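(* Let $\mathcal{S}$, with its subcategories $\mathcal{S}^{sm}$ and $\mathcal{S}^{cl}$, satisfy conditions (i)--(vi) listed in the context. Let $\mathbb{H}_1$ and $\mathbb{H}_2$ be localic triangulated $\mathcal{S}$-fibered categories and let $\mathcal{R}=\{R_S:\mathbb{H}_1(S)\to\mathbb{H}_2(S)\}_{S\in\mathcal{S}}$ be a family of triangulated functors. Then every localic $\mathcal{S}$-structure $\theta$ on $\mathcal{R}$ determines, by restriction (to $\mathcal{S}^{sm}$) and by restriction to $\mathcal{S}^{cl}$ and adjunction, an $\mathcal{S}$-core on $\mathcal{R}$. Conversely, every $\mathcal{S}$-core on $\mathcal{R}$ extends uniquely to a localic $\mathcal{S}$-structure on $\mathcal{R}$ (i.e. it is the $\mathcal{S}$-core determined by a unique localic $\mathcal{S}$-structure).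
   Context: Standing assumptions on $\mathcal{S}$: a small category with two (possibly non-full) subcategories $\mathcal{S}^{sm},\mathcal{S}^{cl}$ such that: (i) both have the same objects as $\mathcal{S}$ and contain all isomorphisms; (ii) for every $p:P\to S$ in $\mathcal{S}^{sm}$ and every $f:T\to S$ in $\mathcal{S}$ the fibered product $P\times_S T$ exists, and every base change of a morphism of $\mathcal{S}^{sm}$ lies in $\mathcal{S}^{sm}$; (iii) in every Cartesian square with sides $z':P_Z\to P$, $p':P_Z\to Z$, $p:P\to S$ in $\mathcal{S}^{sm}$, $z:Z\to S$ in $\mathcal{S}^{cl}$, the morphism $z'$ is in $\mathcal{S}^{cl}$; and if $gz$ is in $\mathcal{S}^{cl}$ then $z$ is in $\mathcal{S}^{cl}$; (iv) every morphism $f$ of $\mathcal{S}$ factors as $f=p\circ t$ with $t$ in $\mathcal{S}^{cl}$, $p$ in $\mathcal{S}^{sm}$; (v) $\mathcal{S}$ has an initial object $\emptyset$; (vi) for every $z:Z\to S$ in $\mathcal{S}^{cl}$ there is a distinguished $u:U\to S$ in $\mathcal{S}^{sm}$ such that for every $T\in\mathcal{S}$ the map $u\circ-:\operatorname{Hom}_{\mathcal{S}}(T,U)\to\operatorname{Hom}_{\mathcal{S}}(T,S)$ identifies $\operatorname{Hom}_{\mathcal{S}}(T,U)$ with the set of those $f:T\to S$ for which the square with sides $\emptyset\to T$, $\emptyset\to Z$, $f$, $z$ is Cartesian; $u$ is called the open immersion complementary to $z$. Morphisms of $\mathcal{S}^{sm}$ are called smooth, morphisms of $\mathcal{S}^{cl}$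 closed immersions. An $\mathcal{S}$-fibered category $\mathbb{H}$: categories $\mathbb{H}(S)$, functors $f^*:\mathbb{H}(S)\to\mathbb{H}(T)$ for $f:T\to S$, and natural isomorphisms $\mathrm{conn}_{f,g}:(gf)^*A\xrightarrow{\sim}f^*g^*A$ with $\mathrm{id}_S^*=\mathrm{id}$ and $f^*\mathrm{conn}_{g,h}\circ\mathrm{conn}_{f,hg}=\mathrm{conn}_{f,g}\circ\mathrm{conn}_{gf,h}$. Composites of connection isomorphisms are written as equalities. It is triangulated if all $\mathbb{H}(S)$ are triangulated categories, all $f^*$ are triangulated functors and all connection isomorphisms are compatible with shifts. A triangulated $\mathbb{H}$ is localic if: (a) $\mathbb{H}(\emptyset)=0$; (b) for every smooth $p$, $p^*$ has a left adjoint $p_\#$, and for every Cartesian square $p f'=f p'$ with $p:P\to S$ smooth, $f:T\to S$, the transformation $p'_\#f'^*A\xrightarrow{\eta}p'_\#f'^*p^*p_\#A=p'_\#p'^*f^*p_\#A\xrightarrow{\epsilon}f^*p_\#A$ is invertible; (c) for every closed immersion $z$, $z^*$ has a right adjoint $z_*$, which is fully faithful; (d) for every closed immersion $z$ with complementary open immersion $u$, the pair $(z^*,u^* )$ is jointly conservative. Adjoints of $\mathrm{id}_S^*$ are chosen to be the identity; the functors $z_*$ together with the isomorphisms $(z_1z_2)_*\simeq z_{1,*}z_{2,*}$ induced by adjunction from the connection isomorphisms make $\mathbb{H}$ an $\mathcal{S}^{cl,op}$-fibered category. For a Cartesian square $p z'=z p'$ with $p:P\to S$ smooth and $z:Z\to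 S$ a closed immersion, the base-change transformation $p^*z_*A\xrightarrow{\eta}z'_*z'^*p^*z_*A=z'_*p'^*z^*z_*A\xrightarrow{\epsilon}z'_*p'^*A$ is invertible when $\mathbb{H}$ is localic. For $\mathcal{S}'=\mathcal{S},\mathcal{S}^{sm},\mathcal{S}^{cl}$, an $\mathcal{S}'$-structure $\theta$ on $\mathcal{R}$ is a system of natural isomorphisms $\theta_f:f^*R_S(A)\xrightarrow{\sim}R_T(f^*A)$, $f:T\to S$ in $\mathcal{S}'$, with $\theta_{gf}=\theta_f\circ f^*\theta_g$ modulo $(gf)^*=f^*g^*$. It is left-adjointable (for $\mathcal{S}'=\mathcal{S}^{sm}$) if for every smooth $p:P\to S$ the composite $p_\#R_P(A)\xrightarrow{\eta}p_\#R_P(p^*p_\#A)\xrightarrow{\theta_p^{-1}}p_\#p^*R_S(p_\#A)\xrightarrow{\epsilon}R_S(p_\#A)$ is invertible. An $\mathcal{S}$-structure is localic if $(\mathcal{R},\theta)$ is a triangulated morphism and its restriction to $\mathcal{S}^{sm}$ is left-adjointable. An $\mathcal{S}^{cl,op}$-structure $\bar\theta^{cl}$ on $\mathcal{R}$ is a system of natural isomorphisms $\bar\theta^{cl}_z:R_S(z_*A)\xrightarrow{\sim}z_*R_Z(A)$ for closed immersions $z:Z\to S$, compatible with composition (its inverses satisfy the cocycle condition above for the functors $z_*$). All structures on $\mathcal{R}$ are understood to be triangulated, i.e. compatible with shifts. Adjunction: from an $\mathcal{S}^{cl}$-structure $\theta^{cl}$ one obtains $\bar\theta^{cl}_z:R_S(z_*B)\xrightarrow{\eta}z_*z^*R_S(z_*B)\xrightarrow{\theta^{cl}_z}z_*R_Z(z^*z_*B)\xrightarrow{\epsilon}z_*R_Z(B)$;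 from an $\mathcal{S}^{cl,op}$-structure one obtains $\theta^{cl}_z:z^*R_S(A)\xrightarrow{\eta}z^*R_S(z_*z^*A)\xrightarrow{\bar\theta^{cl}_z}z^*z_*R_Z(z^*A)\xrightarrow{\epsilon}R_Z(z^*A)$. In the presence of an $\mathcal{S}^{sm}$-structure on $\mathcal{R}$ (left-adjointable, for the second construction) these are invertible. An $\mathcal{S}$-core on $\mathcal{R}$ consists of a left-adjointable $\mathcal{S}^{sm}$-structure $\theta^{sm}$ and an $\mathcal{S}^{cl,op}$-structure $\bar\theta^{cl}$ on $\mathcal{R}$ such that: (C') for every Cartesian square with sides $z':P_Z\to P$, $p':P_Z\to Z$, $p:P\to S$ smooth, $z:Z\to S$ a closed immersion, the composites $$p^*R_S(z_*A)\xrightarrow{\bar\theta^{cl}_z}p^*z_*R_Z(A)\simeq z'_*p'^*R_Z(A)\xrightarrow{\theta^{sm}_{p'}}z'_*R_{P_Z}(p'^*A)$$ and $$p^*R_S(z_*A)\xrightarrow{\theta^{sm}_p}R_P(p^*z_*A)\simeq R_P(z'_*p'^*A)\xrightarrow{\bar\theta^{cl}_{z'}}z'_*R_{P_Z}(p'^*A)$$ coincide ($\simeq$ being the base-change isomorphisms); (T) for every commutative triangle $q=p\circ h$ with $p:P\to S$, $q:Q\to S$ smooth and $h:Q\to P$ a closed immersion, $\theta^{sm}_q:q^*R_S(A)\to R_Q(q^*A)$ coincides, modulo $q^*=h^*p^*$, with $h^*p^*R_S(A)\xrightarrow{\theta^{sm}_p}h^*R_P(p^*A)\xrightarrow{\theta^{cl}_h}R_Q(h^*p^*A)$,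 where $\theta^{cl}$ is obtained from $\bar\theta^{cl}$ by adjunction. *)

theory Defs
  imports "HOL-Algebra.Group"
begin

section \<open>Categories, functors, adjunctions\<close>

record ('o, 'm) precat =
  Ob :: "'o set"
  Arr :: "'m set"
  Dom :: "'m \<Rightarrow> 'o"
  Cod :: "'m \<Rightarrow> 'o"
  Ide :: "'o \<Rightarrow> 'm"
  Comp :: "'m \<Rightarrow> 'm \<Rightarrow> 'm"  (infixr "\<cdot>\<index>" 70)

definition Hom :: "('o, 'm, 'x) precat_scheme \<Rightarrow> 'o \<Rightarrow> 'o \<Rightarrow> 'm set" where
  "Hom C A B = {f \<in> Arr C. Dom C f = A \<and> Cod C f = B}"

locale category =
  fixes C :: "('o, 'm, 'x) precat_scheme" (structure)
  assumes Dom_in: "f \<in> Arr C \<Longrightarrow> Dom C f \<in> Ob C"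
    and Cod_in: "f \<in> Arr C \<Longrightarrow> Cod C f \<in> Ob C"
    and Ide_in: "A \<in> Ob C \<Longrightarrow> Ide C A \<in> Hom C A A"
    and Comp_in: "f \<in> Hom C A B \<Longrightarrow> g \<in> Hom C B D \<Longrightarrow> g \<cdot> f \<in> Hom C A D"
    and Comp_Ide_left: "f \<in> Hom C A B \<Longrightarrow> Ide C B \<cdot> f = f"
    and Comp_Ide_right: "f \<in> Hom C A B \<Longrightarrow> f \<cdot> Ide C A = f"
    and Comp_assoc: "f \<in> Hom C A B \<Longrightarrow> g \<in> Hom C B D \<Longrightarrow> h \<in> Hom C D E \<Longrightarrow>
      (h \<cdot> g) \<cdot> f = h \<cdot> (g \<cdot> f)"

definition inverse_arrows :: "('o, 'm, 'x) precat_scheme \<Rightarrow> 'm \<Rightarrow> 'm \<Rightarrow> bool" where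
  "inverse_arrows C f g \<longleftrightarrow> f \<in> Arr C \<and> g \<in> Hom C (Cod C f) (Dom C f) \<and>
     g \<cdot>\<^bsub>C\<^esub> f = Ide C (Dom C f) \<and> f \<cdot>\<^bsub>C\<^esub> g = Ide C (Cod C f)"

definition is_iso :: "('o, 'm, 'x) precat_scheme \<Rightarrow> 'm \<Rightarrow> bool" where
  "is_iso C f \<longleftrightarrow> (\<exists>g. inverse_arrows C f g)"

definition inv_arr :: "('o, 'm, 'x) precat_scheme \<Rightarrow> 'm \<Rightarrow> 'm" where
  "inv_arr C f = (THE g. inverse_arrows C f g)"

definition initial :: "('o, 'm, 'x) precat_scheme \<Rightarrow> 'o \<Rightarrow> bool" where
  "initial C I \<longleftrightarrow> I \<in> Ob C \<and> (\<forall>A \<in> Ob C. \<exists>!f. f \<in> Hom C I A)"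

definition terminal :: "('o, 'm, 'x) precat_scheme \<Rightarrow> 'o \<Rightarrow> bool" where
  "terminal C I \<longleftrightarrow> I \<in> Ob C \<and> (\<forall>A \<in> Ob C. \<exists>!f. f \<in> Hom C A I)"

definition zero_object :: "('o, 'm, 'x) precat_scheme \<Rightarrow> 'o \<Rightarrow> bool" where
  "zero_object C I \<longleftrightarrow> initial C I \<and> terminal C I"

text \<open>\<open>cartesian C f g f' g'\<close>: the square \<open>f \<cdot> g' = g \<cdot> f'\<close> is Cartesian, where \<open>f'\<close> is the base
  change of \<open>f\<close> along \<open>g\<close> and \<open>g'\<close> is the base change of \<open>g\<close> along \<open>f\<close>.\<close>

definition cartesian ::
  "('o, 'm, 'x) precat_scheme \<Rightarrow> 'm \<Rightarrow> 'm \<Rightarrow> 'm \<Rightarrow> 'm \<Rightarrow> bool" where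
  "cartesian C f g f' g' \<longleftrightarrow>
     f \<in> Arr C \<and> g \<in> Arr C \<and> f' \<in> Arr C \<and> g' \<in> Arr C \<and>
     Cod C f = Cod C g \<and> Dom C f' = Dom C g' \<and> Cod C g' = Dom C f \<and> Cod C f' = Dom C g \<and>
     f \<cdot>\<^bsub>C\<^esub> g' = g \<cdot>\<^bsub>C\<^esub> f' \<and>
     (\<forall>W \<in> Ob C. \<forall>a \<in> Hom C W (Dom C f). \<forall>b \<in> Hom C W (Dom C g).
        f \<cdot>\<^bsub>C\<^esub> a = g \<cdot>\<^bsub>C\<^esub> b \<longrightarrow>
        (\<exists>!m. m \<in> Hom C W (Dom C f') \<and> g' \<cdot>\<^bsub>C\<^esub> m = a \<and> f' \<cdot>\<^bsub>C\<^esub> m = b))"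

record ('o1, 'm1, 'o2, 'm2) fctr =
  fo :: "'o1 \<Rightarrow> 'o2"
  fm :: "'m1 \<Rightarrow> 'm2"

locale cat_functor = dom: category C + cod: category D
  for C :: "('o1, 'm1, 'x) precat_scheme" and D :: "('o2, 'm2, 'y) precat_scheme" +
  fixes F :: "('o1, 'm1, 'o2, 'm2, 'z) fctr_scheme"
  assumes fo_in: "A \<in> Ob C \<Longrightarrow> fo F A \<in> Ob D"
    and fm_in: "f \<in> Hom C A B \<Longrightarrow> fm F f \<in> Hom D (fo F A) (fo F B)"
    and fm_Ide: "A \<in> Ob C \<Longrightarrow> fm F (Ide C A) = Ide D (fo F A)"
    and fm_Comp: "f \<in> Hom C A B \<Longrightarrow> g \<in> Hom C B E \<Longrightarrow>
      fm F (g \<cdot>\<^bsub>C\<^esub> f) = fm F g \<cdot>\<^bsub>D\<^esub> fm F f"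

definition fully_faithful ::
  "('o1, 'm1, 'x) precat_scheme \<Rightarrow> ('o2, 'm2, 'y) precat_scheme \<Rightarrow>
   ('o1, 'm1, 'o2, 'm2, 'z) fctr_scheme \<Rightarrow> bool" where
  "fully_faithful C D F \<longleftrightarrow>
     (\<forall>A \<in> Ob C. \<forall>B \<in> Ob C. bij_betw (fm F) (Hom C A B) (Hom D (fo F A) (fo F B)))"

definition essentially_surjective ::
  "('o1, 'm1, 'x) precat_scheme \<Rightarrow> ('o2, 'm2, 'y) precat_scheme \<Rightarrow>
   ('o1, 'm1, 'o2, 'm2, 'z) fctr_scheme \<Rightarrow> bool" where
  "essentially_surjective C D F \<longleftrightarrow>
     (\<forall>B \<in> Ob D. \<exists>A \<in> Ob C. \<exists>f \<in> Hom D (fo F A) B. is_iso D f)"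

definition nat_trans ::
  "('o1, 'm1, 'x) precat_scheme \<Rightarrow> ('o2, 'm2, 'y) precat_scheme \<Rightarrow>
   ('o1, 'm1, 'o2, 'm2, 'z) fctr_scheme \<Rightarrow> ('o1, 'm1, 'o2, 'm2, 'w) fctr_scheme \<Rightarrow>
   ('o1 \<Rightarrow> 'm2) \<Rightarrow> bool" where
  "nat_trans C D F G \<alpha> \<longleftrightarrow>
     (\<forall>A \<in> Ob C. \<alpha> A \<in> Hom D (fo F A) (fo G A)) \<and>
     (\<forall>A \<in> Ob C. \<forall>B \<in> Ob C. \<forall>f \<in> Hom C A B. \<alpha> B \<cdot>\<^bsub>D\<^esub> fm F f = fm G f \<cdot>\<^bsub>D\<^esub> \<alpha> A)"

definition nat_iso ::
  "('o1, 'm1, 'x) precat_scheme \<Rightarrow> ('o2, 'm2, 'y) precat_scheme \<Rightarrow>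
   ('o1, 'm1, 'o2, 'm2, 'z) fctr_scheme \<Rightarrow> ('o1, 'm1, 'o2, 'm2, 'w) fctr_scheme \<Rightarrow>
   ('o1 \<Rightarrow> 'm2) \<Rightarrow> bool" where
  "nat_iso C D F G \<alpha> \<longleftrightarrow> nat_trans C D F G \<alpha> \<and> (\<forall>A \<in> Ob C. is_iso D (\<alpha> A))"

definition id_fctr :: "('o, 'm, 'o, 'm) fctr" where
  "id_fctr = \<lparr>fo = (\<lambda>A. A), fm = (\<lambda>f. f)\<rparr>"

definition comp_fctr ::
  "('o2, 'm2, 'o3, 'm3, 'z) fctr_scheme \<Rightarrow> ('o1, 'm1, 'o2, 'm2, 'w) fctr_scheme \<Rightarrow>
   ('o1, 'm1, 'o3, 'm3) fctr" where
  "comp_fctr G F = \<lparr>fo = (\<lambda>A. fo G (fo F A)), fm = (\<lambda>f. fm G (fm F f))\<rparr>"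

text \<open>\<open>F : C \<rightarrow> D\<close> is left adjoint to \<open>G : D \<rightarrow> C\<close>, with unit \<open>\<eta>\<close> and counit \<open>\<epsilon>\<close>.\<close>

locale adjunction = left: cat_functor C D F + right: cat_functor D C G
  for C :: "('o1, 'm1, 'x) precat_scheme" and D :: "('o2, 'm2, 'y) precat_scheme"
    and F :: "('o1, 'm1, 'o2, 'm2, 'z) fctr_scheme"
    and G :: "('o2, 'm2, 'o1, 'm1, 'w) fctr_scheme" +
  fixes \<eta> :: "'o1 \<Rightarrow> 'm1" and \<epsilon> :: "'o2 \<Rightarrow> 'm2"
  assumes unit_nat: "nat_trans C C id_fctr (comp_fctr G F) \<eta>"
    and counit_nat: "nat_trans D D (comp_fctr F G) id_fctr \<epsilon>"
    and triangle_left: "A \<in> Ob C \<Longrightarrow> \<epsilon> (fo F A) \<cdot>\<^bsub>D\<^esub> fm F (\<eta> A) = Ide D (fo F A)"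
    and triangle_right: "B \<in> Ob D \<Longrightarrow> fm G (\<epsilon> B) \<cdot>\<^bsub>C\<^esub> \<eta> (fo G B) = Ide C (fo G B)"


section \<open>Triangulated categories and triangulated functors\<close>

record ('o, 'm) tricat = "('o, 'm) precat" +
  Add :: "'m \<Rightarrow> 'm \<Rightarrow> 'm"
  Zero :: "'o \<Rightarrow> 'o \<Rightarrow> 'm"
  Shift :: "('o, 'm, 'o, 'm) fctr"
  Dist :: "('m \<times> 'm \<times> 'm) set"

definition hom_group :: "('o, 'm, 'x) tricat_scheme \<Rightarrow> 'o \<Rightarrow> 'o \<Rightarrow> 'm monoid" where
  "hom_group C A B = \<lparr>carrier = Hom C A B, mult = Add C, one = Zero C A B\<rparr>"

definition neg_arr :: "('o, 'm, 'x) tricat_scheme \<Rightarrow> 'm \<Rightarrow> 'm" where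
  "neg_arr C f = inv\<^bsub>hom_group C (Dom C f) (Cod C f)\<^esub> f"

locale additive_category = category C
  for C :: "('o, 'm, 'x) tricat_scheme" (structure) +
  assumes hom_comm_group: "A \<in> Ob C \<Longrightarrow> B \<in> Ob C \<Longrightarrow> comm_group (hom_group C A B)"
    and Comp_Add_right: "f \<in> Hom C A B \<Longrightarrow> f' \<in> Hom C A B \<Longrightarrow> g \<in> Hom C B D \<Longrightarrow>
      g \<cdot> Add C f f' = Add C (g \<cdot> f) (g \<cdot> f')"
    and Comp_Add_left: "f \<in> Hom C A B \<Longrightarrow> g \<in> Hom C B D \<Longrightarrow> g' \<in> Hom C B D \<Longrightarrow>
      Add C g g' \<cdot> f = Add C (g \<cdot> f) (g' \<cdot> f)"
    and zero_object_exists: "\<exists>N. zero_object C N"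
    and biproduct_exists: "A \<in> Ob C \<Longrightarrow> B \<in> Ob C \<Longrightarrow>
      \<exists>P \<in> Ob C. \<exists>i \<in> Hom C A P. \<exists>j \<in> Hom C B P. \<exists>p \<in> Hom C P A. \<exists>q \<in> Hom C P B.
        p \<cdot> i = Ide C A \<and> q \<cdot> j = Ide C B \<and> p \<cdot> j = Zero C B A \<and> q \<cdot> i = Zero C A B \<and>
        Add C (i \<cdot> p) (j \<cdot> q) = Ide C P"

definition additive_functor ::
  "('o1, 'm1, 'x) tricat_scheme \<Rightarrow> ('o2, 'm2, 'y) tricat_scheme \<Rightarrow>
   ('o1, 'm1, 'o2, 'm2, 'z) fctr_scheme \<Rightarrow> bool" where
  "additive_functor C D F \<longleftrightarrow> cat_functor C D F \<and>
     (\<forall>A \<in> Ob C. \<forall>B \<in> Ob C. \<forall>f \<in> Hom C A B. \<forall>g \<in> Hom C A B.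
        fm F (Add C f g) = Add D (fm F f) (fm F g))"

definition is_triangle :: "('o, 'm, 'x) tricat_scheme \<Rightarrow> 'm \<times> 'm \<times> 'm \<Rightarrow> bool" where
  "is_triangle C t \<longleftrightarrow> (case t of (f, g, h) \<Rightarrow>
     f \<in> Arr C \<and> g \<in> Arr C \<and> h \<in> Arr C \<and> Cod C f = Dom C g \<and> Cod C g = Dom C h \<and>
     Cod C h = fo (Shift C) (Dom C f))"

definition triangle_morphism ::
  "('o, 'm, 'x) tricat_scheme \<Rightarrow> 'm \<times> 'm \<times> 'm \<Rightarrow> 'm \<times> 'm \<times> 'm \<Rightarrow> 'm \<Rightarrow> 'm \<Rightarrow> 'm \<Rightarrow> bool" where
  "triangle_morphism C t t' a b c \<longleftrightarrow> (case t of (f, g, h) \<Rightarrow> case t' of (f', g', h') \<Rightarrow>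
     a \<in> Hom C (Dom C f) (Dom C f') \<and> b \<in> Hom C (Dom C g) (Dom C g') \<and>
     c \<in> Hom C (Dom C h) (Dom C h') \<and>
     b \<cdot>\<^bsub>C\<^esub> f = f' \<cdot>\<^bsub>C\<^esub> a \<and> c \<cdot>\<^bsub>C\<^esub> g = g' \<cdot>\<^bsub>C\<^esub> b \<and>
     fm (Shift C) a \<cdot>\<^bsub>C\<^esub> h = h' \<cdot>\<^bsub>C\<^esub> c)"

locale triangulated_category = additive_category C
  for C :: "('o, 'm, 'x) tricat_scheme" (structure) +
  assumes shift_additive: "additive_functor C C (Shift C)"
    and shift_fully_faithful: "fully_faithful C C (Shift C)"
    and shift_essentially_surjective: "essentially_surjective C C (Shift C)"
    and Dist_triangle: "t \<in> Dist C \<Longrightarrow> is_triangle C t"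
    and TR1_iso: "t \<in> Dist C \<Longrightarrow> is_triangle C t' \<Longrightarrow> triangle_morphism C t t' a b c \<Longrightarrow>
      is_iso C a \<Longrightarrow> is_iso C b \<Longrightarrow> is_iso C c \<Longrightarrow> t' \<in> Dist C"
    and TR1_Ide: "X \<in> Ob C \<Longrightarrow> zero_object C N \<Longrightarrow>
      (Ide C X, Zero C X N, Zero C N (fo (Shift C) X)) \<in> Dist C"
    and TR1_cone: "f \<in> Arr C \<Longrightarrow> \<exists>g h. (f, g, h) \<in> Dist C"
    and TR2: "is_triangle C (f, g, h) \<Longrightarrow>
      (f, g, h) \<in> Dist C \<longleftrightarrow> (g, h, neg_arr C (fm (Shift C) f)) \<in> Dist C"
    and TR3: "(f, g, h) \<in> Dist C \<Longrightarrow> (f', g', h') \<in> Dist C \<Longrightarrow>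
      a \<in> Hom C (Dom C f) (Dom C f') \<Longrightarrow> b \<in> Hom C (Cod C f) (Cod C f') \<Longrightarrow> b \<cdot> f = f' \<cdot> a \<Longrightarrow>
      \<exists>c. triangle_morphism C (f, g, h) (f', g', h') a b c"
    and TR4: "f \<in> Hom C X Y \<Longrightarrow> g \<in> Hom C Y Z \<Longrightarrow>
      (f, i, j) \<in> Dist C \<Longrightarrow> (g, k, l) \<in> Dist C \<Longrightarrow> (g \<cdot> f, m, n) \<in> Dist C \<Longrightarrow>
      \<exists>s t. (s, t, fm (Shift C) i \<cdot> l) \<in> Dist C \<and>
        triangle_morphism C (f, i, j) (g \<cdot> f, m, n) (Ide C X) g s \<and>
        triangle_morphism C (g \<cdot> f, m, n) (g, k, l) f (Ide C Z) t"

text \<open>A triangulated functor carries as data the isomorphism \<open>fs F A : F(A[1]) \<rightarrow> (F A)[1]\<close>.\<close>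

record ('o1, 'm1, 'o2, 'm2) tfctr = "('o1, 'm1, 'o2, 'm2) fctr" +
  fs :: "'o1 \<Rightarrow> 'm2"

definition triangulated_functor ::
  "('o1, 'm1, 'x) tricat_scheme \<Rightarrow> ('o2, 'm2, 'y) tricat_scheme \<Rightarrow>
   ('o1, 'm1, 'o2, 'm2, 'z) tfctr_scheme \<Rightarrow> bool" where
  "triangulated_functor C D F \<longleftrightarrow> additive_functor C D F \<and>
     nat_iso C D (comp_fctr F (Shift C)) (comp_fctr (Shift D) F) (fs F) \<and>
     (\<forall>f g h. (f, g, h) \<in> Dist C \<longrightarrow>
        (fm F f, fm F g, fs F (Dom C f) \<cdot>\<^bsub>D\<^esub> fm F h) \<in> Dist D)"

definition id_tfctr :: "('o, 'm, 'x) tricat_scheme \<Rightarrow> ('o, 'm, 'o, 'm) tfctr" where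
  "id_tfctr C = \<lparr>fo = (\<lambda>A. A), fm = (\<lambda>f. f), fs = (\<lambda>A. Ide C (fo (Shift C) A))\<rparr>"

text \<open>In \<open>comp_tfctr E G F\<close> the category \<open>E\<close> is the target of \<open>G\<close>.\<close>

definition comp_tfctr ::
  "('o3, 'm3, 'x) tricat_scheme \<Rightarrow> ('o2, 'm2, 'o3, 'm3, 'z) tfctr_scheme \<Rightarrow>
   ('o1, 'm1, 'o2, 'm2, 'w) tfctr_scheme \<Rightarrow> ('o1, 'm1, 'o3, 'm3) tfctr" where
  "comp_tfctr E G F = \<lparr>fo = (\<lambda>A. fo G (fo F A)), fm = (\<lambda>f. fm G (fm F f)),
     fs = (\<lambda>A. fs G (fo F A) \<cdot>\<^bsub>E\<^esub> fm G (fs F A))\<rparr>"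

text \<open>Equality of functors on \<open>C\<close>, that is, disregarding values outside the carriers.\<close>

definition fctr_eq ::
  "('o1, 'm1, 'x) precat_scheme \<Rightarrow> ('o1, 'm1, 'o2, 'm2, 'z) fctr_scheme \<Rightarrow>
   ('o1, 'm1, 'o2, 'm2, 'w) fctr_scheme \<Rightarrow> bool" where
  "fctr_eq C F G \<longleftrightarrow> (\<forall>A \<in> Ob C. fo F A = fo G A) \<and> (\<forall>f \<in> Arr C. fm F f = fm G f)"

definition tfctr_eq ::
  "('o1, 'm1, 'x) precat_scheme \<Rightarrow> ('o1, 'm1, 'o2, 'm2, 'z) tfctr_scheme \<Rightarrow>
   ('o1, 'm1, 'o2, 'm2, 'w) tfctr_scheme \<Rightarrow> bool" where
  "tfctr_eq C F G \<longleftrightarrow> fctr_eq C F G \<and> (\<forall>A \<in> Ob C. fs F A = fs G A)"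

text \<open>Natural isomorphisms of triangulated functors that are compatible with shifts.\<close>

definition tri_nat_iso ::
  "('o1, 'm1, 'x) tricat_scheme \<Rightarrow> ('o2, 'm2, 'y) tricat_scheme \<Rightarrow>
   ('o1, 'm1, 'o2, 'm2, 'z) tfctr_scheme \<Rightarrow> ('o1, 'm1, 'o2, 'm2, 'w) tfctr_scheme \<Rightarrow>
   ('o1 \<Rightarrow> 'm2) \<Rightarrow> bool" where
  "tri_nat_iso C D F G \<alpha> \<longleftrightarrow> nat_iso C D F G \<alpha> \<and>
     (\<forall>A \<in> Ob C. fs G A \<cdot>\<^bsub>D\<^esub> \<alpha> (fo (Shift C) A) = fm (Shift D) (\<alpha> A) \<cdot>\<^bsub>D\<^esub> fs F A)"


section \<open>The base category\<close>

text \<open>The chosen initial object and, for each closed immersion \<open>z\<close>, the distinguished complementary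
  open immersion \<open>Opn z\<close> are part of the data.\<close>

record ('s, 'a) basecat = "('s, 'a) precat" +
  Sm :: "'a set"
  Cl :: "'a set"
  Emp :: 's
  Opn :: "'a \<Rightarrow> 'a"

locale base_category = category S
  for S :: "('s, 'a, 'x) basecat_scheme" (structure) +
  assumes Sm_Arr: "Sm S \<subseteq> Arr S"
    and Cl_Arr: "Cl S \<subseteq> Arr S"
    and Sm_Comp: "p \<in> Sm S \<Longrightarrow> q \<in> Sm S \<Longrightarrow> Cod S p = Dom S q \<Longrightarrow> q \<cdot> p \<in> Sm S"
    and Cl_Comp: "y \<in> Cl S \<Longrightarrow> z \<in> Cl S \<Longrightarrow> Cod S y = Dom S z \<Longrightarrow> z \<cdot> y \<in> Cl S"
    and Sm_iso: "is_iso S f \<Longrightarrow> f \<in> Sm S"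
    and Cl_iso: "is_iso S f \<Longrightarrow> f \<in> Cl S"
    and Sm_pullback_exists: "p \<in> Sm S \<Longrightarrow> f \<in> Arr S \<Longrightarrow> Cod S f = Cod S p \<Longrightarrow>
      \<exists>p' f'. cartesian S p f p' f'"
    and Sm_base_change: "p \<in> Sm S \<Longrightarrow> cartesian S p f p' f' \<Longrightarrow> p' \<in> Sm S"
    and Cl_base_change: "p \<in> Sm S \<Longrightarrow> z \<in> Cl S \<Longrightarrow> cartesian S p z p' z' \<Longrightarrow> z' \<in> Cl S"
    and Cl_cancel: "z \<in> Arr S \<Longrightarrow> g \<in> Arr S \<Longrightarrow> Cod S z = Dom S g \<Longrightarrow> g \<cdot> z \<in> Cl S \<Longrightarrow> z \<in> Cl S"
    and factorization: "f \<in> Arr S \<Longrightarrow>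
      \<exists>t \<in> Cl S. \<exists>p \<in> Sm S. Cod S t = Dom S p \<and> f = p \<cdot> t"
    and Emp_initial: "initial S (Emp S)"
    and Opn_Sm: "z \<in> Cl S \<Longrightarrow> Opn S z \<in> Sm S"
    and Cod_Opn: "z \<in> Cl S \<Longrightarrow> Cod S (Opn S z) = Cod S z"
    and Opn_universal: "z \<in> Cl S \<Longrightarrow> T \<in> Ob S \<Longrightarrow>
      bij_betw (\<lambda>g. Opn S z \<cdot> g) (Hom S T (Dom S (Opn S z)))
        {f \<in> Hom S T (Cod S z).
          \<exists>i \<in> Hom S (Emp S) (Dom S z). \<exists>j \<in> Hom S (Emp S) T. cartesian S f z i j}"


section \<open>Localic triangulated fibered categories\<close>

text \<open>\<open>fib H X\<close> is the category over \<open>X\<close>, \<open>pull H f\<close> is \<open>f\<^sup>*\<close>, and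
  \<open>conn H f g A : (g \<cdot> f)\<^sup>* A \<rightarrow> f\<^sup>* (g\<^sup>* A)\<close>.\<close>

record ('s, 'a, 'o, 'm) fibcat =
  fib :: "'s \<Rightarrow> ('o, 'm) tricat"
  pull :: "'a \<Rightarrow> ('o, 'm, 'o, 'm) tfctr"
  conn :: "'a \<Rightarrow> 'a \<Rightarrow> 'o \<Rightarrow> 'm"

locale tri_fibered_category = category S
  for S :: "('s, 'a, 'x) precat_scheme" (structure)
    and H :: "('s, 'a, 'o, 'm, 'y) fibcat_scheme" +
  assumes fib_triangulated: "X \<in> Ob S \<Longrightarrow> triangulated_category (fib H X)"
    and pull_triangulated: "f \<in> Hom S Y X \<Longrightarrow>
      triangulated_functor (fib H X) (fib H Y) (pull H f)"
    and pull_Ide: "X \<in> Ob S \<Longrightarrow> tfctr_eq (fib H X) (pull H (Ide S X)) (id_tfctr (fib H X))"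
    and conn_iso: "f \<in> Hom S Y X \<Longrightarrow> g \<in> Hom S X V \<Longrightarrow>
      tri_nat_iso (fib H V) (fib H Y)
        (pull H (g \<cdot> f)) (comp_tfctr (fib H Y) (pull H f) (pull H g)) (conn H f g)"
    and conn_cocycle: "f \<in> Hom S Y X \<Longrightarrow> g \<in> Hom S X V \<Longrightarrow> h \<in> Hom S V W \<Longrightarrow> A \<in> Ob (fib H W) \<Longrightarrow>
      fm (pull H f) (conn H g h A) \<cdot>\<^bsub>fib H Y\<^esub> conn H f (h \<cdot> g) A =
      conn H f g (fo (pull H h) A) \<cdot>\<^bsub>fib H Y\<^esub> conn H (g \<cdot> f) h A"

text \<open>Chosen adjoints, only meaningful where they are required to exist: \<open>sharp H p\<close> is the left
  adjoint \<open>p\<^sub>#\<close> of \<open>p\<^sup>*\<close> for \<open>p\<close> smooth, and \<open>push H z\<close> is the right adjoint \<open>z\<^sub>*\<close> of \<open>z\<^sup>*\<close> for \<open>z\<close> a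
  closed immersion.\<close>

record ('s, 'a, 'o, 'm) fibcat_adj = "('s, 'a, 'o, 'm) fibcat" +
  sharp :: "'a \<Rightarrow> ('o, 'm, 'o, 'm) fctr"
  sharp_unit :: "'a \<Rightarrow> 'o \<Rightarrow> 'm"
  sharp_counit :: "'a \<Rightarrow> 'o \<Rightarrow> 'm"
  push :: "'a \<Rightarrow> ('o, 'm, 'o, 'm) fctr"
  push_unit :: "'a \<Rightarrow> 'o \<Rightarrow> 'm"
  push_counit :: "'a \<Rightarrow> 'o \<Rightarrow> 'm"

text \<open>For a commutative square \<open>b \<cdot> a = d \<cdot> c\<close>, the isomorphism
  \<open>a\<^sup>* (b\<^sup>* A) \<simeq> (b \<cdot> a)\<^sup>* A = (d \<cdot> c)\<^sup>* A \<simeq> c\<^sup>* (d\<^sup>* A)\<close>.\<close>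

definition exchange ::
  "('s, 'a, 'x) precat_scheme \<Rightarrow> ('s, 'a, 'o, 'm, 'y) fibcat_scheme \<Rightarrow>
   'a \<Rightarrow> 'a \<Rightarrow> 'a \<Rightarrow> 'a \<Rightarrow> 'o \<Rightarrow> 'm" where
  "exchange S H a b c d A =
     conn H c d A \<cdot>\<^bsub>fib H (Dom S a)\<^esub> inv_arr (fib H (Dom S a)) (conn H a b A)"

text \<open>For \<open>p \<cdot> f' = f \<cdot> p'\<close>, the transformation
  \<open>p'\<^sub># f'\<^sup>* A \<rightarrow> p'\<^sub># f'\<^sup>* p\<^sup>* p\<^sub># A = p'\<^sub># p'\<^sup>* f\<^sup>* p\<^sub># A \<rightarrow> f\<^sup>* p\<^sub># A\<close>.\<close>

definition sharp_base_change ::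
  "('s, 'a, 'x) precat_scheme \<Rightarrow> ('s, 'a, 'o, 'm, 'y) fibcat_adj_scheme \<Rightarrow>
   'a \<Rightarrow> 'a \<Rightarrow> 'a \<Rightarrow> 'a \<Rightarrow> 'o \<Rightarrow> 'm" where
  "sharp_base_change S H p f p' f' A =
     sharp_counit H p' (fo (pull H f) (fo (sharp H p) A)) \<cdot>\<^bsub>fib H (Dom S f)\<^esub>
     fm (sharp H p') (exchange S H f' p p' f (fo (sharp H p) A)) \<cdot>\<^bsub>fib H (Dom S f)\<^esub>
     fm (sharp H p') (fm (pull H f') (sharp_unit H p A))"

text \<open>For \<open>p \<cdot> z' = z \<cdot> p'\<close>, the transformation
  \<open>p\<^sup>* z\<^sub>* A \<rightarrow> z'\<^sub>* z'\<^sup>* p\<^sup>* z\<^sub>* A = z'\<^sub>* p'\<^sup>* z\<^sup>* z\<^sub>* A \<rightarrow> z'\<^sub>* p'\<^sup>* A\<close>.\<close>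

definition push_base_change ::
  "('s, 'a, 'x) precat_scheme \<Rightarrow> ('s, 'a, 'o, 'm, 'y) fibcat_adj_scheme \<Rightarrow>
   'a \<Rightarrow> 'a \<Rightarrow> 'a \<Rightarrow> 'a \<Rightarrow> 'o \<Rightarrow> 'm" where
  "push_base_change S H p z p' z' A =
     fm (push H z') (fm (pull H p') (push_counit H z A)) \<cdot>\<^bsub>fib H (Dom S p)\<^esub>
     fm (push H z') (exchange S H z' p p' z (fo (push H z) A)) \<cdot>\<^bsub>fib H (Dom S p)\<^esub>
     push_unit H z' (fo (pull H p) (fo (push H z) A))"

text \<open>The isomorphism \<open>(y \<cdot> z)\<^sub>* A \<rightarrow> y\<^sub>* (z\<^sub>* A)\<close> induced by adjunction from \<open>conn H z y\<close>:
  \<open>(y \<cdot> z)\<^sub>* A \<rightarrow> y\<^sub>* y\<^sup>* (y \<cdot> z)\<^sub>* A \<rightarrow> y\<^sub>* z\<^sub>* z\<^sup>* y\<^sup>* (y \<cdot> z)\<^sub>* A \<simeq> y\<^sub>* z\<^sub>* (y \<cdot> z)\<^sup>* (y \<cdot> z)\<^sub>* A \<rightarrow> y\<^sub>* z\<^sub>* A\<close>.\<close>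

definition push_conn ::
  "('s, 'a, 'x) precat_scheme \<Rightarrow> ('s, 'a, 'o, 'm, 'y) fibcat_adj_scheme \<Rightarrow>
   'a \<Rightarrow> 'a \<Rightarrow> 'o \<Rightarrow> 'm" where
  "push_conn S H y z A =
    (let B = fo (push H (y \<cdot>\<^bsub>S\<^esub> z)) A in
     fm (push H y) (fm (push H z) (push_counit H (y \<cdot>\<^bsub>S\<^esub> z) A)) \<cdot>\<^bsub>fib H (Cod S y)\<^esub>
     fm (push H y) (fm (push H z) (inv_arr (fib H (Dom S z)) (conn H z y B))) \<cdot>\<^bsub>fib H (Cod S y)\<^esub>
     fm (push H y) (push_unit H z (fo (pull H y) B)) \<cdot>\<^bsub>fib H (Cod S y)\<^esub>
     push_unit H y B)"

text \<open>\<open>z\<^sub>*\<close> as a triangulated functor; its shift isomorphism \<open>z\<^sub>* (A[1]) \<rightarrow> (z\<^sub>* A)[1]\<close> is the inverse of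
  \<open>(z\<^sub>* A)[1] \<rightarrow> z\<^sub>* z\<^sup>* ((z\<^sub>* A)[1]) \<simeq> z\<^sub>* ((z\<^sup>* z\<^sub>* A)[1]) \<rightarrow> z\<^sub>* (A[1])\<close>.\<close>

definition tpush ::
  "('s, 'a, 'x) precat_scheme \<Rightarrow> ('s, 'a, 'o, 'm, 'y) fibcat_adj_scheme \<Rightarrow>
   'a \<Rightarrow> ('o, 'm, 'o, 'm) tfctr" where
  "tpush S H z =
    (let C = fib H (Cod S z); D = fib H (Dom S z) in
     \<lparr>fo = fo (push H z), fm = fm (push H z),
      fs = (\<lambda>A. inv_arr C
        (fm (push H z) (fm (Shift D) (push_counit H z A)) \<cdot>\<^bsub>C\<^esub>
         fm (push H z) (fs (pull H z) (fo (push H z) A)) \<cdot>\<^bsub>C\<^esub>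
         push_unit H z (fo (Shift C) (fo (push H z) A))))\<rparr>)"

locale localic_fibered_category = tri_fibered_category S H
  for S :: "('s, 'a, 'x) basecat_scheme" (structure)
    and H :: "('s, 'a, 'o, 'm, 'y) fibcat_adj_scheme" +
  assumes fib_Emp: "A \<in> Ob (fib H (Emp S)) \<Longrightarrow> zero_object (fib H (Emp S)) A"
    and sharp_adjunction: "p \<in> Sm S \<Longrightarrow>
      adjunction (fib H (Dom S p)) (fib H (Cod S p))
        (sharp H p) (pull H p) (sharp_unit H p) (sharp_counit H p)"
    and sharp_base_change_iso: "p \<in> Sm S \<Longrightarrow> cartesian S p f p' f' \<Longrightarrow> A \<in> Ob (fib H (Dom S p)) \<Longrightarrow>
      is_iso (fib H (Dom S f)) (sharp_base_change S H p f p' f' A)"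
    and push_adjunction: "z \<in> Cl S \<Longrightarrow>
      adjunction (fib H (Cod S z)) (fib H (Dom S z))
        (pull H z) (push H z) (push_unit H z) (push_counit H z)"
    and push_fully_faithful: "z \<in> Cl S \<Longrightarrow>
      fully_faithful (fib H (Dom S z)) (fib H (Cod S z)) (push H z)"
    and jointly_conservative: "z \<in> Cl S \<Longrightarrow> \<alpha> \<in> Arr (fib H (Cod S z)) \<Longrightarrow>
      is_iso (fib H (Dom S z)) (fm (pull H z) \<alpha>) \<Longrightarrow>
      is_iso (fib H (Dom S (Opn S z))) (fm (pull H (Opn S z)) \<alpha>) \<Longrightarrow>
      is_iso (fib H (Cod S z)) \<alpha>"
    and sharp_Ide: "X \<in> Ob S \<Longrightarrow> fctr_eq (fib H X) (sharp H (Ide S X)) id_fctr"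
    and sharp_Ide_unit: "X \<in> Ob S \<Longrightarrow> A \<in> Ob (fib H X) \<Longrightarrow>
      sharp_unit H (Ide S X) A = Ide (fib H X) A \<and> sharp_counit H (Ide S X) A = Ide (fib H X) A"
    and push_Ide: "X \<in> Ob S \<Longrightarrow> fctr_eq (fib H X) (push H (Ide S X)) id_fctr"
    and push_Ide_unit: "X \<in> Ob S \<Longrightarrow> A \<in> Ob (fib H X) \<Longrightarrow>
      push_unit H (Ide S X) A = Ide (fib H X) A \<and> push_counit H (Ide S X) A = Ide (fib H X) A"


section \<open>Structures on a family of triangulated functors, and cores\<close>

text \<open>For the subcategory of \<open>S\<close> with class of arrows \<open>K\<close>, a \<open>K\<close>-structure \<open>\<theta>\<close> is a system of
  isomorphisms \<open>\<theta> f A : f\<^sup>* (R\<^sub>X A) \<rightarrow> R\<^sub>Y (f\<^sup>* A)\<close> for \<open>f : Y \<rightarrow> X\<close> in \<open>K\<close>. Only the values at \<open>f \<in> K\<close> and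
  at objects \<open>A\<close> over \<open>X\<close> matter, so that restriction to a smaller class does not change \<open>\<theta>\<close> as a
  HOL function.\<close>

definition pull_structure ::
  "('s, 'a, 'x) precat_scheme \<Rightarrow> ('s, 'a, 'o1, 'm1, 'y) fibcat_scheme \<Rightarrow>
   ('s, 'a, 'o2, 'm2, 'z) fibcat_scheme \<Rightarrow> ('s \<Rightarrow> ('o1, 'm1, 'o2, 'm2) tfctr) \<Rightarrow>
   'a set \<Rightarrow> ('a \<Rightarrow> 'o1 \<Rightarrow> 'm2) \<Rightarrow> bool" where
  "pull_structure S H1 H2 R K \<theta> \<longleftrightarrow>
     (\<forall>f \<in> K. tri_nat_iso (fib H1 (Cod S f)) (fib H2 (Dom S f))
        (comp_tfctr (fib H2 (Dom S f)) (pull H2 f) (R (Cod S f)))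
        (comp_tfctr (fib H2 (Dom S f)) (R (Dom S f)) (pull H1 f)) (\<theta> f)) \<and>
     (\<forall>f \<in> K. \<forall>g \<in> K. Cod S f = Dom S g \<longrightarrow> (\<forall>A \<in> Ob (fib H1 (Cod S g)).
        fm (R (Dom S f)) (conn H1 f g A) \<cdot>\<^bsub>fib H2 (Dom S f)\<^esub> \<theta> (g \<cdot>\<^bsub>S\<^esub> f) A =
        \<theta> f (fo (pull H1 g) A) \<cdot>\<^bsub>fib H2 (Dom S f)\<^esub> fm (pull H2 f) (\<theta> g A) \<cdot>\<^bsub>fib H2 (Dom S f)\<^esub>
          conn H2 f g (fo (R (Cod S g)) A)))"

text \<open>The composite \<open>p\<^sub># R\<^sub>P A \<rightarrow> p\<^sub># R\<^sub>P p\<^sup>* p\<^sub># A \<rightarrow> p\<^sub># p\<^sup>* R\<^sub>X p\<^sub># A \<rightarrow> R\<^sub>X p\<^sub># A\<close>, where the middle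
  arrow is induced by the inverse of \<open>\<theta> p\<close>.\<close>

definition sharp_mate ::
  "('s, 'a, 'x) precat_scheme \<Rightarrow> ('s, 'a, 'o1, 'm1, 'y) fibcat_adj_scheme \<Rightarrow>
   ('s, 'a, 'o2, 'm2, 'z) fibcat_adj_scheme \<Rightarrow> ('s \<Rightarrow> ('o1, 'm1, 'o2, 'm2) tfctr) \<Rightarrow>
   ('a \<Rightarrow> 'o1 \<Rightarrow> 'm2) \<Rightarrow> 'a \<Rightarrow> 'o1 \<Rightarrow> 'm2" where
  "sharp_mate S H1 H2 R \<theta> p A =
     sharp_counit H2 p (fo (R (Cod S p)) (fo (sharp H1 p) A)) \<cdot>\<^bsub>fib H2 (Cod S p)\<^esub>
     fm (sharp H2 p) (inv_arr (fib H2 (Dom S p)) (\<theta> p (fo (sharp H1 p) A))) \<cdot>\<^bsub>fib H2 (Cod S p)\<^esub>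
     fm (sharp H2 p) (fm (R (Dom S p)) (sharp_unit H1 p A))"

definition left_adjointable ::
  "('s, 'a, 'x) basecat_scheme \<Rightarrow> ('s, 'a, 'o1, 'm1, 'y) fibcat_adj_scheme \<Rightarrow>
   ('s, 'a, 'o2, 'm2, 'z) fibcat_adj_scheme \<Rightarrow> ('s \<Rightarrow> ('o1, 'm1, 'o2, 'm2) tfctr) \<Rightarrow>
   ('a \<Rightarrow> 'o1 \<Rightarrow> 'm2) \<Rightarrow> bool" where
  "left_adjointable S H1 H2 R \<theta> \<longleftrightarrow>
     (\<forall>p \<in> Sm S. \<forall>A \<in> Ob (fib H1 (Dom S p)).
        is_iso (fib H2 (Cod S p)) (sharp_mate S H1 H2 R \<theta> p A))"

definition localic_structure ::
  "('s, 'a, 'x) basecat_scheme \<Rightarrow> ('s, 'a, 'o1, 'm1, 'y) fibcat_adj_scheme \<Rightarrow>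
   ('s, 'a, 'o2, 'm2, 'z) fibcat_adj_scheme \<Rightarrow> ('s \<Rightarrow> ('o1, 'm1, 'o2, 'm2) tfctr) \<Rightarrow>
   ('a \<Rightarrow> 'o1 \<Rightarrow> 'm2) \<Rightarrow> bool" where
  "localic_structure S H1 H2 R \<theta> \<longleftrightarrow>
     pull_structure S H1 H2 R (Arr S) \<theta> \<and> left_adjointable S H1 H2 R \<theta>"

text \<open>A system of isomorphisms \<open>\<omega> z A : R\<^sub>X (z\<^sub>* A) \<rightarrow> z\<^sub>* (R\<^sub>Z A)\<close> for closed immersions \<open>z : Z \<rightarrow> X\<close>, whose
  inverses satisfy the cocycle condition for the functors \<open>z\<^sub>*\<close>.\<close>

definition push_structure ::
  "('s, 'a, 'x) basecat_scheme \<Rightarrow> ('s, 'a, 'o1, 'm1, 'y) fibcat_adj_scheme \<Rightarrow>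
   ('s, 'a, 'o2, 'm2, 'z) fibcat_adj_scheme \<Rightarrow> ('s \<Rightarrow> ('o1, 'm1, 'o2, 'm2) tfctr) \<Rightarrow>
   ('a \<Rightarrow> 'o1 \<Rightarrow> 'm2) \<Rightarrow> bool" where
  "push_structure S H1 H2 R \<omega> \<longleftrightarrow>
     (\<forall>z \<in> Cl S. tri_nat_iso (fib H1 (Dom S z)) (fib H2 (Cod S z))
        (comp_tfctr (fib H2 (Cod S z)) (R (Cod S z)) (tpush S H1 z))
        (comp_tfctr (fib H2 (Cod S z)) (tpush S H2 z) (R (Dom S z))) (\<omega> z)) \<and>
     (\<forall>z \<in> Cl S. \<forall>y \<in> Cl S. Cod S z = Dom S y \<longrightarrow> (\<forall>A \<in> Ob (fib H1 (Dom S z)).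
        let C = fib H2 (Cod S y) in
        fm (R (Cod S y)) (push_conn S H1 y z A) \<cdot>\<^bsub>C\<^esub> inv_arr C (\<omega> (y \<cdot>\<^bsub>S\<^esub> z) A) =
        inv_arr C (\<omega> y (fo (push H1 z) A)) \<cdot>\<^bsub>C\<^esub>
          fm (push H2 y) (inv_arr (fib H2 (Cod S z)) (\<omega> z A)) \<cdot>\<^bsub>C\<^esub>
          push_conn S H2 y z (fo (R (Dom S z)) A)))"

text \<open>\<open>R\<^sub>X z\<^sub>* A \<rightarrow> z\<^sub>* z\<^sup>* R\<^sub>X z\<^sub>* A \<rightarrow> z\<^sub>* R\<^sub>Z z\<^sup>* z\<^sub>* A \<rightarrow> z\<^sub>* R\<^sub>Z A\<close>\<close>

definition push_mate ::
  "('s, 'a, 'x) precat_scheme \<Rightarrow> ('s, 'a, 'o1, 'm1, 'y) fibcat_adj_scheme \<Rightarrow>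
   ('s, 'a, 'o2, 'm2, 'z) fibcat_adj_scheme \<Rightarrow> ('s \<Rightarrow> ('o1, 'm1, 'o2, 'm2) tfctr) \<Rightarrow>
   ('a \<Rightarrow> 'o1 \<Rightarrow> 'm2) \<Rightarrow> 'a \<Rightarrow> 'o1 \<Rightarrow> 'm2" where
  "push_mate S H1 H2 R \<theta> z A =
     fm (push H2 z) (fm (R (Dom S z)) (push_counit H1 z A)) \<cdot>\<^bsub>fib H2 (Cod S z)\<^esub>
     fm (push H2 z) (\<theta> z (fo (push H1 z) A)) \<cdot>\<^bsub>fib H2 (Cod S z)\<^esub>
     push_unit H2 z (fo (R (Cod S z)) (fo (push H1 z) A))"

text \<open>\<open>z\<^sup>* R\<^sub>X A \<rightarrow> z\<^sup>* R\<^sub>X z\<^sub>* z\<^sup>* A \<rightarrow> z\<^sup>* z\<^sub>* R\<^sub>Z z\<^sup>* A \<rightarrow> R\<^sub>Z z\<^sup>* A\<close>\<close>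

definition pull_mate ::
  "('s, 'a, 'x) precat_scheme \<Rightarrow> ('s, 'a, 'o1, 'm1, 'y) fibcat_adj_scheme \<Rightarrow>
   ('s, 'a, 'o2, 'm2, 'z) fibcat_adj_scheme \<Rightarrow> ('s \<Rightarrow> ('o1, 'm1, 'o2, 'm2) tfctr) \<Rightarrow>
   ('a \<Rightarrow> 'o1 \<Rightarrow> 'm2) \<Rightarrow> 'a \<Rightarrow> 'o1 \<Rightarrow> 'm2" where
  "pull_mate S H1 H2 R \<omega> z A =
     push_counit H2 z (fo (R (Dom S z)) (fo (pull H1 z) A)) \<cdot>\<^bsub>fib H2 (Dom S z)\<^esub>
     fm (pull H2 z) (\<omega> z (fo (pull H1 z) A)) \<cdot>\<^bsub>fib H2 (Dom S z)\<^esub>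
     fm (pull H2 z) (fm (R (Cod S z)) (push_unit H1 z A))"

definition core_C ::
  "('s, 'a, 'x) basecat_scheme \<Rightarrow> ('s, 'a, 'o1, 'm1, 'y) fibcat_adj_scheme \<Rightarrow>
   ('s, 'a, 'o2, 'm2, 'z) fibcat_adj_scheme \<Rightarrow> ('s \<Rightarrow> ('o1, 'm1, 'o2, 'm2) tfctr) \<Rightarrow>
   ('a \<Rightarrow> 'o1 \<Rightarrow> 'm2) \<Rightarrow> ('a \<Rightarrow> 'o1 \<Rightarrow> 'm2) \<Rightarrow> bool" where
  "core_C S H1 H2 R \<theta> \<omega> \<longleftrightarrow>
     (\<forall>p \<in> Sm S. \<forall>z \<in> Cl S. \<forall>p' z'. cartesian S p z p' z' \<longrightarrow> (\<forall>A \<in> Ob (fib H1 (Dom S z)).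
        let D = fib H2 (Dom S p) in
        fm (push H2 z') (\<theta> p' A) \<cdot>\<^bsub>D\<^esub>
          push_base_change S H2 p z p' z' (fo (R (Dom S z)) A) \<cdot>\<^bsub>D\<^esub> fm (pull H2 p) (\<omega> z A) =
        \<omega> z' (fo (pull H1 p') A) \<cdot>\<^bsub>D\<^esub>
          fm (R (Dom S p)) (push_base_change S H1 p z p' z' A) \<cdot>\<^bsub>D\<^esub> \<theta> p (fo (push H1 z) A)))"

definition core_T ::
  "('s, 'a, 'x) basecat_scheme \<Rightarrow> ('s, 'a, 'o1, 'm1, 'y) fibcat_adj_scheme \<Rightarrow>
   ('s, 'a, 'o2, 'm2, 'z) fibcat_adj_scheme \<Rightarrow> ('s \<Rightarrow> ('o1, 'm1, 'o2, 'm2) tfctr) \<Rightarrow>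
   ('a \<Rightarrow> 'o1 \<Rightarrow> 'm2) \<Rightarrow> ('a \<Rightarrow> 'o1 \<Rightarrow> 'm2) \<Rightarrow> bool" where
  "core_T S H1 H2 R \<theta> \<omega> \<longleftrightarrow>
     (\<forall>p \<in> Sm S. \<forall>q \<in> Sm S. \<forall>h \<in> Cl S. Cod S h = Dom S p \<and> q = p \<cdot>\<^bsub>S\<^esub> h \<longrightarrow>
       (\<forall>A \<in> Ob (fib H1 (Cod S p)).
        let D = fib H2 (Dom S h) in
        fm (R (Dom S h)) (conn H1 h p A) \<cdot>\<^bsub>D\<^esub> \<theta> q A =
        pull_mate S H1 H2 R \<omega> h (fo (pull H1 p) A) \<cdot>\<^bsub>D\<^esub> fm (pull H2 h) (\<theta> p A) \<cdot>\<^bsub>D\<^esub>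
          conn H2 h p (fo (R (Cod S p)) A)))"

definition core ::
  "('s, 'a, 'x) basecat_scheme \<Rightarrow> ('s, 'a, 'o1, 'm1, 'y) fibcat_adj_scheme \<Rightarrow>
   ('s, 'a, 'o2, 'm2, 'z) fibcat_adj_scheme \<Rightarrow> ('s \<Rightarrow> ('o1, 'm1, 'o2, 'm2) tfctr) \<Rightarrow>
   ('a \<Rightarrow> 'o1 \<Rightarrow> 'm2) \<Rightarrow> ('a \<Rightarrow> 'o1 \<Rightarrow> 'm2) \<Rightarrow> bool" where
  "core S H1 H2 R \<theta> \<omega> \<longleftrightarrow>
     pull_structure S H1 H2 R (Sm S) \<theta> \<and> left_adjointable S H1 H2 R \<theta> \<and>
     push_structure S H1 H2 R \<omega> \<and> core_C S H1 H2 R \<theta> \<omega> \<and> core_T S H1 H2 R \<theta> \<omega>"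

text \<open>Equality of two systems on the classes of arrows and objects where they are meaningful.\<close>

definition pull_structure_eq ::
  "('s, 'a, 'x) precat_scheme \<Rightarrow> ('s, 'a, 'o1, 'm1, 'y) fibcat_scheme \<Rightarrow> 'a set \<Rightarrow>
   ('a \<Rightarrow> 'o1 \<Rightarrow> 'm2) \<Rightarrow> ('a \<Rightarrow> 'o1 \<Rightarrow> 'm2) \<Rightarrow> bool" where
  "pull_structure_eq S H1 K \<theta> \<theta>' \<longleftrightarrow> (\<forall>f \<in> K. \<forall>A \<in> Ob (fib H1 (Cod S f)). \<theta> f A = \<theta>' f A)"

definition push_structure_eq ::
  "('s, 'a, 'x) basecat_scheme \<Rightarrow> ('s, 'a, 'o1, 'm1, 'y) fibcat_scheme \<Rightarrow>
   ('a \<Rightarrow> 'o1 \<Rightarrow> 'm2) \<Rightarrow> ('a \<Rightarrow> 'o1 \<Rightarrow> 'm2) \<Rightarrow> bool" where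
  "push_structure_eq S H1 \<omega> \<omega>' \<longleftrightarrow> (\<forall>z \<in> Cl S. \<forall>A \<in> Ob (fib H1 (Dom S z)). \<omega> z A = \<omega>' z A)"

text \<open>\<open>(\<theta>sm, \<omega>)\<close> is obtained from \<open>\<theta>\<close> by restriction to smooth morphisms, and by restriction to closed
  immersions followed by adjunction.\<close>

definition determines ::
  "('s, 'a, 'x) basecat_scheme \<Rightarrow> ('s, 'a, 'o1, 'm1, 'y) fibcat_adj_scheme \<Rightarrow>
   ('s, 'a, 'o2, 'm2, 'z) fibcat_adj_scheme \<Rightarrow> ('s \<Rightarrow> ('o1, 'm1, 'o2, 'm2) tfctr) \<Rightarrow>
   ('a \<Rightarrow> 'o1 \<Rightarrow> 'm2) \<Rightarrow> ('a \<Rightarrow> 'o1 \<Rightarrow> 'm2) \<Rightarrow> ('a \<Rightarrow> 'o1 \<Rightarrow> 'm2) \<Rightarrow> bool" where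
  "determines S H1 H2 R \<theta> \<theta>sm \<omega> \<longleftrightarrow>
     pull_structure_eq S H1 (Sm S) \<theta> \<theta>sm \<and> push_structure_eq S H1 (push_mate S H1 H2 R \<theta>) \<omega>"

end

theory Submission
  imports Defs
begin

text \<open>
For transformations \<open>\<alpha> : f\<^sup>* R \<rightarrow> R f\<^sup>*\<close> and \<open>\<beta> : g\<^sup>* R \<rightarrow> R g\<^sup>*\<close> let \<open>star f \<alpha> g \<beta>\<close> be the induced transformation over
\<open>g \<cdot> f\<close>. This product is associative (\<open>star_assoc_at\<close>), so the pairs \<open>(f, \<alpha>)\<close> behave like the arrows of a
category over \<open>S\<close>, in which the connection isomorphisms are no longer visible. A structure is a multiplicative
section \<open>f \<mapsto> \<theta> f\<close>. The theorem says that such a section is the same as a pair of multiplicative sections over smooth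
morphisms and over closed immersions, subject to \<open>star z' (cl z') p (sm p) = star p' (sm p') z (cl z)\<close> on Cartesian
squares \<open>p \<cdot> z' = z \<cdot> p'\<close> and \<open>sm (p \<cdot> h) = star h (cl h) p (sm p)\<close> on triangles, except that a core records the
section over closed immersions through its mates \<open>\<omega> z : R z\<^sub>* \<rightarrow> z\<^sub>* R\<close>.

Passing to mates. Natural transformations \<open>\<alpha>\<close> and \<open>\<omega>\<close> over a closed immersion correspond to each other through
one equation, \<open>\<epsilon> \<cdot> z\<^sup>* \<omega> = R \<epsilon> \<cdot> \<alpha>\<close>, the relation \<open>mated\<close>. Since \<open>z\<^sub>*\<close> is fully faithful, \<open>\<epsilon>\<close> is
invertible, and a transformation into a functor that factors through \<open>z\<^sup>*\<close> is determined at the objects \<open>z\<^sub>* B\<close>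
(\<open>agree_along\<close>). Transposing a condition on \<open>\<omega>\<close> at \<open>B\<close> yields the corresponding condition on \<open>\<alpha>\<close> at \<open>z\<^sub>* B\<close>,
and therefore everywhere; this gives the equivalences \<open>mates_shift_iff\<close>, \<open>push_cocycle_iff\<close> and \<open>cross_iff\<close>,
which serve both directions of the theorem.

Invertibility of mates is where localization enters. An arrow into \<open>z\<^sub>* B\<close> whose source is killed by \<open>u\<^sup>*\<close> can be
tested after \<open>z\<^sup>*\<close>, which makes \<open>\<omega>\<close> invertible if \<open>\<alpha>\<close> is (\<open>mated_push_iso\<close>). Conversely the cone of
\<open>A \<rightarrow> z\<^sub>* z\<^sup>* A\<close> has the form \<open>u\<^sub># C\<close>; left adjointability gives \<open>z\<^sup>* R u\<^sub># C = z\<^sup>* u\<^sub># R C = 0\<close>, so \<open>z\<^sup>* R\<close> inverts the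
unit, and \<open>\<alpha>\<close> is invertible if \<open>\<omega>\<close> is (\<open>mated_pull_iso\<close>).

Gluing. For \<open>f = p \<cdot> t\<close> with \<open>t\<close> a closed immersion and \<open>p\<close> smooth the only possible value is
\<open>star t (cl t) p (sm p)\<close>. The essential point is that \<open>cl (p \<cdot> w) = star w (cl w) p (sm p)\<close> whenever \<open>w\<close> and
\<open>p \<cdot> w\<close> are closed immersions (\<open>cl_factor\<close>): the base change of \<open>p\<close> along \<open>p \<cdot> w\<close> has a section, for which the
triangle condition applies, and the exchange condition returns from the base change to \<open>p\<close>. Independence of the
factorization follows by passing to the fibre product of two factorizations, and multiplicativity by moving smooth
factors past closed ones (\<open>sm_cl_exchange\<close>).
\<close>

section \<open>Categories, functors and natural transformations\<close>

context category
begin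

lemma Hom_iff: "f \<in> Hom C A B \<longleftrightarrow> f \<in> Arr C \<and> Dom C f = A \<and> Cod C f = B"
  by (auto simp: Hom_def)

lemma comp_arr [simp]:
  assumes "f \<in> Arr C" "g \<in> Arr C" "Cod C f = Dom C g"
  shows "g \<cdot> f \<in> Arr C" "Dom C (g \<cdot> f) = Dom C f" "Cod C (g \<cdot> f) = Cod C g"
  using Comp_in[of f "Dom C f" "Cod C f" g "Cod C g"] assms by (auto simp: Hom_def)

lemma assoc [simp]:
  "\<lbrakk>f \<in> Arr C; g \<in> Arr C; h \<in> Arr C; Cod C f = Dom C g; Cod C g = Dom C h\<rbrakk>
    \<Longrightarrow> (h \<cdot> g) \<cdot> f = h \<cdot> (g \<cdot> f)"
  using Comp_assoc[of f "Dom C f" "Cod C f" g "Cod C g" h "Cod C h"] by (auto simp: Hom_def)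

lemma dom_cod_ob [simp]: "f \<in> Arr C \<Longrightarrow> Dom C f \<in> Ob C" "f \<in> Arr C \<Longrightarrow> Cod C f \<in> Ob C"
  by (fact Dom_in, fact Cod_in)

lemma ide_arr [simp]:
  assumes "A \<in> Ob C"
  shows "Ide C A \<in> Arr C" "Dom C (Ide C A) = A" "Cod C (Ide C A) = A"
  using Ide_in[OF assms] by (auto simp: Hom_def)

lemma ide_left [simp]: "\<lbrakk>f \<in> Arr C; Cod C f = A\<rbrakk> \<Longrightarrow> Ide C A \<cdot> f = f"
  using Comp_Ide_left[of f "Dom C f" A] by (auto simp: Hom_def)

lemma ide_right [simp]: "\<lbrakk>f \<in> Arr C; Dom C f = A\<rbrakk> \<Longrightarrow> f \<cdot> Ide C A = f"
  using Comp_Ide_right[of f A "Cod C f"] by (auto simp: Hom_def)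

text \<open>Simplification associates composites to the right, which hides an inner composite of two arrows. An
  equation about such a composite is applied inside a longer one through these two rules.\<close>

lemma subst_comp:
  "\<lbrakk>g \<cdot> f = k; f \<in> Arr C; g \<in> Arr C; e \<in> Arr C; Cod C f = Dom C g; Cod C e = Dom C f\<rbrakk>
    \<Longrightarrow> g \<cdot> (f \<cdot> e) = k \<cdot> e"
  using assoc by metis

lemma subst_comp2:
  "\<lbrakk>g \<cdot> f = k \<cdot> h; f \<in> Arr C; g \<in> Arr C; h \<in> Arr C; k \<in> Arr C; e \<in> Arr C; Cod C f = Dom C g;
    Cod C h = Dom C k; Cod C e = Dom C f\<rbrakk>
    \<Longrightarrow> g \<cdot> (f \<cdot> e) = k \<cdot> (h \<cdot> e)"
  using assoc comp_arr by metis

lemma inverse_arrowsI: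
  "\<lbrakk>f \<in> Arr C; g \<in> Arr C; Dom C g = Cod C f; Cod C g = Dom C f;
    g \<cdot> f = Ide C (Dom C f); f \<cdot> g = Ide C (Cod C f)\<rbrakk> \<Longrightarrow> inverse_arrows C f g"
  by (auto simp: inverse_arrows_def Hom_def)

lemma isoI:
  "\<lbrakk>f \<in> Arr C; g \<in> Arr C; Dom C g = Cod C f; Cod C g = Dom C f;
    g \<cdot> f = Ide C (Dom C f); f \<cdot> g = Ide C (Cod C f)\<rbrakk> \<Longrightarrow> is_iso C f"
  using inverse_arrowsI unfolding is_iso_def by blast

lemma inverse_arrows_unique:
  assumes "inverse_arrows C f g" "inverse_arrows C f h"
  shows "g = h"
proof -
  have "g = g \<cdot> (f \<cdot> h)" using assms by (auto simp: inverse_arrows_def Hom_def)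
  also have "\<dots> = (g \<cdot> f) \<cdot> h"
    by (rule assoc[symmetric]) (use assms in \<open>auto simp: inverse_arrows_def Hom_def\<close>)
  also have "\<dots> = h" using assms by (auto simp: inverse_arrows_def Hom_def)
  finally show ?thesis .
qed

lemma inv_arr_eqI: "inverse_arrows C f g \<Longrightarrow> inv_arr C f = g"
  unfolding inv_arr_def using inverse_arrows_unique by blast

lemma inverse_arrows_inv_arr: "is_iso C f \<Longrightarrow> inverse_arrows C f (inv_arr C f)"
  unfolding is_iso_def using inv_arr_eqI by auto

lemma iso_arr: "is_iso C f \<Longrightarrow> f \<in> Arr C"
  by (auto simp: is_iso_def inverse_arrows_def)

lemma inv_arr_arr [simp]:
  assumes "is_iso C f"
  shows "inv_arr C f \<in> Arr C" "Dom C (inv_arr C f) = Cod C f" "Cod C (inv_arr C f) = Dom C f"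
    "f \<cdot> inv_arr C f = Ide C (Cod C f)" "inv_arr C f \<cdot> f = Ide C (Dom C f)"
  using inverse_arrows_inv_arr[OF assms] by (auto simp: inverse_arrows_def Hom_def)

lemma inv_arr_cancel [simp]:
  assumes "is_iso C f" "e \<in> Arr C"
  shows "Cod C e = Cod C f \<Longrightarrow> f \<cdot> (inv_arr C f \<cdot> e) = e"
    "Cod C e = Dom C f \<Longrightarrow> inv_arr C f \<cdot> (f \<cdot> e) = e"
  using assms subst_comp[of f "inv_arr C f" _ e] subst_comp[of "inv_arr C f" f _ e] iso_arr by auto

lemma iso_inv_arr [simp]: "is_iso C f \<Longrightarrow> is_iso C (inv_arr C f)"
  by (rule isoI[of _ f]) (auto simp: iso_arr)

lemma iso_ide [simp]: "A \<in> Ob C \<Longrightarrow> is_iso C (Ide C A)"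
  by (rule isoI[of _ "Ide C A"]) auto

lemma inv_arr_ide [simp]: "A \<in> Ob C \<Longrightarrow> inv_arr C (Ide C A) = Ide C A"
  by (rule inv_arr_eqI, rule inverse_arrowsI) auto

lemma iso_comp:
  assumes f: "is_iso C f" and g: "is_iso C g" and c: "Cod C f = Dom C g"
  shows "is_iso C (g \<cdot> f)"
proof (rule isoI[of _ "inv_arr C f \<cdot> inv_arr C g"])
  have arr: "f \<in> Arr C" "g \<in> Arr C" using f g iso_arr by auto
  show "(g \<cdot> f) \<cdot> (inv_arr C f \<cdot> inv_arr C g) = Ide C (Cod C (g \<cdot> f))"
    "(inv_arr C f \<cdot> inv_arr C g) \<cdot> (g \<cdot> f) = Ide C (Dom C (g \<cdot> f))"
    using arr f g c by simp_all
qed (use f g c iso_arr in auto)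

lemma iso_cancel_left:
  assumes "is_iso C g" "f \<in> Arr C" "f' \<in> Arr C" "Cod C f = Dom C g" "Cod C f' = Dom C g"
    and "g \<cdot> f = g \<cdot> f'"
  shows "f = f'"
  using inv_arr_cancel(2)[of g f] inv_arr_cancel(2)[of g f'] assms by metis

lemma iso_cancel_right:
  assumes g: "is_iso C g" and "f \<in> Arr C" "f' \<in> Arr C" "Dom C f = Cod C g" "Dom C f' = Cod C g"
    and "f \<cdot> g = f' \<cdot> g"
  shows "f = f'"
proof -
  have "f = (f \<cdot> g) \<cdot> inv_arr C g" using assms(1-5) iso_arr[OF g] by simp
  also have "\<dots> = (f' \<cdot> g) \<cdot> inv_arr C g" using assms(6) by simp
  also have "\<dots> = f'" using assms(1-5) iso_arr[OF g] by simp
  finally show ?thesis .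
qed

lemma iso_of_comp_left:
  assumes gf: "is_iso C (g \<cdot> f)" and g: "is_iso C g" and f: "f \<in> Arr C" "Cod C f = Dom C g"
  shows "is_iso C f"
proof -
  have "inv_arr C g \<cdot> (g \<cdot> f) = f" using assms by simp
  then show ?thesis using iso_comp[OF gf iso_inv_arr[OF g]] iso_arr[OF g] assms by simp
qed

lemma iso_of_comp_right:
  assumes gf: "is_iso C (g \<cdot> f)" and f: "is_iso C f" and g: "g \<in> Arr C" "Cod C f = Dom C g"
  shows "is_iso C g"
proof -
  have "(g \<cdot> f) \<cdot> inv_arr C f = g" using assms iso_arr[OF f] by simp
  then show ?thesis using iso_comp[OF iso_inv_arr[OF f] gf] iso_arr[OF f] assms by simp
qed

end

context cat_functor
begin

lemma fo_ob [simp]: "A \<in> Ob C \<Longrightarrow> fo F A \<in> Ob D"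
  by (fact fo_in)

lemma fm_arr [simp]:
  assumes "f \<in> Arr C"
  shows "fm F f \<in> Arr D" "Dom D (fm F f) = fo F (Dom C f)" "Cod D (fm F f) = fo F (Cod C f)"
  using fm_in[of f "Dom C f" "Cod C f"] assms by (auto simp: Hom_def)

lemma fm_ide [simp]: "A \<in> Ob C \<Longrightarrow> fm F (Ide C A) = Ide D (fo F A)"
  by (fact fm_Ide)

lemma fm_comp:
  "\<lbrakk>f \<in> Arr C; g \<in> Arr C; Cod C f = Dom C g\<rbrakk> \<Longrightarrow> fm F (g \<cdot>\<^bsub>C\<^esub> f) = fm F g \<cdot>\<^bsub>D\<^esub> fm F f"
  using fm_Comp[of f "Dom C f" "Cod C f" g "Cod C g"] by (auto simp: Hom_def)

lemma inverse_arrows_fm: "inverse_arrows C f g \<Longrightarrow> inverse_arrows D (fm F f) (fm F g)"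
  using fm_comp[of f g] fm_comp[of g f] by (auto simp: inverse_arrows_def Hom_def)

lemma iso_fm [simp]: "is_iso C f \<Longrightarrow> is_iso D (fm F f)"
  using inverse_arrows_fm unfolding is_iso_def by blast

lemma inv_arr_fm: "is_iso C f \<Longrightarrow> inv_arr D (fm F f) = fm F (inv_arr C f)"
  using inverse_arrows_fm[OF dom.inverse_arrows_inv_arr] cod.inv_arr_eqI by blast

end

lemma comp_fctr_simps [simp]:
  "fo (comp_fctr G F) A = fo G (fo F A)" "fm (comp_fctr G F) f = fm G (fm F f)"
  by (simp_all add: comp_fctr_def)

lemma comp_tfctr_simps [simp]:
  "fo (comp_tfctr E G F) A = fo G (fo F A)" "fm (comp_tfctr E G F) f = fm G (fm F f)"
  "fs (comp_tfctr E G F) A = fs G (fo F A) \<cdot>\<^bsub>E\<^esub> fm G (fs F A)"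
  by (simp_all add: comp_tfctr_def)

lemma id_fctr_simps [simp]: "fo id_fctr A = A" "fm id_fctr f = f"
  by (simp_all add: id_fctr_def)

lemma id_tfctr_simps [simp]:
  "fo (id_tfctr C) A = A" "fm (id_tfctr C) f = f" "fs (id_tfctr C) A = Ide C (fo (Shift C) A)"
  by (simp_all add: id_tfctr_def)

lemma nat_transI:
  assumes "\<And>A. A \<in> Ob C \<Longrightarrow> \<alpha> A \<in> Arr D \<and> Dom D (\<alpha> A) = fo F A \<and> Cod D (\<alpha> A) = fo G A"
    and "\<And>f. f \<in> Arr C \<Longrightarrow> \<alpha> (Cod C f) \<cdot>\<^bsub>D\<^esub> fm F f = fm G f \<cdot>\<^bsub>D\<^esub> \<alpha> (Dom C f)"
  shows "nat_trans C D F G \<alpha>"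
  using assms by (auto simp: nat_trans_def Hom_def)

lemma nat_trans_arr:
  assumes "nat_trans C D F G \<alpha>" "A \<in> Ob C"
  shows "\<alpha> A \<in> Arr D" "Dom D (\<alpha> A) = fo F A" "Cod D (\<alpha> A) = fo G A"
  using assms by (auto simp: nat_trans_def Hom_def)

lemma (in category) nat_trans_nat:
  assumes "nat_trans C D F G \<alpha>" "f \<in> Arr C" "Cod C f = B"
  shows "\<alpha> B \<cdot>\<^bsub>D\<^esub> fm F f = fm G f \<cdot>\<^bsub>D\<^esub> \<alpha> (Dom C f)"
  using assms by (auto simp: nat_trans_def Hom_def)

section \<open>Adjunctions and mates\<close>

context adjunction
begin

lemma unit_arr [simp]:
  "A \<in> Ob C \<Longrightarrow> \<eta> A \<in> Arr C" "A \<in> Ob C \<Longrightarrow> Dom C (\<eta> A) = A"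
  "A \<in> Ob C \<Longrightarrow> Cod C (\<eta> A) = fo G (fo F A)"
  using nat_trans_arr[OF unit_nat] by simp_all

lemma counit_arr [simp]:
  "B \<in> Ob D \<Longrightarrow> \<epsilon> B \<in> Arr D" "B \<in> Ob D \<Longrightarrow> Dom D (\<epsilon> B) = fo F (fo G B)"
  "B \<in> Ob D \<Longrightarrow> Cod D (\<epsilon> B) = B"
  using nat_trans_arr[OF counit_nat] by simp_all

lemma unit_natural:
  "\<lbrakk>f \<in> Arr C; Cod C f = B\<rbrakk> \<Longrightarrow> \<eta> B \<cdot>\<^bsub>C\<^esub> f = fm G (fm F f) \<cdot>\<^bsub>C\<^esub> \<eta> (Dom C f)"
  using left.dom.nat_trans_nat[OF unit_nat] by simp

lemma counit_natural:
  "\<lbrakk>f \<in> Arr D; Cod D f = B\<rbrakk> \<Longrightarrow> \<epsilon> B \<cdot>\<^bsub>D\<^esub> fm F (fm G f) = f \<cdot>\<^bsub>D\<^esub> \<epsilon> (Dom D f)"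
  using left.cod.nat_trans_nat[OF counit_nat] by simp

lemma counit_natural_comp:
  "\<lbrakk>f \<in> Arr D; Cod D f = B; e \<in> Arr D; Cod D e = fo F (fo G (Dom D f))\<rbrakk> \<Longrightarrow>
    \<epsilon> B \<cdot>\<^bsub>D\<^esub> (fm F (fm G f) \<cdot>\<^bsub>D\<^esub> e) = f \<cdot>\<^bsub>D\<^esub> (\<epsilon> (Dom D f) \<cdot>\<^bsub>D\<^esub> e)"
  by (rule left.cod.subst_comp2[OF counit_natural]) auto

text \<open>Transposition sends \<open>f : A \<rightarrow> G B\<close> to \<open>\<epsilon> \<cdot> F f\<close> and, in the other direction, \<open>g : F A \<rightarrow> B\<close> to \<open>G g \<cdot> \<eta>\<close>.
  Its injectivity is the way in which arrows into \<open>G B\<close>, or out of \<open>F A\<close>, are compared.\<close>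

lemma untranspose:
  assumes "f \<in> Arr C" "Cod C f = fo G B" "B \<in> Ob D"
  shows "fm G (\<epsilon> B \<cdot>\<^bsub>D\<^esub> fm F f) \<cdot>\<^bsub>C\<^esub> \<eta> (Dom C f) = f"
proof -
  have "fm G (\<epsilon> B \<cdot>\<^bsub>D\<^esub> fm F f) \<cdot>\<^bsub>C\<^esub> \<eta> (Dom C f)
      = fm G (\<epsilon> B) \<cdot>\<^bsub>C\<^esub> (fm G (fm F f) \<cdot>\<^bsub>C\<^esub> \<eta> (Dom C f))"
    using assms by (simp add: right.fm_comp)
  also have "\<dots> = fm G (\<epsilon> B) \<cdot>\<^bsub>C\<^esub> (\<eta> (fo G B) \<cdot>\<^bsub>C\<^esub> f)"
    using assms by (simp add: unit_natural)
  also have "\<dots> = f"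
    using assms triangle_right[of B]
      left.dom.subst_comp[of "fm G (\<epsilon> B)" "\<eta> (fo G B)" _ f] by simp
  finally show ?thesis .
qed

lemma transpose_inj:
  assumes "f \<in> Arr C" "f' \<in> Arr C" "Dom C f = Dom C f'" "Cod C f = fo G B" "Cod C f' = fo G B"
    and "B \<in> Ob D" and "\<epsilon> B \<cdot>\<^bsub>D\<^esub> fm F f = \<epsilon> B \<cdot>\<^bsub>D\<^esub> fm F f'"
  shows "f = f'"
  using untranspose[of f B] untranspose[of f' B] assms by metis

lemma transpose:
  assumes "f \<in> Arr D" "Dom D f = fo F A" "A \<in> Ob C"
  shows "\<epsilon> (Cod D f) \<cdot>\<^bsub>D\<^esub> fm F (fm G f \<cdot>\<^bsub>C\<^esub> \<eta> A) = f"
  using assms triangle_left[of A] by (simp add: left.fm_comp counit_natural_comp)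

lemma cotranspose_inj:
  assumes "f \<in> Arr D" "f' \<in> Arr D" "Dom D f = fo F A" "Dom D f' = fo F A" "Cod D f = Cod D f'"
    and "A \<in> Ob C" and "fm G f \<cdot>\<^bsub>C\<^esub> \<eta> A = fm G f' \<cdot>\<^bsub>C\<^esub> \<eta> A"
  shows "f = f'"
  using transpose[of f A] transpose[of f' A] assms by metis

text \<open>A right adjoint is fully faithful only if the counit is invertible: the inverse is the arrow
  that the right adjoint sends to the unit.\<close>

lemma counit_iso:
  assumes ff: "fully_faithful D C G" and B: "B \<in> Ob D"
  shows "is_iso D (\<epsilon> B)"
proof -
  have "bij_betw (fm G) (Hom D B (fo F (fo G B))) (Hom C (fo G B) (fo G (fo F (fo G B))))"
    using ff B unfolding fully_faithful_def by simp
  moreover have "\<eta> (fo G B) \<in> Hom C (fo G B) (fo G (fo F (fo G B)))"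
    using B by (simp add: left.dom.Hom_iff)
  ultimately have "\<eta> (fo G B) \<in> fm G ` Hom D B (fo F (fo G B))"
    unfolding bij_betw_def by simp
  then obtain g where g: "g \<in> Arr D" "Dom D g = B" "Cod D g = fo F (fo G B)"
    and Gg: "fm G g = \<eta> (fo G B)"
    by (auto simp: left.cod.Hom_iff)
  have inj: "inj_on (fm G) (Hom D B B)"
    using ff B unfolding fully_faithful_def bij_betw_def by simp
  have "\<epsilon> B \<cdot>\<^bsub>D\<^esub> g = Ide D B"
    by (rule inj_onD[OF inj]) (use g B Gg triangle_right[OF B] in
      \<open>simp_all add: right.fm_comp left.cod.Hom_iff\<close>)
  moreover have "g \<cdot>\<^bsub>D\<^esub> \<epsilon> B = Ide D (fo F (fo G B))"
    using counit_natural[of g "fo F (fo G B)"] g B Gg triangle_left[of "fo G B"] by simp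
  ultimately show ?thesis
    using g B by (intro left.cod.isoI[of _ g]) simp_all
qed

lemma fm_unit_iso:
  assumes \<epsilon>: "\<And>B. B \<in> Ob D \<Longrightarrow> is_iso D (\<epsilon> B)" and A: "A \<in> Ob C"
  shows "is_iso D (fm F (\<eta> A))"
  by (rule left.cod.iso_of_comp_left[of "\<epsilon> (fo F A)"]) (use A \<epsilon> triangle_left[OF A] in simp_all)

end

text \<open>A functor that inverts \<open>f\<close> sees no difference between the two ends of \<open>f\<close>, so a transformation into
  it is determined at one end by its value at the other. Applied to the unit \<open>A \<rightarrow> G (F A)\<close> of an adjunction
  with invertible counit, which \<open>F\<close> inverts, this reduces identities between transformations into functors
  that factor through \<open>F\<close> to objects in the image of \<open>G\<close>.\<close>

lemma agree_along:
  assumes C: "category C" and E: "category E"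
    and \<phi>: "nat_trans C E K L \<phi>" and \<psi>: "nat_trans C E K L \<psi>"
    and f: "f \<in> Arr C" and iso: "is_iso E (fm L f)"
    and L: "Dom E (fm L f) = fo L (Dom C f)"
    and eq: "\<phi> (Cod C f) = \<psi> (Cod C f)"
  shows "\<phi> (Dom C f) = \<psi> (Dom C f)"
proof -
  interpret C: category C by fact
  interpret E: category E by fact
  have "fm L f \<cdot>\<^bsub>E\<^esub> \<phi> (Dom C f) = fm L f \<cdot>\<^bsub>E\<^esub> \<psi> (Dom C f)"
    using C.nat_trans_nat[OF \<phi> f refl] C.nat_trans_nat[OF \<psi> f refl] eq by simp
  then show ?thesis
    using E.iso_cancel_left[OF iso, of "\<phi> (Dom C f)" "\<psi> (Dom C f)"] f L
      nat_trans_arr[OF \<phi>, of "Dom C f"] nat_trans_arr[OF \<psi>, of "Dom C f"] by simp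
qed

text \<open>Two adjunctions \<open>F1 \<stileturn> G1\<close> and \<open>F2 \<stileturn> G2\<close> joined by functors \<open>R\<close> and \<open>Q\<close>. A transformation
  \<open>\<alpha> : F2 R \<rightarrow> Q F1\<close> and its mate \<open>\<omega> : R G1 \<rightarrow> G2 Q\<close> determine each other, and the equation \<open>mates\<close> says
  that the transpose of \<open>\<omega> B\<close> is obtained from \<open>\<alpha>\<close> at \<open>G1 B\<close>. Unlike the
  formulas \<open>rmate\<close> and \<open>lmate\<close> it defines neither in terms of the other, and all properties of \<open>\<alpha>\<close> and \<open>\<omega>\<close> are
  compared through it.\<close>

locale mate_square =
  adj1: adjunction C1 D1 F1 G1 \<eta>1 \<epsilon>1 + adj2: adjunction C2 D2 F2 G2 \<eta>2 \<epsilon>2 +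
  R: cat_functor C1 C2 R + Q: cat_functor D1 D2 Q
  for C1 D1 F1 G1 \<eta>1 \<epsilon>1 C2 D2 F2 G2 \<eta>2 \<epsilon>2 R Q
begin

definition rmate where
  "rmate \<alpha> B = fm G2 (fm Q (\<epsilon>1 B)) \<cdot>\<^bsub>C2\<^esub> fm G2 (\<alpha> (fo G1 B)) \<cdot>\<^bsub>C2\<^esub> \<eta>2 (fo R (fo G1 B))"

definition lmate where
  "lmate \<omega> A = \<epsilon>2 (fo Q (fo F1 A)) \<cdot>\<^bsub>D2\<^esub> fm F2 (\<omega> (fo F1 A)) \<cdot>\<^bsub>D2\<^esub> fm F2 (fm R (\<eta>1 A))"

definition mates where
  "mates \<alpha> \<omega> \<longleftrightarrow> (\<forall>B \<in> Ob D1. \<epsilon>2 (fo Q B) \<cdot>\<^bsub>D2\<^esub> fm F2 (\<omega> B) = fm Q (\<epsilon>1 B) \<cdot>\<^bsub>D2\<^esub> \<alpha> (fo G1 B))"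

abbreviation "lnat \<equiv> nat_trans C1 D2 (comp_fctr F2 R) (comp_fctr Q F1)"
abbreviation "rnat \<equiv> nat_trans D1 C2 (comp_fctr R G1) (comp_fctr G2 Q)"

lemma lnat_arr:
  "lnat \<alpha> \<Longrightarrow> A \<in> Ob C1 \<Longrightarrow> \<alpha> A \<in> Arr D2"
  "lnat \<alpha> \<Longrightarrow> A \<in> Ob C1 \<Longrightarrow> Dom D2 (\<alpha> A) = fo F2 (fo R A)"
  "lnat \<alpha> \<Longrightarrow> A \<in> Ob C1 \<Longrightarrow> Cod D2 (\<alpha> A) = fo Q (fo F1 A)"
  using nat_trans_arr[where F = "comp_fctr F2 R" and G = "comp_fctr Q F1"] by auto

lemma rnat_arr:
  "rnat \<omega> \<Longrightarrow> B \<in> Ob D1 \<Longrightarrow> \<omega> B \<in> Arr C2"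
  "rnat \<omega> \<Longrightarrow> B \<in> Ob D1 \<Longrightarrow> Dom C2 (\<omega> B) = fo R (fo G1 B)"
  "rnat \<omega> \<Longrightarrow> B \<in> Ob D1 \<Longrightarrow> Cod C2 (\<omega> B) = fo G2 (fo Q B)"
  using nat_trans_arr[where F = "comp_fctr R G1" and G = "comp_fctr G2 Q"] by auto

lemma lnat_nat:
  "\<lbrakk>lnat \<alpha>; f \<in> Arr C1; Cod C1 f = A\<rbrakk> \<Longrightarrow>
    \<alpha> A \<cdot>\<^bsub>D2\<^esub> fm F2 (fm R f) = fm Q (fm F1 f) \<cdot>\<^bsub>D2\<^esub> \<alpha> (Dom C1 f)"
  using adj1.left.dom.nat_trans_nat[where F = "comp_fctr F2 R" and G = "comp_fctr Q F1"] by simp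

lemma rnat_nat:
  "\<lbrakk>rnat \<omega>; f \<in> Arr D1; Cod D1 f = B\<rbrakk> \<Longrightarrow>
    \<omega> B \<cdot>\<^bsub>C2\<^esub> fm R (fm G1 f) = fm G2 (fm Q f) \<cdot>\<^bsub>C2\<^esub> \<omega> (Dom D1 f)"
  using adj1.left.cod.nat_trans_nat[where F = "comp_fctr R G1" and G = "comp_fctr G2 Q"] by simp

lemma matesD:
  "\<lbrakk>mates \<alpha> \<omega>; B \<in> Ob D1\<rbrakk> \<Longrightarrow>
    \<epsilon>2 (fo Q B) \<cdot>\<^bsub>D2\<^esub> fm F2 (\<omega> B) = fm Q (\<epsilon>1 B) \<cdot>\<^bsub>D2\<^esub> \<alpha> (fo G1 B)"
  unfolding mates_def by blast

lemma rmate_arr [simp]: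
  assumes \<alpha>: "lnat \<alpha>" and B: "B \<in> Ob D1"
  shows "rmate \<alpha> B \<in> Arr C2" "Dom C2 (rmate \<alpha> B) = fo R (fo G1 B)"
    "Cod C2 (rmate \<alpha> B) = fo G2 (fo Q B)"
  using B unfolding rmate_def by (simp_all add: lnat_arr[OF \<alpha>])

lemma lmate_arr [simp]:
  assumes \<omega>: "rnat \<omega>" and A: "A \<in> Ob C1"
  shows "lmate \<omega> A \<in> Arr D2" "Dom D2 (lmate \<omega> A) = fo F2 (fo R A)"
    "Cod D2 (lmate \<omega> A) = fo Q (fo F1 A)"
  using A unfolding lmate_def by (simp_all add: rnat_arr[OF \<omega>])

lemma mates_rmate:
  assumes \<alpha>: "lnat \<alpha>"
  shows "mates \<alpha> (rmate \<alpha>)"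
  unfolding mates_def
proof
  fix B assume B: "B \<in> Ob D1"
  have "rmate \<alpha> B = fm G2 (fm Q (\<epsilon>1 B) \<cdot>\<^bsub>D2\<^esub> \<alpha> (fo G1 B)) \<cdot>\<^bsub>C2\<^esub> \<eta>2 (fo R (fo G1 B))"
    using B unfolding rmate_def by (simp add: adj2.right.fm_comp lnat_arr[OF \<alpha>])
  then show "\<epsilon>2 (fo Q B) \<cdot>\<^bsub>D2\<^esub> fm F2 (rmate \<alpha> B) = fm Q (\<epsilon>1 B) \<cdot>\<^bsub>D2\<^esub> \<alpha> (fo G1 B)"
    using adj2.transpose[of "fm Q (\<epsilon>1 B) \<cdot>\<^bsub>D2\<^esub> \<alpha> (fo G1 B)" "fo R (fo G1 B)"] B
    by (simp add: lnat_arr[OF \<alpha>])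
qed

lemma mates_lmate:
  assumes \<omega>: "rnat \<omega>"
  shows "mates (lmate \<omega>) \<omega>"
  unfolding mates_def
proof
  fix B assume B: "B \<in> Ob D1"
  have "fm G2 (fm Q (\<epsilon>1 B)) \<cdot>\<^bsub>C2\<^esub> (\<omega> (fo F1 (fo G1 B)) \<cdot>\<^bsub>C2\<^esub> fm R (\<eta>1 (fo G1 B)))
      = \<omega> B \<cdot>\<^bsub>C2\<^esub> (fm R (fm G1 (\<epsilon>1 B)) \<cdot>\<^bsub>C2\<^esub> fm R (\<eta>1 (fo G1 B)))"
    by (rule adj2.left.dom.subst_comp2)
      (use B rnat_nat[OF \<omega>, of "\<epsilon>1 B" B] in \<open>simp_all add: rnat_arr[OF \<omega>]\<close>)
  also have "fm R (fm G1 (\<epsilon>1 B)) \<cdot>\<^bsub>C2\<^esub> fm R (\<eta>1 (fo G1 B)) = Ide C2 (fo R (fo G1 B))"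
    using B adj1.triangle_right[OF B] R.fm_comp[of "\<eta>1 (fo G1 B)" "fm G1 (\<epsilon>1 B)"] by simp
  finally have "fm G2 (fm Q (\<epsilon>1 B)) \<cdot>\<^bsub>C2\<^esub> (\<omega> (fo F1 (fo G1 B)) \<cdot>\<^bsub>C2\<^esub> fm R (\<eta>1 (fo G1 B))) = \<omega> B"
    using B by (simp add: rnat_arr[OF \<omega>])
  then have "fm F2 (fm G2 (fm Q (\<epsilon>1 B))) \<cdot>\<^bsub>D2\<^esub>
      (fm F2 (\<omega> (fo F1 (fo G1 B))) \<cdot>\<^bsub>D2\<^esub> fm F2 (fm R (\<eta>1 (fo G1 B)))) = fm F2 (\<omega> B)"
    using B by (simp add: rnat_arr[OF \<omega>] flip: adj2.left.fm_comp)
  then show "\<epsilon>2 (fo Q B) \<cdot>\<^bsub>D2\<^esub> fm F2 (\<omega> B) = fm Q (\<epsilon>1 B) \<cdot>\<^bsub>D2\<^esub> lmate \<omega> (fo G1 B)"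
    unfolding lmate_def
    using adj2.counit_natural_comp[of "fm Q (\<epsilon>1 B)" "fo Q B"
        "fm F2 (\<omega> (fo F1 (fo G1 B))) \<cdot>\<^bsub>D2\<^esub> fm F2 (fm R (\<eta>1 (fo G1 B)))"] B
    by (simp add: rnat_arr[OF \<omega>])
qed

lemma rmate_unique:
  assumes "lnat \<alpha>" "rnat \<omega>" "mates \<alpha> \<omega>" "B \<in> Ob D1"
  shows "rmate \<alpha> B = \<omega> B"
  by (rule adj2.transpose_inj[of _ _ "fo Q B"])
    (use assms matesD[OF assms(3)] matesD[OF mates_rmate] in \<open>simp_all add: rnat_arr\<close>)

lemma lmate_unique:
  assumes \<alpha>: "lnat \<alpha>" and \<omega>: "rnat \<omega>" and m: "mates \<alpha> \<omega>" and A: "A \<in> Ob C1"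
  shows "lmate \<omega> A = \<alpha> A"
proof -
  have "lmate \<omega> A = fm Q (\<epsilon>1 (fo F1 A)) \<cdot>\<^bsub>D2\<^esub> (\<alpha> (fo G1 (fo F1 A)) \<cdot>\<^bsub>D2\<^esub> fm F2 (fm R (\<eta>1 A)))"
    unfolding lmate_def
    by (rule adj2.left.cod.subst_comp2[OF matesD[OF m]]) (use A in \<open>simp_all add: lnat_arr[OF \<alpha>] rnat_arr[OF \<omega>]\<close>)
  also have "\<dots> = fm Q (\<epsilon>1 (fo F1 A)) \<cdot>\<^bsub>D2\<^esub> (fm Q (fm F1 (\<eta>1 A)) \<cdot>\<^bsub>D2\<^esub> \<alpha> A)"
    using A lnat_nat[OF \<alpha>, of "\<eta>1 A"] by simp
  also have "\<dots> = fm Q (Ide D1 (fo F1 A)) \<cdot>\<^bsub>D2\<^esub> \<alpha> A"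
    by (rule adj2.left.cod.subst_comp)
      (use A Q.fm_comp[of "fm F1 (\<eta>1 A)" "\<epsilon>1 (fo F1 A)"] adj1.triangle_left[OF A]
        in \<open>simp_all add: lnat_arr[OF \<alpha>]\<close>)
  also have "\<dots> = \<alpha> A" using A by (simp add: lnat_arr[OF \<alpha>])
  finally show ?thesis .
qed

lemma rmate_nat:
  assumes \<alpha>: "lnat \<alpha>"
  shows "rnat (rmate \<alpha>)"
proof (rule nat_transI)
  fix f assume f: "f \<in> Arr D1"
  let ?B = "Cod D1 f" and ?A = "Dom D1 f"
  have "fm G2 (fm Q f) \<cdot>\<^bsub>C2\<^esub> rmate \<alpha> ?A = rmate \<alpha> ?B \<cdot>\<^bsub>C2\<^esub> fm R (fm G1 f)"
  proof (rule adj2.transpose_inj[of _ _ "fo Q ?B"])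
    have "\<epsilon>2 (fo Q ?B) \<cdot>\<^bsub>D2\<^esub> fm F2 (fm G2 (fm Q f) \<cdot>\<^bsub>C2\<^esub> rmate \<alpha> ?A)
        = fm Q f \<cdot>\<^bsub>D2\<^esub> (\<epsilon>2 (fo Q ?A) \<cdot>\<^bsub>D2\<^esub> fm F2 (rmate \<alpha> ?A))"
      using f \<alpha> by (simp add: adj2.left.fm_comp adj2.counit_natural_comp)
    also have "\<dots> = fm Q f \<cdot>\<^bsub>D2\<^esub> (fm Q (\<epsilon>1 ?A) \<cdot>\<^bsub>D2\<^esub> \<alpha> (fo G1 ?A))"
      using f matesD[OF mates_rmate[OF \<alpha>]] by simp
    also have "\<dots> = fm Q (\<epsilon>1 ?B) \<cdot>\<^bsub>D2\<^esub> (fm Q (fm F1 (fm G1 f)) \<cdot>\<^bsub>D2\<^esub> \<alpha> (fo G1 ?A))"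
      by (rule adj2.left.cod.subst_comp2)
        (use f in \<open>simp_all add: lnat_arr[OF \<alpha>] adj1.counit_natural flip: Q.fm_comp\<close>)
    also have "\<dots> = fm Q (\<epsilon>1 ?B) \<cdot>\<^bsub>D2\<^esub> (\<alpha> (fo G1 ?B) \<cdot>\<^bsub>D2\<^esub> fm F2 (fm R (fm G1 f)))"
      using f lnat_nat[OF \<alpha>, of "fm G1 f"] by simp
    also have "\<dots> = \<epsilon>2 (fo Q ?B) \<cdot>\<^bsub>D2\<^esub> (fm F2 (rmate \<alpha> ?B) \<cdot>\<^bsub>D2\<^esub> fm F2 (fm R (fm G1 f)))"
      by (rule adj2.left.cod.subst_comp2[OF matesD[OF mates_rmate[OF \<alpha>]], symmetric])
        (use f \<alpha> in \<open>simp_all add: lnat_arr[OF \<alpha>]\<close>)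
    finally show "\<epsilon>2 (fo Q ?B) \<cdot>\<^bsub>D2\<^esub> fm F2 (fm G2 (fm Q f) \<cdot>\<^bsub>C2\<^esub> rmate \<alpha> ?A)
        = \<epsilon>2 (fo Q ?B) \<cdot>\<^bsub>D2\<^esub> fm F2 (rmate \<alpha> ?B \<cdot>\<^bsub>C2\<^esub> fm R (fm G1 f))"
      using f \<alpha> by (simp add: adj2.left.fm_comp)
  qed (use f \<alpha> in simp_all)
  then show "rmate \<alpha> ?B \<cdot>\<^bsub>C2\<^esub> fm (comp_fctr R G1) f = fm (comp_fctr G2 Q) f \<cdot>\<^bsub>C2\<^esub> rmate \<alpha> ?A"
    by simp
qed (use \<alpha> in simp)

lemma lmate_nat:
  assumes \<omega>: "rnat \<omega>"
  shows "lnat (lmate \<omega>)"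
proof (rule nat_transI)
  fix f assume f: "f \<in> Arr C1"
  let ?A = "Dom C1 f" and ?B = "Cod C1 f"
  have "fm R (\<eta>1 ?B) \<cdot>\<^bsub>C2\<^esub> fm R f = fm R (fm G1 (fm F1 f)) \<cdot>\<^bsub>C2\<^esub> fm R (\<eta>1 ?A)"
    using f by (simp add: adj1.unit_natural flip: R.fm_comp)
  then have "\<omega> (fo F1 ?B) \<cdot>\<^bsub>C2\<^esub> (fm R (\<eta>1 ?B) \<cdot>\<^bsub>C2\<^esub> fm R f)
      = fm G2 (fm Q (fm F1 f)) \<cdot>\<^bsub>C2\<^esub> (\<omega> (fo F1 ?A) \<cdot>\<^bsub>C2\<^esub> fm R (\<eta>1 ?A))"
    using adj2.left.dom.subst_comp2[OF rnat_nat[OF \<omega>, of "fm F1 f" "fo F1 ?B"], of "fm R (\<eta>1 ?A)"] f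
    by (simp add: rnat_arr[OF \<omega>])
  then have "fm F2 (\<omega> (fo F1 ?B)) \<cdot>\<^bsub>D2\<^esub> (fm F2 (fm R (\<eta>1 ?B)) \<cdot>\<^bsub>D2\<^esub> fm F2 (fm R f))
      = fm F2 (fm G2 (fm Q (fm F1 f))) \<cdot>\<^bsub>D2\<^esub> (fm F2 (\<omega> (fo F1 ?A)) \<cdot>\<^bsub>D2\<^esub> fm F2 (fm R (\<eta>1 ?A)))"
    using f by (simp add: rnat_arr[OF \<omega>] flip: adj2.left.fm_comp)
  then show "lmate \<omega> ?B \<cdot>\<^bsub>D2\<^esub> fm (comp_fctr F2 R) f = fm (comp_fctr Q F1) f \<cdot>\<^bsub>D2\<^esub> lmate \<omega> ?A"
    unfolding lmate_def using f by (simp add: rnat_arr[OF \<omega>] adj2.counit_natural_comp)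
qed (use \<omega> in simp)

end

section \<open>Vanishing objects and distinguished triangles\<close>

text \<open>In an additive category these are the zero objects. In this equational form the property is visibly
  preserved by additive functors.\<close>

definition vanishes :: "('o, 'm, 'x) tricat_scheme \<Rightarrow> 'o \<Rightarrow> bool" where
  "vanishes C A \<longleftrightarrow> A \<in> Ob C \<and> Ide C A = Zero C A A"

lemma (in cat_functor) fully_faithful_reflects_iso:
  assumes ff: "fully_faithful C D F" and f: "f \<in> Arr C" and iso: "is_iso D (fm F f)"
  shows "is_iso C f"
proof -
  let ?A = "Dom C f" and ?B = "Cod C f"
  have bij: "bij_betw (fm F) (Hom C A B) (Hom D (fo F A) (fo F B))" if "A \<in> Ob C" "B \<in> Ob C" for A B
    using ff that unfolding fully_faithful_def by simp
  have "inv_arr D (fm F f) \<in> Hom D (fo F ?B) (fo F ?A)"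
    using iso f by (simp add: cod.Hom_iff)
  then have "inv_arr D (fm F f) \<in> fm F ` Hom C ?B ?A"
    using bij[of ?B ?A] f unfolding bij_betw_def by simp
  then obtain g where g: "g \<in> Arr C" "Dom C g = ?B" "Cod C g = ?A" "fm F g = inv_arr D (fm F f)"
    by (auto simp: dom.Hom_iff)
  have inj: "inj_on (fm F) (Hom C A A)" if "A \<in> Ob C" for A
    using bij[OF that that] unfolding bij_betw_def by simp
  show ?thesis
  proof (rule dom.isoI[of _ g])
    show "g \<cdot>\<^bsub>C\<^esub> f = Ide C ?A"
      by (rule inj_onD[OF inj[of ?A]]) (use f g iso in \<open>simp_all add: dom.Hom_iff fm_comp\<close>)
    show "f \<cdot>\<^bsub>C\<^esub> g = Ide C ?B"
      by (rule inj_onD[OF inj[of ?B]]) (use f g iso in \<open>simp_all add: dom.Hom_iff fm_comp\<close>)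
  qed (use f g in auto)
qed

lemma (in category) zero_object_hom_unique:
  assumes "zero_object C N" "f \<in> Arr C" "g \<in> Arr C" "Dom C f = Dom C g" "Cod C f = Cod C g"
    and "Dom C f = N \<or> Cod C f = N"
  shows "f = g"
proof (cases "Dom C f = N")
  case True
  then have "\<exists>!h. h \<in> Hom C N (Cod C f)"
    using assms unfolding zero_object_def initial_def by simp
  then show ?thesis using assms True by (auto simp: Hom_iff)
next
  case False
  then have "\<exists>!h. h \<in> Hom C (Dom C f) N"
    using assms unfolding zero_object_def terminal_def by simp
  then show ?thesis using assms False by (auto simp: Hom_iff)
qed

context additive_category
begin

lemma zero_arr [simp]:
  assumes "A \<in> Ob C" "B \<in> Ob C"
  shows "Zero C A B \<in> Arr C" "Dom C (Zero C A B) = A" "Cod C (Zero C A B) = B"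
proof -
  interpret G: comm_group "hom_group C A B" using hom_comm_group assms .
  have "Zero C A B \<in> Hom C A B" using G.one_closed by (simp add: hom_group_def)
  then show "Zero C A B \<in> Arr C" "Dom C (Zero C A B) = A" "Cod C (Zero C A B) = B"
    by (auto simp: Hom_iff)
qed

lemma add_idem_zero:
  assumes "f \<in> Arr C" "Add C f f = f"
  shows "f = Zero C (Dom C f) (Cod C f)"
proof -
  interpret G: comm_group "hom_group C (Dom C f) (Cod C f)" using hom_comm_group assms(1) by simp
  have "f \<in> carrier (hom_group C (Dom C f) (Cod C f))"
    using assms(1) by (simp add: hom_group_def Hom_iff)
  then show ?thesis using assms(2) G.r_cancel_one[of f f] by (simp add: hom_group_def)
qed

lemma add_zero_zero:
  assumes "A \<in> Ob C" "B \<in> Ob C"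
  shows "Add C (Zero C A B) (Zero C A B) = Zero C A B"
proof -
  interpret G: comm_group "hom_group C A B" using hom_comm_group assms .
  show ?thesis using G.r_one[OF G.one_closed] by (simp add: hom_group_def)
qed

lemma zero_comp [simp]:
  assumes "f \<in> Arr C" "Cod C f = A" "B \<in> Ob C"
  shows "Zero C A B \<cdot> f = Zero C (Dom C f) B"
proof -
  have A: "A \<in> Ob C" using assms by auto
  have z: "Zero C A B \<cdot> f \<in> Arr C" "Dom C (Zero C A B \<cdot> f) = Dom C f"
    "Cod C (Zero C A B \<cdot> f) = B"
    using assms A by simp_all
  have "Add C (Zero C A B \<cdot> f) (Zero C A B \<cdot> f) = Add C (Zero C A B) (Zero C A B) \<cdot> f"
    using Comp_Add_left[of f "Dom C f" A "Zero C A B" B "Zero C A B"] assms A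
    by (simp add: Hom_iff)
  then show ?thesis using add_zero_zero A assms add_idem_zero[OF z(1)] z by simp
qed

lemma comp_zero [simp]:
  assumes "f \<in> Arr C" "Dom C f = B" "A \<in> Ob C"
  shows "f \<cdot> Zero C A B = Zero C A (Cod C f)"
proof -
  have B: "B \<in> Ob C" using assms by auto
  have z: "f \<cdot> Zero C A B \<in> Arr C" "Dom C (f \<cdot> Zero C A B) = A"
    "Cod C (f \<cdot> Zero C A B) = Cod C f"
    using assms B by simp_all
  have "Add C (f \<cdot> Zero C A B) (f \<cdot> Zero C A B) = f \<cdot> Add C (Zero C A B) (Zero C A B)"
    using Comp_Add_right[of "Zero C A B" A B "Zero C A B" f "Cod C f"] assms B
    by (simp add: Hom_iff)
  then show ?thesis using add_zero_zero B assms add_idem_zero[OF z(1)] z by simp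
qed

lemma vanishes_ob: "vanishes C A \<Longrightarrow> A \<in> Ob C"
  by (simp add: vanishes_def)

lemma into_vanishing: "\<lbrakk>vanishes C B; f \<in> Arr C; Cod C f = B\<rbrakk> \<Longrightarrow> f = Zero C (Dom C f) B"
  using zero_comp[of f B B] ide_left[of f B] by (auto simp: vanishes_def)

lemma from_vanishing: "\<lbrakk>vanishes C A; f \<in> Arr C; Dom C f = A\<rbrakk> \<Longrightarrow> f = Zero C A (Cod C f)"
  using comp_zero[of f A A] ide_right[of f A] by (auto simp: vanishes_def)

lemma vanishing_iso:
  assumes "vanishes C A" "vanishes C B" "f \<in> Arr C" "Dom C f = A" "Cod C f = B"
  shows "is_iso C f"
  by (rule isoI[of _ "Zero C B A"]) (use assms vanishes_ob in \<open>auto simp: vanishes_def\<close>)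

lemma vanishes_iso:
  assumes iso: "is_iso C f" and v: "vanishes C (Dom C f) \<or> vanishes C (Cod C f)"
  shows "vanishes C (Dom C f)" "vanishes C (Cod C f)"
proof -
  have f: "f \<in> Arr C" using iso iso_arr by simp
  have g: "inv_arr C f \<in> Arr C" using iso by simp
  have "f = Zero C (Dom C f) (Cod C f)"
    using v f into_vanishing[OF _ f] from_vanishing[OF _ f] by auto
  then have "inv_arr C f \<cdot> f = Zero C (Dom C f) (Dom C f)"
      "f \<cdot> inv_arr C f = Zero C (Cod C f) (Cod C f)"
    using iso f g comp_zero[of "inv_arr C f" "Cod C f" "Dom C f"]
      zero_comp[of "inv_arr C f" "Dom C f" "Cod C f"] by simp_all
  then show "vanishes C (Dom C f)" "vanishes C (Cod C f)"
    using iso f by (simp_all add: vanishes_def)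
qed

lemma neg_arr_arr [simp]:
  assumes "f \<in> Arr C"
  shows "neg_arr C f \<in> Arr C" "Dom C (neg_arr C f) = Dom C f" "Cod C (neg_arr C f) = Cod C f"
    and add_neg: "Add C f (neg_arr C f) = Zero C (Dom C f) (Cod C f)"
proof -
  interpret G: comm_group "hom_group C (Dom C f) (Cod C f)" using hom_comm_group assms by simp
  have f: "f \<in> carrier (hom_group C (Dom C f) (Cod C f))"
    using assms by (simp add: hom_group_def Hom_iff)
  then have "neg_arr C f \<in> Hom C (Dom C f) (Cod C f)"
    using G.inv_closed by (simp add: neg_arr_def hom_group_def)
  then show "neg_arr C f \<in> Arr C" "Dom C (neg_arr C f) = Dom C f" "Cod C (neg_arr C f) = Cod C f"
    by (auto simp: Hom_iff)
  show "Add C f (neg_arr C f) = Zero C (Dom C f) (Cod C f)"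
    using G.r_inv[OF f] by (simp add: neg_arr_def hom_group_def)
qed

lemma neg_unique:
  assumes "f \<in> Arr C" "g \<in> Arr C" "Dom C g = Dom C f" "Cod C g = Cod C f"
    and "Add C f g = Zero C (Dom C f) (Cod C f)"
  shows "g = neg_arr C f"
proof -
  interpret G: comm_group "hom_group C (Dom C f) (Cod C f)" using hom_comm_group assms(1) by simp
  have "f \<in> carrier (hom_group C (Dom C f) (Cod C f))" "g \<in> carrier (hom_group C (Dom C f) (Cod C f))"
    using assms by (simp_all add: hom_group_def Hom_iff)
  then show ?thesis
    using assms(5) G.inv_equality[of g f] G.m_comm[of f g] by (simp add: neg_arr_def hom_group_def)
qed

lemma neg_neg: assumes "f \<in> Arr C" shows "neg_arr C (neg_arr C f) = f"
proof -
  interpret G: comm_group "hom_group C (Dom C f) (Cod C f)" using hom_comm_group assms(1) by simp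
  have "f \<in> carrier (hom_group C (Dom C f) (Cod C f))"
    using assms by (simp_all add: hom_group_def Hom_iff)
  then show ?thesis
    using G.inv_inv assms neg_arr_arr[OF assms] by (simp add: neg_arr_def[of C] )
qed

lemma neg_comp_right:
  assumes "f \<in> Arr C" "g \<in> Arr C" "Cod C f = Dom C g"
  shows "g \<cdot> neg_arr C f = neg_arr C (g \<cdot> f)"
  by (rule neg_unique)
    (use assms Comp_Add_right[of f "Dom C f" "Dom C g" "neg_arr C f" g "Cod C g"] add_neg[of f]
      in \<open>simp_all add: Hom_iff\<close>)

lemma neg_comp_left:
  assumes "f \<in> Arr C" "g \<in> Arr C" "Cod C f = Dom C g"
  shows "neg_arr C g \<cdot> f = neg_arr C (g \<cdot> f)"
  by (rule neg_unique)
    (use assms Comp_Add_left[of f "Dom C f" "Dom C g" g "Cod C g" "neg_arr C g"] add_neg[of g]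
      in \<open>simp_all add: Hom_iff\<close>)

end

lemma additive_functor_zero:
  assumes F: "additive_functor C D F" and C: "additive_category C" and D: "additive_category D"
    and A: "A \<in> Ob C" and B: "B \<in> Ob C"
  shows "fm F (Zero C A B) = Zero D (fo F A) (fo F B)"
proof -
  interpret C: additive_category C by fact
  interpret D: additive_category D by fact
  interpret F: cat_functor C D F using F unfolding additive_functor_def by simp
  have "Zero C A B \<in> Hom C A B" using A B by (simp add: C.Hom_iff)
  then have "fm F (Add C (Zero C A B) (Zero C A B)) = Add D (fm F (Zero C A B)) (fm F (Zero C A B))"
    using F A B unfolding additive_functor_def by blast
  then show ?thesis
    using D.add_idem_zero[of "fm F (Zero C A B)"] C.add_zero_zero[OF A B] A B by simp
qed

lemma additive_functor_vanishes:
  assumes F: "additive_functor C D F" and C: "additive_category C" and D: "additive_category D"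
    and A: "vanishes C A"
  shows "vanishes D (fo F A)"
proof -
  interpret F: cat_functor C D F using F unfolding additive_functor_def by simp
  show ?thesis
    using A additive_functor_zero[OF F C D, of A A] F.fm_ide[of A] by (auto simp: vanishes_def)
qed

context triangulated_category
begin

lemma shift_functor: "cat_functor C C (Shift C)"
  using shift_additive by (simp add: additive_functor_def)

lemma triangle_arr:
  assumes "(f, g, h) \<in> Dist C"
  shows "f \<in> Arr C" "g \<in> Arr C" "h \<in> Arr C" "Cod C f = Dom C g" "Cod C g = Dom C h"
    "Cod C h = fo (Shift C) (Dom C f)"
  using Dist_triangle[OF assms] by (auto simp: is_triangle_def)

lemma rotate:
  "(f, g, h) \<in> Dist C \<Longrightarrow> (g, h, neg_arr C (fm (Shift C) f)) \<in> Dist C"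
  using TR2 Dist_triangle by blast

text \<open>Rotating the triangle and comparing it with the rotated triangles of \<open>Ide Y\<close> and \<open>Ide X\<close> produces a right
  and a left inverse of \<open>f[1]\<close>. The shift is fully faithful and hence reflects invertibility.\<close>

lemma iso_if_cone_vanishes:
  assumes t: "(f, g, h) \<in> Dist C" and v: "vanishes C (Cod C g)"
  shows "is_iso C f"
proof -
  interpret sh: cat_functor C C "Shift C" by (rule shift_functor)
  obtain N where N: "zero_object C N" using zero_object_exists by blast
  then have NO: "N \<in> Ob C" by (simp add: zero_object_def initial_def)
  let ?s = "fm (Shift C)" and ?S = "fo (Shift C)"
  obtain X Y Z where X: "Dom C f = X" and Y: "Cod C f = Y" and Z: "Cod C g = Z" by blast
  have arr: "f \<in> Arr C" "Dom C f = X" "Cod C f = Y" "g \<in> Arr C" "Dom C g = Y" "Cod C g = Z"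
    "h \<in> Arr C" "Dom C h = Z" "Cod C h = ?S X" "X \<in> Ob C" "Y \<in> Ob C" "Z \<in> Ob C"
    using triangle_arr[OF t] X Y Z by auto
  have g0: "g = Zero C Y Z" and h0: "h = Zero C Z (?S X)"
    using into_vanishing[of Z g] from_vanishing[of Z h] v arr by simp_all
  have "(Zero C Y N, Zero C N (?S Y), neg_arr C (?s (Ide C Y))) \<in> Dist C"
    using rotate[OF TR1_Ide[of Y N]] N arr by simp
  from TR3[OF this rotate[OF t], of "Ide C Y" "Zero C N Z"]
  obtain c where c: "triangle_morphism C (Zero C Y N, Zero C N (?S Y), neg_arr C (?s (Ide C Y)))
      (g, h, neg_arr C (?s f)) (Ide C Y) (Zero C N Z) c"
    using arr NO g0 by (auto simp: Hom_iff)
  then have carr: "c \<in> Arr C" "Dom C c = ?S Y" "Cod C c = ?S X"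
    and "neg_arr C (Ide C (?S Y)) = neg_arr C (?s f) \<cdot> c"
    using arr NO by (auto simp: triangle_morphism_def Hom_iff)
  moreover have "neg_arr C (?s f) \<cdot> c = neg_arr C (?s f \<cdot> c)"
    using neg_comp_left[of c "?s f"] carr arr by simp
  ultimately have "neg_arr C (neg_arr C (?s f \<cdot> c)) = neg_arr C (neg_arr C (Ide C (?S Y)))"
    by argo
  then have right: "?s f \<cdot> c = Ide C (?S Y)"
    using carr(1-3) arr by (subst (asm) (1 2) neg_neg) simp_all
  have "(Zero C N (?S X), neg_arr C (?s (Ide C X)), neg_arr C (?s (Zero C X N))) \<in> Dist C"
    using rotate[OF rotate[OF TR1_Ide[of X N]]] N arr by simp
  from TR3[OF rotate[OF rotate[OF t]] this, of "Zero C Z N" "Ide C (?S X)"]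
  obtain d where d: "triangle_morphism C (h, neg_arr C (?s f), neg_arr C (?s g))
      (Zero C N (?S X), neg_arr C (?s (Ide C X)), neg_arr C (?s (Zero C X N)))
      (Zero C Z N) (Ide C (?S X)) d"
    using arr NO h0 by (auto simp: Hom_iff)
  then have darr: "d \<in> Arr C" "Dom C d = ?S Y" "Cod C d = ?S X"
    and "d \<cdot> neg_arr C (?s f) = neg_arr C (Ide C (?S X))"
    using arr NO by (auto simp: triangle_morphism_def Hom_iff)
  moreover have "d \<cdot> neg_arr C (?s f) = neg_arr C (d \<cdot> ?s f)"
    using neg_comp_right[of "?s f" d] darr arr by simp
  ultimately have "neg_arr C (neg_arr C (d \<cdot> ?s f)) = neg_arr C (neg_arr C (Ide C (?S X)))"
    by argo
  then have left: "d \<cdot> ?s f = Ide C (?S X)"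
    using darr(1-3) arr by (subst (asm) (1 2) neg_neg) simp_all
  have "d = (d \<cdot> ?s f) \<cdot> c" using right carr darr arr by simp
  then have "d = c" using left carr by simp
  then have "is_iso C (?s f)"
    using isoI[of "?s f" c] left right carr arr by simp
  then show ?thesis
    using sh.fully_faithful_reflects_iso[OF shift_fully_faithful arr(1)] by blast
qed

text \<open>Since \<open>f\<close> is invertible, \<open>(f, 0, 0)\<close> with third object zero is distinguished as well. Comparing it with
  \<open>(f, g, h)\<close> in both directions gives \<open>g = 0\<close> and \<open>h = 0\<close>. Because \<open>h = 0\<close>, the identity of the cone
  \<open>Z\<close> lifts along \<open>g\<close> after a shift, and because \<open>g = 0\<close> it must vanish.\<close>

lemma cone_of_iso_vanishes:
  assumes t: "(f, g, h) \<in> Dist C" and f: "is_iso C f"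
  shows "vanishes C (Cod C g)"
proof -
  interpret sh: cat_functor C C "Shift C" by (rule shift_functor)
  have szero: "fm (Shift C) (Zero C A B) = Zero C (fo (Shift C) A) (fo (Shift C) B)"
    if "A \<in> Ob C" "B \<in> Ob C" for A B
    using additive_functor_zero[OF shift_additive] that additive_category_axioms by blast
  obtain N where N: "zero_object C N" using zero_object_exists by blast
  then have NO: "N \<in> Ob C" by (simp add: zero_object_def initial_def)
  let ?s = "fm (Shift C)" and ?S = "fo (Shift C)"
  obtain X Y Z where X: "Dom C f = X" and Y: "Cod C f = Y" and Z: "Cod C g = Z" by blast
  have arr: "f \<in> Arr C" "Dom C f = X" "Cod C f = Y" "g \<in> Arr C" "Dom C g = Y" "Cod C g = Z"
    "h \<in> Arr C" "Dom C h = Z" "Cod C h = ?S X" "X \<in> Ob C" "Y \<in> Ob C" "Z \<in> Ob C"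
    using triangle_arr[OF t] X Y Z by auto
  let ?t = "(f, Zero C Y N, Zero C N (?S X))"
  have t': "?t \<in> Dist C"
  proof (rule TR1_iso[OF TR1_Ide[of X N] _ _ _ f])
    show "triangle_morphism C (Ide C X, Zero C X N, Zero C N (?S X)) ?t (Ide C X) f (Ide C N)"
      using arr NO by (simp add: triangle_morphism_def Hom_iff)
  qed (use arr NO N in \<open>simp_all add: is_triangle_def\<close>)
  have g0: "g = Zero C Y Z"
  proof -
    obtain c where "triangle_morphism C ?t (f, g, h) (Ide C X) (Ide C Y) c"
      using TR3[OF t' t, of "Ide C X" "Ide C Y"] arr by (auto simp: Hom_iff)
    then have "c \<in> Arr C" "Dom C c = N" "Cod C c = Z" "c \<cdot> Zero C Y N = g"
      using arr NO by (auto simp: triangle_morphism_def Hom_iff)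
    moreover have "c \<cdot> Zero C Y N = Zero C Y Z" using calculation arr by simp
    ultimately show ?thesis by simp
  qed
  have h0: "h = Zero C Z (?S X)"
  proof -
    obtain c where "triangle_morphism C (f, g, h) ?t (Ide C X) (Ide C Y) c"
      using TR3[OF t t', of "Ide C X" "Ide C Y"] arr by (auto simp: Hom_iff)
    then have "c \<in> Arr C" "Dom C c = Z" "Cod C c = N" "h = Zero C N (?S X) \<cdot> c"
      using arr NO by (auto simp: triangle_morphism_def Hom_iff)
    moreover have "Zero C N (?S X) \<cdot> c = Zero C Z (?S X)" using calculation(1-3) arr(10) by simp
    ultimately show ?thesis by argo
  qed
  have "(Zero C Z N, Zero C N (?S Z), neg_arr C (?s (Ide C Z))) \<in> Dist C"
    using rotate[OF TR1_Ide[of Z N]] N arr by simp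
  from TR3[OF this rotate[OF rotate[OF t]], of "Ide C Z" "Zero C N (?S X)"]
  obtain c where "triangle_morphism C (Zero C Z N, Zero C N (?S Z), neg_arr C (?s (Ide C Z)))
      (h, neg_arr C (?s f), neg_arr C (?s g)) (Ide C Z) (Zero C N (?S X)) c"
    using arr NO h0 by (auto simp: Hom_iff)
  then have carr: "c \<in> Arr C" "Dom C c = ?S Z" "Cod C c = ?S Y"
    and "neg_arr C (Ide C (?S Z)) = neg_arr C (?s g) \<cdot> c"
    using arr NO by (auto simp: triangle_morphism_def Hom_iff)
  moreover have "neg_arr C (?s g) \<cdot> c = neg_arr C (?s g \<cdot> c)"
    using neg_comp_left[of c "?s g"] carr arr by simp
  ultimately have "neg_arr C (neg_arr C (Ide C (?S Z))) = neg_arr C (neg_arr C (?s g \<cdot> c))"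
    by argo
  then have "Ide C (?S Z) = ?s g \<cdot> c"
    using carr(1-3) arr by (subst (asm) (1 2) neg_neg) simp_all
  also have "?s g = Zero C (?S Y) (?S Z)" using g0 szero[of Y Z] arr by simp
  also have "\<dots> \<cdot> c = Zero C (?S Z) (?S Z)" using carr arr by simp
  finally have eq: "?s (Ide C Z) = ?s (Zero C Z Z)" using szero arr by simp
  have "inj_on ?s (Hom C Z Z)"
    using shift_fully_faithful arr(12) by (simp add: fully_faithful_def bij_betw_def)
  then have "Ide C Z = Zero C Z Z"
    by (rule inj_onD[where f = ?s, OF _ eq]) (use arr(12) in \<open>simp_all add: Hom_iff\<close>)
  then show ?thesis using arr by (simp add: vanishes_def)
qed

end

section \<open>Localization in a localic fibered category\<close>

context tri_fibered_category
begin

lemma fib_category: "X \<in> Ob S \<Longrightarrow> category (fib H X)"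
  and fib_additive: "X \<in> Ob S \<Longrightarrow> additive_category (fib H X)"
  using fib_triangulated[of X]
  by (simp_all add: triangulated_category_def additive_category_def)

lemma pull_functor: "f \<in> Hom S Y X \<Longrightarrow> cat_functor (fib H X) (fib H Y) (pull H f)"
  using pull_triangulated[of f Y X]
  by (simp add: triangulated_functor_def additive_functor_def)

lemma conn_arr:
  assumes "f \<in> Hom S Y X" "g \<in> Hom S X V" "A \<in> Ob (fib H V)"
  shows "conn H f g A \<in> Arr (fib H Y)" "Dom (fib H Y) (conn H f g A) = fo (pull H (g \<cdot> f)) A"
    "Cod (fib H Y) (conn H f g A) = fo (pull H f) (fo (pull H g) A)"
    "is_iso (fib H Y) (conn H f g A)"
  using conn_iso[OF assms(1,2)] assms(3)
  by (auto simp: tri_nat_iso_def nat_iso_def nat_trans_def Hom_def)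

lemma conn_natural:
  assumes "f \<in> Hom S Y X" "g \<in> Hom S X V" "\<phi> \<in> Arr (fib H V)" "Cod (fib H V) \<phi> = B"
  shows "conn H f g B \<cdot>\<^bsub>fib H Y\<^esub> fm (pull H (g \<cdot> f)) \<phi>
    = fm (pull H f) (fm (pull H g) \<phi>) \<cdot>\<^bsub>fib H Y\<^esub> conn H f g (Dom (fib H V) \<phi>)"
proof -
  have "V \<in> Ob S" using assms(2) by (auto simp: Hom_def)
  then interpret V: category "fib H V" by (rule fib_category)
  have "nat_trans (fib H V) (fib H Y) (pull H (g \<cdot> f))
      (comp_tfctr (fib H Y) (pull H f) (pull H g)) (conn H f g)"
    using conn_iso[OF assms(1,2)] by (simp add: tri_nat_iso_def nat_iso_def)
  from V.nat_trans_nat[OF this assms(3,4)] show ?thesis by simp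
qed

lemma pull_Ide_simps:
  "\<lbrakk>X \<in> Ob S; A \<in> Ob (fib H X)\<rbrakk> \<Longrightarrow> fo (pull H (Ide S X)) A = A"
  "\<lbrakk>X \<in> Ob S; f \<in> Arr (fib H X)\<rbrakk> \<Longrightarrow> fm (pull H (Ide S X)) f = f"
  using pull_Ide[of X] by (simp_all add: tfctr_eq_def fctr_eq_def)

lemma exchange_arr:
  assumes a: "a \<in> Hom S Y X" and b: "b \<in> Hom S X V" and c: "c \<in> Hom S Y X'" and d: "d \<in> Hom S X' V"
    and eq: "b \<cdot> a = d \<cdot> c" and A: "A \<in> Ob (fib H V)"
  shows "exchange S H a b c d A \<in> Arr (fib H Y)"
    "Dom (fib H Y) (exchange S H a b c d A) = fo (pull H a) (fo (pull H b) A)"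
    "Cod (fib H Y) (exchange S H a b c d A) = fo (pull H c) (fo (pull H d) A)"
proof -
  have "Y \<in> Ob S" and D: "Dom S a = Y" using a by (auto simp: Hom_def)
  then interpret Y: category "fib H Y" by (simp add: fib_category)
  show "exchange S H a b c d A \<in> Arr (fib H Y)"
    "Dom (fib H Y) (exchange S H a b c d A) = fo (pull H a) (fo (pull H b) A)"
    "Cod (fib H Y) (exchange S H a b c d A) = fo (pull H c) (fo (pull H d) A)"
    using conn_arr[OF a b A] conn_arr[OF c d A] eq by (simp_all add: exchange_def D)
qed

end

locale localic = base_category S + localic_fibered_category S H
  for S :: "('s, 'a, 'x) basecat_scheme" (structure)
    and H :: "('s, 'a, 'o, 'm, 'y) fibcat_adj_scheme"
begin

lemma Sm_Hom: "p \<in> Sm S \<Longrightarrow> p \<in> Hom S (Dom S p) (Cod S p)"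
  and Cl_Hom: "p \<in> Cl S \<Longrightarrow> p \<in> Hom S (Dom S p) (Cod S p)"
  using Sm_Arr Cl_Arr by (auto simp: Hom_def)

lemma push_adj:
  assumes "z \<in> Cl S" "z \<in> Hom S Z X"
  shows "adjunction (fib H X) (fib H Z) (pull H z) (push H z) (push_unit H z) (push_counit H z)"
  using push_adjunction[of z] assms by (auto simp: Hom_def)

lemma sharp_adj:
  assumes "p \<in> Sm S" "p \<in> Hom S P X"
  shows "adjunction (fib H P) (fib H X) (sharp H p) (pull H p) (sharp_unit H p) (sharp_counit H p)"
  using sharp_adjunction[of p] assms by (auto simp: Hom_def)

lemma push_counit_iso:
  assumes z: "z \<in> Cl S" "z \<in> Hom S Z X" and B: "B \<in> Ob (fib H Z)"
  shows "is_iso (fib H Z) (push_counit H z B)"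
proof -
  interpret z: adjunction "fib H X" "fib H Z" "pull H z" "push H z" "push_unit H z" "push_counit H z"
    using push_adj z .
  show ?thesis using z.counit_iso push_fully_faithful[OF z(1)] B z(2) by (auto simp: Hom_def)
qed

text \<open>The identity of \<open>U\<close> corresponds to \<open>u\<close> itself, so \<open>u\<close> belongs to the arrows whose fibre product with \<open>z\<close>
  is empty.\<close>

lemma Opn_cartesian_Emp:
  assumes z: "z \<in> Cl S" "z \<in> Hom S Z X" and u: "Opn S z \<in> Hom S U X"
  obtains i j where "i \<in> Hom S (Emp S) Z" "j \<in> Hom S (Emp S) U" "cartesian S (Opn S z) z i j"
proof -
  have U: "U \<in> Ob S" "Ide S U \<in> Hom S U U" "Opn S z \<cdot> Ide S U = Opn S z"
    using u Ide_in Comp_Ide_right[OF u] by (auto simp: Hom_def)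
  have "Opn S z \<in> (\<lambda>g. Opn S z \<cdot> g) ` Hom S U (Dom S (Opn S z))"
    by (rule image_eqI[of _ _ "Ide S U"]) (use U u in \<open>auto simp: Hom_def\<close>)
  then have "Opn S z \<in> {f \<in> Hom S U (Cod S z).
      \<exists>i \<in> Hom S (Emp S) (Dom S z). \<exists>j \<in> Hom S (Emp S) U. cartesian S f z i j}"
    using Opn_universal[OF z(1) U(1)] unfolding bij_betw_def by blast
  then show ?thesis using that z by (auto simp: Hom_def)
qed

text \<open>By smooth base change, \<open>z\<^sup>* u\<^sub># A\<close> is \<open>i\<^sub># j\<^sup>* A\<close>, where \<open>j\<^sup>* A\<close> lies over the empty object and is zero.
  The left adjoint \<open>i\<^sub>#\<close> preserves initial objects.\<close>

lemma pull_closed_sharp_open_vanishes: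
  assumes z: "z \<in> Cl S" "z \<in> Hom S Z X" and u: "Opn S z \<in> Hom S U X" and A: "A \<in> Ob (fib H U)"
  shows "vanishes (fib H Z) (fo (pull H z) (fo (sharp H (Opn S z)) A))"
proof -
  let ?u = "Opn S z"
  have Sm: "?u \<in> Sm S" using Opn_Sm z by simp
  obtain i j where i: "i \<in> Hom S (Emp S) Z" and j: "j \<in> Hom S (Emp S) U"
    and c: "cartesian S ?u z i j"
    using Opn_cartesian_Emp[OF z u] .
  have iS: "i \<in> Sm S" using Sm_base_change[OF Sm c] .
  have ob: "X \<in> Ob S" "Z \<in> Ob S" "U \<in> Ob S" "Emp S \<in> Ob S"
    using z u Emp_initial by (auto simp: Hom_def initial_def)
  interpret Z: additive_category "fib H Z" using ob by (simp add: fib_additive)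
  interpret E: additive_category "fib H (Emp S)" using ob by (simp add: fib_additive)
  interpret u: adjunction "fib H U" "fib H X" "sharp H ?u" "pull H ?u" "sharp_unit H ?u" "sharp_counit H ?u"
    using sharp_adj Sm u .
  interpret i: adjunction "fib H (Emp S)" "fib H Z" "sharp H i" "pull H i" "sharp_unit H i" "sharp_counit H i"
    using sharp_adj iS i .
  interpret jp: cat_functor "fib H U" "fib H (Emp S)" "pull H j" using pull_functor j .
  interpret zp: cat_functor "fib H X" "fib H Z" "pull H z" using pull_functor z(2) .
  let ?b = "sharp_base_change S H ?u z i j A" and ?N = "fo (sharp H i) (fo (pull H j) A)"
  have dz: "Dom S z = Z" using z(2) by (simp add: Hom_def)
  have "?u \<cdot> j = z \<cdot> i" using c by (simp add: cartesian_def)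
  note ex = exchange_arr[OF j u i z(2) this, of "fo (sharp H ?u) A"]
  have b: "?b \<in> Arr (fib H Z)" "Dom (fib H Z) ?b = ?N"
    "Cod (fib H Z) ?b = fo (pull H z) (fo (sharp H ?u) A)"
    using A ex by (simp_all add: sharp_base_change_def dz)
  have "is_iso (fib H Z) ?b"
    using sharp_base_change_iso[OF Sm c] A dz u by (simp add: Hom_def)
  moreover have "vanishes (fib H Z) ?N"
  proof -
    have "zero_object (fib H (Emp S)) (fo (pull H j) A)" using fib_Emp A by simp
    then have "fm (pull H i) (Ide (fib H Z) ?N) \<cdot>\<^bsub>fib H (Emp S)\<^esub> sharp_unit H i (fo (pull H j) A)
        = fm (pull H i) (Zero (fib H Z) ?N ?N) \<cdot>\<^bsub>fib H (Emp S)\<^esub> sharp_unit H i (fo (pull H j) A)"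
      by (rule E.zero_object_hom_unique) (use A in simp_all)
    then have "Ide (fib H Z) ?N = Zero (fib H Z) ?N ?N"
      using i.cotranspose_inj[of "Ide (fib H Z) ?N" "Zero (fib H Z) ?N ?N" "fo (pull H j) A"] A by simp
    then show ?thesis using A by (simp add: vanishes_def)
  qed
  ultimately show ?thesis using Z.vanishes_iso b by metis
qed

lemma pull_open_push_vanishes:
  assumes z: "z \<in> Cl S" "z \<in> Hom S Z X" and u: "Opn S z \<in> Hom S U X" and B: "B \<in> Ob (fib H Z)"
  shows "vanishes (fib H U) (fo (pull H (Opn S z)) (fo (push H z) B))"
proof -
  let ?u = "Opn S z"
  have Sm: "?u \<in> Sm S" using Opn_Sm z by simp
  have ob: "X \<in> Ob S" "Z \<in> Ob S" "U \<in> Ob S" using z u by (auto simp: Hom_def)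
  interpret U: additive_category "fib H U" using ob by (simp add: fib_additive)
  interpret Z: additive_category "fib H Z" using ob by (simp add: fib_additive)
  interpret u: adjunction "fib H U" "fib H X" "sharp H ?u" "pull H ?u" "sharp_unit H ?u" "sharp_counit H ?u"
    using sharp_adj Sm u .
  interpret z: adjunction "fib H X" "fib H Z" "pull H z" "push H z" "push_unit H z" "push_counit H z"
    using push_adj z .
  let ?V = "fo (pull H ?u) (fo (push H z) B)"
  have V: "?V \<in> Ob (fib H U)" using B by simp
  \<comment> \<open>an arrow into \<open>u\<^sup>* z\<^sub>* B\<close> is adjoint to one out of the vanishing object \<open>z\<^sup>* u\<^sub># V\<close>\<close>
  have "a = b" if a: "a \<in> Arr (fib H U)" "Dom (fib H U) a = ?V" "Cod (fib H U) a = ?V"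
    and b: "b \<in> Arr (fib H U)" "Dom (fib H U) b = ?V" "Cod (fib H U) b = ?V" for a b
  proof (rule u.transpose_inj[of _ _ "fo (push H z) B"])
    let ?t = "\<lambda>a. sharp_counit H ?u (fo (push H z) B) \<cdot>\<^bsub>fib H X\<^esub> fm (sharp H ?u) a"
    have van: "vanishes (fib H Z) (fo (pull H z) (fo (sharp H ?u) ?V))"
      using pull_closed_sharp_open_vanishes[OF z u V] .
    show "?t a = ?t b"
    proof (rule z.transpose_inj[of _ _ B])
      show "push_counit H z B \<cdot>\<^bsub>fib H Z\<^esub> fm (pull H z) (?t a)
          = push_counit H z B \<cdot>\<^bsub>fib H Z\<^esub> fm (pull H z) (?t b)"
        using Z.from_vanishing[OF van, of "push_counit H z B \<cdot>\<^bsub>fib H Z\<^esub> fm (pull H z) (?t a)"]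
          Z.from_vanishing[OF van, of "push_counit H z B \<cdot>\<^bsub>fib H Z\<^esub> fm (pull H z) (?t b)"] a b B
        by simp
    qed (use a b B in simp_all)
  qed (use a b B in simp_all)
  from this[of "Ide (fib H U) ?V" "Zero (fib H U) ?V ?V"] show ?thesis
    using V by (simp add: vanishes_def)
qed

lemma Opn_mono_cartesian:
  assumes z: "z \<in> Cl S" and u: "Opn S z \<in> Hom S U X"
  shows "cartesian S (Opn S z) (Opn S z) (Ide S U) (Ide S U)"
proof -
  let ?u = "Opn S z"
  have U: "U \<in> Ob S" "Ide S U \<in> Hom S U U" using u Ide_in by (auto simp: Hom_def)
  have "\<exists>!m. m \<in> Hom S W U \<and> Ide S U \<cdot> m = a \<and> Ide S U \<cdot> m = b"
    if W: "W \<in> Ob S" and a: "a \<in> Hom S W U" and b: "b \<in> Hom S W U" and e: "?u \<cdot> a = ?u \<cdot> b" for W a b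
  proof -
    have "inj_on (\<lambda>g. ?u \<cdot> g) (Hom S W (Dom S ?u))"
      using Opn_universal[OF z W] unfolding bij_betw_def by simp
    then have "a = b" by (rule inj_onD[where f = "\<lambda>g. ?u \<cdot> g", OF _ e]) (use a b u in \<open>auto simp: Hom_def\<close>)
    moreover have "Ide S U \<cdot> a = a" using a Comp_Ide_left by blast
    moreover have "Ide S U \<cdot> m = m" if "m \<in> Hom S W U" for m using that Comp_Ide_left by blast
    ultimately show ?thesis using a by metis
  qed
  moreover have "Dom S ?u = U" "?u \<in> Arr S" "Ide S U \<in> Arr S" "Dom S (Ide S U) = U" "Cod S (Ide S U) = U"
    using u U by (auto simp: Hom_def)
  ultimately show ?thesis unfolding cartesian_def by simp
qed

text \<open>\<open>u\<^sub>#\<close> is fully faithful: since \<open>u\<close> is a monomorphism, the unit \<open>A \<rightarrow> u\<^sup>* u\<^sub># A\<close> is the smooth base change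
  transformation of the Cartesian square formed by \<open>u\<close>, \<open>u\<close> and two identities.\<close>

lemma sharp_open_unit_iso:
  assumes z: "z \<in> Cl S" and u: "Opn S z \<in> Hom S U X" and A: "A \<in> Ob (fib H U)"
  shows "is_iso (fib H U) (sharp_unit H (Opn S z) A)"
proof -
  let ?u = "Opn S z" and ?i = "Ide S U"
  have Sm: "?u \<in> Sm S" using Opn_Sm z by simp
  have ob: "X \<in> Ob S" "U \<in> Ob S" and du: "Dom S ?u = U" using u by (auto simp: Hom_def)
  have i: "?i \<in> Hom S U U" and iA: "?i \<in> Arr S" "Dom S ?i = U"
    using ob Ide_in by (auto simp: Hom_def)
  interpret u: adjunction "fib H U" "fib H X" "sharp H ?u" "pull H ?u" "sharp_unit H ?u" "sharp_counit H ?u"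
    using sharp_adj Sm u .
  let ?B = "fo (sharp H ?u) A"
  note c = Opn_mono_cartesian[OF z u]
  have ex: "exchange S H ?i ?u ?i ?u ?B = Ide (fib H U) (fo (pull H ?u) ?B)"
    using conn_arr[OF i u, of ?B] A ob by (simp add: exchange_def iA pull_Ide_simps)
  have "sharp_base_change S H ?u ?u ?i ?i A = sharp_unit H ?u A"
    using A ob sharp_Ide[of U] sharp_Ide_unit[of U]
    by (simp add: sharp_base_change_def ex du pull_Ide_simps fctr_eq_def)
  then show ?thesis using sharp_base_change_iso[OF Sm c, of A] A du iA(2) by metis
qed

lemma iso_if_pull_iso:
  assumes z: "z \<in> Cl S" "z \<in> Hom S Z X" and u: "Opn S z \<in> Hom S U X"
    and \<phi>: "\<phi> \<in> Arr (fib H X)" "is_iso (fib H Z) (fm (pull H z) \<phi>)"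
      "is_iso (fib H U) (fm (pull H (Opn S z)) \<phi>)"
  shows "is_iso (fib H X) \<phi>"
  using jointly_conservative[OF z(1), of \<phi>] z(2) u \<phi> by (simp add: Hom_def)

text \<open>An object that vanishes on the closed part is extended by \<open>u\<^sub>#\<close> from the open part: the counit is an
  arrow between objects killed by \<open>z\<^sup>*\<close>, and \<open>u\<^sup>*\<close> inverts it because \<open>u\<^sub>#\<close> is fully faithful.\<close>

lemma sharp_open_counit_iso:
  assumes z: "z \<in> Cl S" "z \<in> Hom S Z X" and u: "Opn S z \<in> Hom S U X" and G: "G \<in> Ob (fib H X)"
    and van: "vanishes (fib H Z) (fo (pull H z) G)"
  shows "is_iso (fib H X) (sharp_counit H (Opn S z) G)"
proof -
  let ?u = "Opn S z"
  have Sm: "?u \<in> Sm S" using Opn_Sm z by simp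
  have ob: "X \<in> Ob S" "Z \<in> Ob S" "U \<in> Ob S" using z u by (auto simp: Hom_def)
  interpret Z: additive_category "fib H Z" using ob by (simp add: fib_additive)
  interpret u: adjunction "fib H U" "fib H X" "sharp H ?u" "pull H ?u" "sharp_unit H ?u" "sharp_counit H ?u"
    using sharp_adj Sm u .
  interpret zp: cat_functor "fib H X" "fib H Z" "pull H z" using pull_functor z(2) .
  have "is_iso (fib H Z) (fm (pull H z) (sharp_counit H ?u G))"
    by (rule Z.vanishing_iso[OF pull_closed_sharp_open_vanishes[OF z u, of "fo (pull H ?u) G"] van])
      (use G in simp_all)
  moreover have "is_iso (fib H U) (fm (pull H ?u) (sharp_counit H ?u G))"
  proof (rule u.left.dom.iso_of_comp_right[of _ "sharp_unit H ?u (fo (pull H ?u) G)"])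
    show "is_iso (fib H U) (sharp_unit H ?u (fo (pull H ?u) G))"
      using sharp_open_unit_iso[OF z(1) u] G by simp
    show "is_iso (fib H U) (fm (pull H ?u) (sharp_counit H ?u G)
        \<cdot>\<^bsub>fib H U\<^esub> sharp_unit H ?u (fo (pull H ?u) G))"
      using u.triangle_right[OF G] G by simp
  qed (use G in simp_all)
  ultimately show ?thesis using iso_if_pull_iso[OF z u] G by simp
qed

text \<open>If both ends of an arrow are killed by \<open>u\<^sup>*\<close>, joint conservativity leaves only \<open>z\<^sup>*\<close> to be tested. All
  transformations into \<open>z\<^sub>*\<close> below are shown to be invertible in this way.\<close>

lemma iso_into_push:
  assumes z: "z \<in> Cl S" "z \<in> Hom S Z X" and u: "Opn S z \<in> Hom S U X"
    and \<phi>: "\<phi> \<in> Arr (fib H X)" "Cod (fib H X) \<phi> = fo (push H z) B" and B: "B \<in> Ob (fib H Z)"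
    and van: "vanishes (fib H U) (fo (pull H (Opn S z)) (Dom (fib H X) \<phi>))"
    and iso: "is_iso (fib H Z) (push_counit H z B \<cdot>\<^bsub>fib H Z\<^esub> fm (pull H z) \<phi>)"
  shows "is_iso (fib H X) \<phi>"
proof (rule iso_if_pull_iso[OF z u \<phi>(1)])
  let ?u = "Opn S z"
  have ob: "X \<in> Ob S" "Z \<in> Ob S" "U \<in> Ob S" using z u by (auto simp: Hom_def)
  interpret U: additive_category "fib H U" using ob by (simp add: fib_additive)
  interpret z: adjunction "fib H X" "fib H Z" "pull H z" "push H z" "push_unit H z" "push_counit H z"
    using push_adj z .
  interpret up: cat_functor "fib H X" "fib H U" "pull H ?u" using pull_functor u .
  show "is_iso (fib H Z) (fm (pull H z) \<phi>)"
    using z.left.cod.iso_of_comp_left[OF iso] push_counit_iso[OF z B] \<phi> B by simp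
  show "is_iso (fib H U) (fm (pull H ?u) \<phi>)"
    by (rule U.vanishing_iso[OF van pull_open_push_vanishes[OF z u B]]) (use \<phi> in simp_all)
qed

text \<open>\<open>z\<^sup>*\<close> inverts the unit \<open>A \<rightarrow> z\<^sub>* z\<^sup>* A\<close>, hence kills its cone. By the above the cone has the form \<open>u\<^sub># C\<close>;
  this is the localization triangle.\<close>

lemma push_unit_cone:
  assumes z: "z \<in> Cl S" "z \<in> Hom S Z X" and A: "A \<in> Ob (fib H X)"
  obtains g h where "(push_unit H z A, g, h) \<in> Dist (fib H X)"
    "vanishes (fib H Z) (fo (pull H z) (Cod (fib H X) g))"
proof -
  have ob: "X \<in> Ob S" "Z \<in> Ob S" using z by (auto simp: Hom_def)
  interpret X: triangulated_category "fib H X" using ob fib_triangulated by simp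
  interpret Z: triangulated_category "fib H Z" using ob fib_triangulated by simp
  interpret z: adjunction "fib H X" "fib H Z" "pull H z" "push H z" "push_unit H z" "push_counit H z"
    using push_adj z .
  have "push_unit H z A \<in> Arr (fib H X)" using A by simp
  then obtain g h where t: "(push_unit H z A, g, h) \<in> Dist (fib H X)" using X.TR1_cone by blast
  note arr = X.triangle_arr[OF t]
  have "(fm (pull H z) (push_unit H z A), fm (pull H z) g,
      fs (pull H z) A \<cdot>\<^bsub>fib H Z\<^esub> fm (pull H z) h) \<in> Dist (fib H Z)"
    using pull_triangulated[OF z(2)] t A unfolding triangulated_functor_def by fastforce
  moreover have "is_iso (fib H Z) (fm (pull H z) (push_unit H z A))"
    using z.fm_unit_iso[OF _ A] push_counit_iso[OF z] by simp
  ultimately have "vanishes (fib H Z) (Cod (fib H Z) (fm (pull H z) g))"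
    by (rule Z.cone_of_iso_vanishes)
  then show ?thesis using that[OF t] arr by simp
qed

end

section \<open>Isomorphisms of functors compatible with shifts\<close>

text \<open>A functor with a comparison of shifts. Triangulated functors are of this kind, and so are their
  composites; this is the setting in which compatibility of transformations with shifts is transported.\<close>

locale shift_compatible_functor =
  C: triangulated_category C + D: triangulated_category D + cat_functor C D F
  for C :: "('o1, 'm1, 'x) tricat_scheme" and D :: "('o2, 'm2, 'y) tricat_scheme"
    and F :: "('o1, 'm1, 'o2, 'm2, 'z) tfctr_scheme" +
  assumes fs_nat: "nat_trans C D (comp_fctr F (Shift C)) (comp_fctr (Shift D) F) (fs F)"
begin

sublocale shC: cat_functor C C "Shift C" by (rule C.shift_functor)
sublocale shD: cat_functor D D "Shift D" by (rule D.shift_functor)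

lemma fs_arr [simp]:
  assumes "A \<in> Ob C"
  shows "fs F A \<in> Arr D" "Dom D (fs F A) = fo F (fo (Shift C) A)"
    "Cod D (fs F A) = fo (Shift D) (fo F A)"
  using nat_trans_arr[OF fs_nat assms] by simp_all

lemma fs_natural:
  "\<lbrakk>f \<in> Arr C; Cod C f = B\<rbrakk> \<Longrightarrow>
    fs F B \<cdot>\<^bsub>D\<^esub> fm F (fm (Shift C) f) = fm (Shift D) (fm F f) \<cdot>\<^bsub>D\<^esub> fs F (Dom C f)"
  using C.nat_trans_nat[OF fs_nat] by simp

end

lemma triangulated_shift_compatible:
  assumes "triangulated_category C" "triangulated_category D" "triangulated_functor C D F"
  shows "shift_compatible_functor C D F"
  using assms
  by (simp add: shift_compatible_functor_def shift_compatible_functor_axioms_def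
      triangulated_functor_def additive_functor_def nat_iso_def)

lemma shift_compatible_comp:
  assumes F: "shift_compatible_functor C D F" and G: "shift_compatible_functor D E G"
  shows "shift_compatible_functor C E (comp_tfctr E G F)"
proof -
  interpret F: shift_compatible_functor C D F by fact
  interpret G: shift_compatible_functor D E G by fact
  show ?thesis
  proof
    show "nat_trans C E (comp_fctr (comp_tfctr E G F) (Shift C))
        (comp_fctr (Shift E) (comp_tfctr E G F)) (fs (comp_tfctr E G F))"
    proof (rule nat_transI)
      fix f assume f: "f \<in> Arr C"
      have "fm G (fs F (Cod C f)) \<cdot>\<^bsub>E\<^esub> fm G (fm F (fm (Shift C) f))
          = fm G (fm (Shift D) (fm F f)) \<cdot>\<^bsub>E\<^esub> fm G (fs F (Dom C f))"
        using f F.fs_natural[of f "Cod C f"] by (simp flip: G.fm_comp)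
      moreover have "fs G (fo F (Cod C f)) \<cdot>\<^bsub>E\<^esub>
            (fm G (fm (Shift D) (fm F f)) \<cdot>\<^bsub>E\<^esub> fm G (fs F (Dom C f)))
          = fm (Shift E) (fm G (fm F f)) \<cdot>\<^bsub>E\<^esub> (fs G (fo F (Dom C f)) \<cdot>\<^bsub>E\<^esub> fm G (fs F (Dom C f)))"
        by (rule G.D.subst_comp2) (use f G.fs_natural[of "fm F f"] in simp_all)
      ultimately show "fs (comp_tfctr E G F) (Cod C f) \<cdot>\<^bsub>E\<^esub> fm (comp_fctr (comp_tfctr E G F) (Shift C)) f
          = fm (comp_fctr (Shift E) (comp_tfctr E G F)) f \<cdot>\<^bsub>E\<^esub> fs (comp_tfctr E G F) (Dom C f)"
        using f by simp
    qed simp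
  qed (simp_all add: F.C.Hom_iff F.D.Hom_iff G.D.Hom_iff F.fm_comp G.fm_comp)
qed

lemma tri_nat_iso_arr:
  assumes "tri_nat_iso C D F G \<alpha>" "A \<in> Ob C"
  shows "\<alpha> A \<in> Arr D" "Dom D (\<alpha> A) = fo F A" "Cod D (\<alpha> A) = fo G A" "is_iso D (\<alpha> A)"
  using assms by (auto simp: tri_nat_iso_def nat_iso_def nat_trans_def Hom_def)

lemma tri_nat_iso_shift:
  assumes "tri_nat_iso C D F G \<alpha>" "A \<in> Ob C"
  shows "fs G A \<cdot>\<^bsub>D\<^esub> \<alpha> (fo (Shift C) A) = fm (Shift D) (\<alpha> A) \<cdot>\<^bsub>D\<^esub> fs F A"
  using assms by (simp add: tri_nat_iso_def)

lemma (in additive_category) tri_nat_iso_natural: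
  assumes "tri_nat_iso C D F G \<alpha>" "f \<in> Arr C" "Cod C f = B"
  shows "\<alpha> B \<cdot>\<^bsub>D\<^esub> fm F f = fm G f \<cdot>\<^bsub>D\<^esub> \<alpha> (Dom C f)"
  using assms nat_trans_nat[of D F G \<alpha> f B] by (simp add: tri_nat_iso_def nat_iso_def)

lemma tri_nat_isoI:
  assumes "\<And>A. A \<in> Ob C \<Longrightarrow> \<alpha> A \<in> Arr D \<and> Dom D (\<alpha> A) = fo F A \<and> Cod D (\<alpha> A) = fo G A"
    and "\<And>A. A \<in> Ob C \<Longrightarrow> is_iso D (\<alpha> A)"
    and "\<And>f. f \<in> Arr C \<Longrightarrow> \<alpha> (Cod C f) \<cdot>\<^bsub>D\<^esub> fm F f = fm G f \<cdot>\<^bsub>D\<^esub> \<alpha> (Dom C f)"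
    and "\<And>A. A \<in> Ob C \<Longrightarrow>
      fs G A \<cdot>\<^bsub>D\<^esub> \<alpha> (fo (Shift C) A) = fm (Shift D) (\<alpha> A) \<cdot>\<^bsub>D\<^esub> fs F A"
  shows "tri_nat_iso C D F G \<alpha>"
  using nat_transI[of C \<alpha> D F G] assms by (simp add: tri_nat_iso_def nat_iso_def)

lemma tri_nat_iso_comp:
  assumes F: "shift_compatible_functor C D F" and G: "shift_compatible_functor C D G"
    and H: "shift_compatible_functor C D H"
    and \<alpha>: "tri_nat_iso C D F G \<alpha>" and \<beta>: "tri_nat_iso C D G H \<beta>"
  shows "tri_nat_iso C D F H (\<lambda>A. \<beta> A \<cdot>\<^bsub>D\<^esub> \<alpha> A)"
proof -
  interpret F: shift_compatible_functor C D F by fact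
  interpret G: shift_compatible_functor C D G by fact
  interpret H: shift_compatible_functor C D H by fact
  note [simp] = tri_nat_iso_arr[OF \<alpha>] tri_nat_iso_arr[OF \<beta>]
  show ?thesis
  proof (rule tri_nat_isoI)
    fix f assume f: "f \<in> Arr C"
    have "(\<beta> (Cod C f) \<cdot>\<^bsub>D\<^esub> \<alpha> (Cod C f)) \<cdot>\<^bsub>D\<^esub> fm F f
        = \<beta> (Cod C f) \<cdot>\<^bsub>D\<^esub> (fm G f \<cdot>\<^bsub>D\<^esub> \<alpha> (Dom C f))"
      using f F.C.tri_nat_iso_natural[OF \<alpha> f refl] by simp
    also have "\<dots> = fm H f \<cdot>\<^bsub>D\<^esub> (\<beta> (Dom C f) \<cdot>\<^bsub>D\<^esub> \<alpha> (Dom C f))"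
      by (rule F.D.subst_comp2[OF F.C.tri_nat_iso_natural[OF \<beta> f refl]]) (use f in simp_all)
    finally show "(\<beta> (Cod C f) \<cdot>\<^bsub>D\<^esub> \<alpha> (Cod C f)) \<cdot>\<^bsub>D\<^esub> fm F f
        = fm H f \<cdot>\<^bsub>D\<^esub> (\<beta> (Dom C f) \<cdot>\<^bsub>D\<^esub> \<alpha> (Dom C f))" .
  next
    fix A assume A: "A \<in> Ob C"
    have "fs H A \<cdot>\<^bsub>D\<^esub> (\<beta> (fo (Shift C) A) \<cdot>\<^bsub>D\<^esub> \<alpha> (fo (Shift C) A))
        = fm (Shift D) (\<beta> A) \<cdot>\<^bsub>D\<^esub> (fs G A \<cdot>\<^bsub>D\<^esub> \<alpha> (fo (Shift C) A))"
      by (rule F.D.subst_comp2[OF tri_nat_iso_shift[OF \<beta> A]]) (use A in simp_all)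
    then show "fs H A \<cdot>\<^bsub>D\<^esub> (\<beta> (fo (Shift C) A) \<cdot>\<^bsub>D\<^esub> \<alpha> (fo (Shift C) A))
        = fm (Shift D) (\<beta> A \<cdot>\<^bsub>D\<^esub> \<alpha> A) \<cdot>\<^bsub>D\<^esub> fs F A"
      using A tri_nat_iso_shift[OF \<alpha> A] by (simp add: F.shD.fm_comp)
  qed (simp_all add: F.D.iso_comp)
qed

lemma tri_nat_iso_inverse:
  assumes F: "shift_compatible_functor C D F" and G: "shift_compatible_functor C D G"
    and \<alpha>: "tri_nat_iso C D F G \<alpha>"
  shows "tri_nat_iso C D G F (\<lambda>A. inv_arr D (\<alpha> A))"
proof -
  interpret F: shift_compatible_functor C D F by fact
  interpret G: shift_compatible_functor C D G by fact
  note [simp] = tri_nat_iso_arr[OF \<alpha>]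
  show ?thesis
  proof (rule tri_nat_isoI)
    fix f assume f: "f \<in> Arr C"
    have "\<alpha> (Cod C f) \<cdot>\<^bsub>D\<^esub> (fm F f \<cdot>\<^bsub>D\<^esub> inv_arr D (\<alpha> (Dom C f)))
        = fm G f \<cdot>\<^bsub>D\<^esub> (\<alpha> (Dom C f) \<cdot>\<^bsub>D\<^esub> inv_arr D (\<alpha> (Dom C f)))"
      by (rule F.D.subst_comp2[OF F.C.tri_nat_iso_natural[OF \<alpha> f refl]]) (use f in simp_all)
    then have "inv_arr D (\<alpha> (Cod C f)) \<cdot>\<^bsub>D\<^esub> (\<alpha> (Cod C f) \<cdot>\<^bsub>D\<^esub> (fm F f \<cdot>\<^bsub>D\<^esub> inv_arr D (\<alpha> (Dom C f))))
        = inv_arr D (\<alpha> (Cod C f)) \<cdot>\<^bsub>D\<^esub> fm G f"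
      using f by simp
    then show "inv_arr D (\<alpha> (Cod C f)) \<cdot>\<^bsub>D\<^esub> fm G f = fm F f \<cdot>\<^bsub>D\<^esub> inv_arr D (\<alpha> (Dom C f))"
      using f by simp
  next
    fix A assume A: "A \<in> Ob C"
    have inv: "inv_arr D (fm (Shift D) (\<alpha> A)) = fm (Shift D) (inv_arr D (\<alpha> A))"
      "is_iso D (fm (Shift D) (\<alpha> A))"
      using A F.shD.inv_arr_fm by simp_all
    have "fm (Shift D) (\<alpha> A) \<cdot>\<^bsub>D\<^esub> (fs F A \<cdot>\<^bsub>D\<^esub> inv_arr D (\<alpha> (fo (Shift C) A)))
        = fs G A \<cdot>\<^bsub>D\<^esub> (\<alpha> (fo (Shift C) A) \<cdot>\<^bsub>D\<^esub> inv_arr D (\<alpha> (fo (Shift C) A)))"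
      by (rule F.D.subst_comp2[OF tri_nat_iso_shift[OF \<alpha> A, symmetric]]) (use A in simp_all)
    then have "inv_arr D (fm (Shift D) (\<alpha> A)) \<cdot>\<^bsub>D\<^esub>
          (fm (Shift D) (\<alpha> A) \<cdot>\<^bsub>D\<^esub> (fs F A \<cdot>\<^bsub>D\<^esub> inv_arr D (\<alpha> (fo (Shift C) A))))
        = inv_arr D (fm (Shift D) (\<alpha> A)) \<cdot>\<^bsub>D\<^esub> fs G A"
      using A by simp
    then show "fs F A \<cdot>\<^bsub>D\<^esub> inv_arr D (\<alpha> (fo (Shift C) A))
        = fm (Shift D) (inv_arr D (\<alpha> A)) \<cdot>\<^bsub>D\<^esub> fs G A"
      using A F.D.inv_arr_cancel(2)[OF inv(2), of "fs F A \<cdot>\<^bsub>D\<^esub> inv_arr D (\<alpha> (fo (Shift C) A))"] inv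
      by simp
  qed simp_all
qed

lemma tri_nat_iso_whisker_left:
  assumes F: "shift_compatible_functor C D F" and G: "shift_compatible_functor C D G"
    and L: "shift_compatible_functor D E L" and \<alpha>: "tri_nat_iso C D F G \<alpha>"
  shows "tri_nat_iso C E (comp_tfctr E L F) (comp_tfctr E L G) (\<lambda>A. fm L (\<alpha> A))"
proof -
  interpret F: shift_compatible_functor C D F by fact
  interpret G: shift_compatible_functor C D G by fact
  interpret L: shift_compatible_functor D E L by fact
  note [simp] = tri_nat_iso_arr[OF \<alpha>]
  show ?thesis
  proof (rule tri_nat_isoI)
    fix f assume f: "f \<in> Arr C"
    then show "fm L (\<alpha> (Cod C f)) \<cdot>\<^bsub>E\<^esub> fm (comp_tfctr E L F) f
        = fm (comp_tfctr E L G) f \<cdot>\<^bsub>E\<^esub> fm L (\<alpha> (Dom C f))"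
      using F.C.tri_nat_iso_natural[OF \<alpha> f refl] by (simp flip: L.fm_comp)
  next
    fix A assume A: "A \<in> Ob C"
    have "fm L (fs G A) \<cdot>\<^bsub>E\<^esub> fm L (\<alpha> (fo (Shift C) A))
        = fm L (fm (Shift D) (\<alpha> A)) \<cdot>\<^bsub>E\<^esub> fm L (fs F A)"
      using A tri_nat_iso_shift[OF \<alpha> A] by (simp flip: L.fm_comp)
    moreover have "fs L (fo G A) \<cdot>\<^bsub>E\<^esub> (fm L (fm (Shift D) (\<alpha> A)) \<cdot>\<^bsub>E\<^esub> fm L (fs F A))
        = fm (Shift E) (fm L (\<alpha> A)) \<cdot>\<^bsub>E\<^esub> (fs L (fo F A) \<cdot>\<^bsub>E\<^esub> fm L (fs F A))"
      by (rule L.D.subst_comp2) (use A L.fs_natural[of "\<alpha> A"] in simp_all)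
    ultimately show "fs (comp_tfctr E L G) A \<cdot>\<^bsub>E\<^esub> fm L (\<alpha> (fo (Shift C) A))
        = fm (Shift E) (fm L (\<alpha> A)) \<cdot>\<^bsub>E\<^esub> fs (comp_tfctr E L F) A"
      using A by simp
  qed simp_all
qed

lemma tri_nat_iso_whisker_right:
  assumes F: "shift_compatible_functor C D F" and G: "shift_compatible_functor C D G"
    and K: "shift_compatible_functor B C K" and \<alpha>: "tri_nat_iso C D F G \<alpha>"
  shows "tri_nat_iso B D (comp_tfctr D F K) (comp_tfctr D G K) (\<lambda>A. \<alpha> (fo K A))"
proof -
  interpret F: shift_compatible_functor C D F by fact
  interpret G: shift_compatible_functor C D G by fact
  interpret K: shift_compatible_functor B C K by fact
  note [simp] = tri_nat_iso_arr[OF \<alpha>]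
  show ?thesis
  proof (rule tri_nat_isoI)
    fix f assume f: "f \<in> Arr B"
    then show "\<alpha> (fo K (Cod B f)) \<cdot>\<^bsub>D\<^esub> fm (comp_tfctr D F K) f
        = fm (comp_tfctr D G K) f \<cdot>\<^bsub>D\<^esub> \<alpha> (fo K (Dom B f))"
      using F.C.tri_nat_iso_natural[OF \<alpha>, of "fm K f"] by simp
  next
    fix A assume A: "A \<in> Ob B"
    have "fm G (fs K A) \<cdot>\<^bsub>D\<^esub> \<alpha> (fo K (fo (Shift B) A))
        = \<alpha> (fo (Shift C) (fo K A)) \<cdot>\<^bsub>D\<^esub> fm F (fs K A)"
      using A F.C.tri_nat_iso_natural[OF \<alpha>, of "fs K A"] by simp
    moreover have "fs G (fo K A) \<cdot>\<^bsub>D\<^esub> (\<alpha> (fo (Shift C) (fo K A)) \<cdot>\<^bsub>D\<^esub> fm F (fs K A))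
        = fm (Shift D) (\<alpha> (fo K A)) \<cdot>\<^bsub>D\<^esub> (fs F (fo K A) \<cdot>\<^bsub>D\<^esub> fm F (fs K A))"
      by (rule F.D.subst_comp2[OF tri_nat_iso_shift[OF \<alpha>]]) (use A in simp_all)
    ultimately show "fs (comp_tfctr D G K) A \<cdot>\<^bsub>D\<^esub> \<alpha> (fo K (fo (Shift B) A))
        = fm (Shift D) (\<alpha> (fo K A)) \<cdot>\<^bsub>D\<^esub> fs (comp_tfctr D F K) A"
      using A by simp
  qed simp_all
qed

lemma tri_nat_iso_cong:
  assumes "category C" "tri_nat_iso C D F G \<alpha>" "tfctr_eq C F F'" "tfctr_eq C G G'"
    and "\<And>A. A \<in> Ob C \<Longrightarrow> \<alpha> A = \<alpha>' A" and "\<And>A. A \<in> Ob C \<Longrightarrow> fo (Shift C) A \<in> Ob C"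
  shows "tri_nat_iso C D F' G' \<alpha>'"
proof -
  interpret category C by fact
  show ?thesis
    using assms unfolding tri_nat_iso_def nat_iso_def nat_trans_def tfctr_eq_def fctr_eq_def Hom_def
    by auto
qed

lemma comp_tfctr_assoc:
  assumes F: "shift_compatible_functor C D F" and G: "shift_compatible_functor B C G"
    and H: "shift_compatible_functor A B H"
  shows "tfctr_eq A (comp_tfctr D (comp_tfctr D F G) H) (comp_tfctr D F (comp_tfctr C G H))"
proof -
  interpret F: shift_compatible_functor C D F by fact
  interpret G: shift_compatible_functor B C G by fact
  interpret H: shift_compatible_functor A B H by fact
  show ?thesis by (simp add: tfctr_eq_def fctr_eq_def F.fm_comp)
qed

lemma tfctr_eq_refl: "tfctr_eq C F F" and tfctr_eq_sym: "tfctr_eq C F G \<Longrightarrow> tfctr_eq C G F"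
  by (simp_all add: tfctr_eq_def fctr_eq_def)

section \<open>Composition of structure isomorphisms\<close>

locale localic_pair = base_category S + one: localic S H1 + two: localic S H2
  for S :: "('s, 'a, 'x) basecat_scheme" (structure)
    and H1 :: "('s, 'a, 'o1, 'm1, 'y) fibcat_adj_scheme"
    and H2 :: "('s, 'a, 'o2, 'm2, 'z) fibcat_adj_scheme" +
  fixes R :: "'s \<Rightarrow> ('o1, 'm1, 'o2, 'm2) tfctr"
  assumes R_triangulated: "X \<in> Ob S \<Longrightarrow> triangulated_functor (fib H1 X) (fib H2 X) (R X)"
begin

definition compat :: "'a \<Rightarrow> ('o1 \<Rightarrow> 'm2) \<Rightarrow> bool" where
  "compat f \<alpha> \<longleftrightarrow> tri_nat_iso (fib H1 (Cod S f)) (fib H2 (Dom S f))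
     (comp_tfctr (fib H2 (Dom S f)) (pull H2 f) (R (Cod S f)))
     (comp_tfctr (fib H2 (Dom S f)) (R (Dom S f)) (pull H1 f)) \<alpha>"

text \<open>The product of \<open>\<alpha>\<close> over \<open>f\<close> and \<open>\<beta>\<close> over \<open>g\<close>, lying over \<open>g \<cdot> f\<close>. The cocycle condition for a structure
  \<open>\<theta>\<close> says precisely that \<open>\<theta>\<close> is multiplicative, \<open>\<theta> (g \<cdot> f) = star f (\<theta> f) g (\<theta> g)\<close>.\<close>

definition star :: "'a \<Rightarrow> ('o1 \<Rightarrow> 'm2) \<Rightarrow> 'a \<Rightarrow> ('o1 \<Rightarrow> 'm2) \<Rightarrow> 'o1 \<Rightarrow> 'm2" where
  "star f \<alpha> g \<beta> A =
     inv_arr (fib H2 (Dom S f)) (fm (R (Dom S f)) (conn H1 f g A)) \<cdot>\<^bsub>fib H2 (Dom S f)\<^esub>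
     \<alpha> (fo (pull H1 g) A) \<cdot>\<^bsub>fib H2 (Dom S f)\<^esub> fm (pull H2 f) (\<beta> A) \<cdot>\<^bsub>fib H2 (Dom S f)\<^esub>
     conn H2 f g (fo (R (Cod S g)) A)"

lemma Hom_ob: "f \<in> Hom S Y X \<Longrightarrow> Y \<in> Ob S" "f \<in> Hom S Y X \<Longrightarrow> X \<in> Ob S"
  by (auto simp: Hom_def)

lemma R_shift: "X \<in> Ob S \<Longrightarrow> shift_compatible_functor (fib H1 X) (fib H2 X) (R X)"
  using triangulated_shift_compatible one.fib_triangulated two.fib_triangulated R_triangulated by blast

lemma pull1_shift: "f \<in> Hom S Y X \<Longrightarrow> shift_compatible_functor (fib H1 X) (fib H1 Y) (pull H1 f)"
  using triangulated_shift_compatible one.fib_triangulated one.pull_triangulated Hom_ob by blast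

lemma pull2_shift: "f \<in> Hom S Y X \<Longrightarrow> shift_compatible_functor (fib H2 X) (fib H2 Y) (pull H2 f)"
  using triangulated_shift_compatible two.fib_triangulated two.pull_triangulated Hom_ob by blast

lemma compat_iff:
  "f \<in> Hom S Y X \<Longrightarrow> compat f \<alpha> \<longleftrightarrow> tri_nat_iso (fib H1 X) (fib H2 Y)
     (comp_tfctr (fib H2 Y) (pull H2 f) (R X)) (comp_tfctr (fib H2 Y) (R Y) (pull H1 f)) \<alpha>"
  by (auto simp: compat_def Hom_def)

lemma compat_arr:
  assumes f: "f \<in> Hom S Y X" and \<alpha>: "compat f \<alpha>" and A: "A \<in> Ob (fib H1 X)"
  shows "\<alpha> A \<in> Arr (fib H2 Y)" "Dom (fib H2 Y) (\<alpha> A) = fo (pull H2 f) (fo (R X) A)"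
    "Cod (fib H2 Y) (\<alpha> A) = fo (R Y) (fo (pull H1 f) A)" "is_iso (fib H2 Y) (\<alpha> A)"
  using tri_nat_iso_arr[OF \<alpha>[unfolded compat_iff[OF f]] A] by simp_all

lemma compat_natural:
  assumes f: "f \<in> Hom S Y X" and \<alpha>: "compat f \<alpha>"
    and \<phi>: "\<phi> \<in> Arr (fib H1 X)" "Cod (fib H1 X) \<phi> = B"
  shows "\<alpha> B \<cdot>\<^bsub>fib H2 Y\<^esub> fm (pull H2 f) (fm (R X) \<phi>)
    = fm (R Y) (fm (pull H1 f) \<phi>) \<cdot>\<^bsub>fib H2 Y\<^esub> \<alpha> (Dom (fib H1 X) \<phi>)"
proof -
  interpret X: additive_category "fib H1 X" using one.fib_additive Hom_ob f by blast
  show ?thesis using X.tri_nat_iso_natural[OF \<alpha>[unfolded compat_iff[OF f]] \<phi>] by simp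
qed

lemma star_arr:
  assumes f: "f \<in> Hom S Y X" and g: "g \<in> Hom S X V" and \<alpha>: "compat f \<alpha>" and \<beta>: "compat g \<beta>"
    and A: "A \<in> Ob (fib H1 V)"
  shows "star f \<alpha> g \<beta> A \<in> Arr (fib H2 Y)"
    "Dom (fib H2 Y) (star f \<alpha> g \<beta> A) = fo (pull H2 (g \<cdot> f)) (fo (R V) A)"
    "Cod (fib H2 Y) (star f \<alpha> g \<beta> A) = fo (R Y) (fo (pull H1 (g \<cdot> f)) A)"
    and conn_star: "fm (R Y) (conn H1 f g A) \<cdot>\<^bsub>fib H2 Y\<^esub> star f \<alpha> g \<beta> A =
      \<alpha> (fo (pull H1 g) A) \<cdot>\<^bsub>fib H2 Y\<^esub> fm (pull H2 f) (\<beta> A) \<cdot>\<^bsub>fib H2 Y\<^esub> conn H2 f g (fo (R V) A)"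
    and conn_image_iso: "is_iso (fib H2 Y) (fm (R Y) (conn H1 f g A))"
proof -
  have ds: "Dom S f = Y" "Cod S g = V" using f g by (auto simp: Hom_def)
  interpret RY: shift_compatible_functor "fib H1 Y" "fib H2 Y" "R Y" using R_shift Hom_ob f by blast
  interpret RV: shift_compatible_functor "fib H1 V" "fib H2 V" "R V" using R_shift Hom_ob g by blast
  interpret f2: shift_compatible_functor "fib H2 X" "fib H2 Y" "pull H2 f" using pull2_shift f .
  interpret g1: shift_compatible_functor "fib H1 V" "fib H1 X" "pull H1 g" using pull1_shift g .
  note [simp] = one.conn_arr[OF f g A] two.conn_arr[OF f g] compat_arr[OF f \<alpha>] compat_arr[OF g \<beta>]
  show "star f \<alpha> g \<beta> A \<in> Arr (fib H2 Y)"
    "Dom (fib H2 Y) (star f \<alpha> g \<beta> A) = fo (pull H2 (g \<cdot> f)) (fo (R V) A)"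
    "Cod (fib H2 Y) (star f \<alpha> g \<beta> A) = fo (R Y) (fo (pull H1 (g \<cdot> f)) A)"
    "fm (R Y) (conn H1 f g A) \<cdot>\<^bsub>fib H2 Y\<^esub> star f \<alpha> g \<beta> A =
      \<alpha> (fo (pull H1 g) A) \<cdot>\<^bsub>fib H2 Y\<^esub> fm (pull H2 f) (\<beta> A) \<cdot>\<^bsub>fib H2 Y\<^esub> conn H2 f g (fo (R V) A)"
    "is_iso (fib H2 Y) (fm (R Y) (conn H1 f g A))"
    using A by (simp_all add: star_def ds)
qed

lemma star_eq_iff:
  assumes f: "f \<in> Hom S Y X" and g: "g \<in> Hom S X V" and \<alpha>: "compat f \<alpha>" and \<beta>: "compat g \<beta>"
    and A: "A \<in> Ob (fib H1 V)" and e: "e \<in> Arr (fib H2 Y)"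
      "Cod (fib H2 Y) e = fo (R Y) (fo (pull H1 (g \<cdot> f)) A)"
  shows "e = star f \<alpha> g \<beta> A \<longleftrightarrow> fm (R Y) (conn H1 f g A) \<cdot>\<^bsub>fib H2 Y\<^esub> e =
      \<alpha> (fo (pull H1 g) A) \<cdot>\<^bsub>fib H2 Y\<^esub> fm (pull H2 f) (\<beta> A) \<cdot>\<^bsub>fib H2 Y\<^esub> conn H2 f g (fo (R V) A)"
proof -
  interpret RY: shift_compatible_functor "fib H1 Y" "fib H2 Y" "R Y" using R_shift Hom_ob f by blast
  note st = star_arr(1-3)[OF f g \<alpha> \<beta> A] conn_star[OF f g \<alpha> \<beta> A] conn_image_iso[OF f g \<alpha> \<beta> A]
  have "e = star f \<alpha> g \<beta> A" if "fm (R Y) (conn H1 f g A) \<cdot>\<^bsub>fib H2 Y\<^esub> e =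
      fm (R Y) (conn H1 f g A) \<cdot>\<^bsub>fib H2 Y\<^esub> star f \<alpha> g \<beta> A"
    by (rule RY.D.iso_cancel_left[OF st(5) e(1) st(1) _ _ that])
      (use e st one.conn_arr[OF f g A] in simp_all)
  then show ?thesis using st(4) by metis
qed

text \<open>The product is a vertical composite of whiskered isomorphisms, each of them compatible with shifts.\<close>

lemma star_compat:
  assumes f: "f \<in> Hom S Y X" and g: "g \<in> Hom S X V" and \<alpha>: "compat f \<alpha>" and \<beta>: "compat g \<beta>"
  shows "compat (g \<cdot> f) (star f \<alpha> g \<beta>)"
proof -
  have ds: "Dom S f = Y" "Cod S g = V" using f g by (auto simp: Hom_def)
  have gf: "g \<cdot> f \<in> Hom S Y V" using Comp_in f g .
  have ob: "X \<in> Ob S" "Y \<in> Ob S" "V \<in> Ob S" using f g Hom_ob by auto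
  let ?Y = "fib H2 Y" and ?X = "fib H2 X"
  note RY = R_shift[OF ob(2)] and RX = R_shift[OF ob(1)] and RV = R_shift[OF ob(3)]
  note f1 = pull1_shift[OF f] and f2 = pull2_shift[OF f] and g1 = pull1_shift[OF g]
    and g2 = pull2_shift[OF g] and gf1 = pull1_shift[OF gf] and gf2 = pull2_shift[OF gf]
  note sc = shift_compatible_comp
  interpret V: triangulated_category "fib H1 V" using one.fib_triangulated ob by simp
  interpret shV: cat_functor "fib H1 V" "fib H1 V" "Shift (fib H1 V)" by (rule V.shift_functor)
  note cong = tri_nat_iso_cong[OF V.category_axioms _ _ _ refl shV.fo_ob]
  let ?F0 = "comp_tfctr ?Y (pull H2 (g \<cdot> f)) (R V)"
  let ?F1 = "comp_tfctr ?Y (pull H2 f) (comp_tfctr ?X (pull H2 g) (R V))"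
  let ?F2 = "comp_tfctr ?Y (pull H2 f) (comp_tfctr ?X (R X) (pull H1 g))"
  let ?F3 = "comp_tfctr ?Y (R Y) (comp_tfctr (fib H1 Y) (pull H1 f) (pull H1 g))"
  let ?F4 = "comp_tfctr ?Y (R Y) (pull H1 (g \<cdot> f))"
  have "tri_nat_iso (fib H1 V) ?Y ?F0 ?F1 (\<lambda>A. conn H2 f g (fo (R V) A))"
    by (rule cong[OF tri_nat_iso_whisker_right[OF gf2 sc[OF g2 f2] RV two.conn_iso[OF f g]]
          tfctr_eq_refl comp_tfctr_assoc[OF f2 g2 RV]])
  moreover have "tri_nat_iso (fib H1 V) ?Y ?F1 ?F2 (\<lambda>A. fm (pull H2 f) (\<beta> A))"
    by (rule tri_nat_iso_whisker_left[OF sc[OF RV g2] sc[OF g1 RX] f2 \<beta>[unfolded compat_iff[OF g]]])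
  moreover have "tri_nat_iso (fib H1 V) ?Y ?F2 ?F3 (\<lambda>A. \<alpha> (fo (pull H1 g) A))"
    by (rule cong[OF tri_nat_iso_whisker_right[OF sc[OF RX f2] sc[OF f1 RY] g1 \<alpha>[unfolded compat_iff[OF f]]]
          comp_tfctr_assoc[OF f2 RX g1] comp_tfctr_assoc[OF RY f1 g1]])
  moreover have "tri_nat_iso (fib H1 V) ?Y ?F3 ?F4 (\<lambda>A. inv_arr ?Y (fm (R Y) (conn H1 f g A)))"
    by (rule tri_nat_iso_inverse[OF sc[OF gf1 RY] sc[OF sc[OF g1 f1] RY]
          tri_nat_iso_whisker_left[OF gf1 sc[OF g1 f1] RY one.conn_iso[OF f g]]])
  moreover have "shift_compatible_functor (fib H1 V) ?Y ?F0" "shift_compatible_functor (fib H1 V) ?Y ?F1"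
    "shift_compatible_functor (fib H1 V) ?Y ?F2" "shift_compatible_functor (fib H1 V) ?Y ?F3"
    "shift_compatible_functor (fib H1 V) ?Y ?F4"
    using sc[OF RV gf2] sc[OF sc[OF RV g2] f2] sc[OF sc[OF g1 RX] f2] sc[OF sc[OF g1 f1] RY] sc[OF gf1 RY]
    by auto
  ultimately have "tri_nat_iso (fib H1 V) ?Y ?F0 ?F4 (\<lambda>A. inv_arr ?Y (fm (R Y) (conn H1 f g A))
      \<cdot>\<^bsub>?Y\<^esub> \<alpha> (fo (pull H1 g) A) \<cdot>\<^bsub>?Y\<^esub> fm (pull H2 f) (\<beta> A) \<cdot>\<^bsub>?Y\<^esub> conn H2 f g (fo (R V) A))"
    using tri_nat_iso_comp by blast
  then show ?thesis unfolding compat_iff[OF gf] star_def[abs_def] ds .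
qed

text \<open>Both products become equal to the same composite \<open>k\<close> once the connection isomorphisms of \<open>H1\<close> in front of
  them are cleared; this uses the naturality of \<open>\<alpha>\<close> and of the connection isomorphisms of \<open>H2\<close>, and the cocycle
  conditions of \<open>H1\<close> and \<open>H2\<close>. Associativity turns the pairs \<open>(f, \<alpha>)\<close> into a category over \<open>S\<close> and makes all
  coherence bookkeeping disappear from the arguments about factorizations.\<close>

lemma star_assoc_at:
  assumes f: "f \<in> Hom S Y X" and g: "g \<in> Hom S X V" and h: "h \<in> Hom S V W"
    and \<alpha>: "compat f \<alpha>" and \<beta>: "compat g \<beta>" and \<gamma>: "compat h \<gamma>" and A: "A \<in> Ob (fib H1 W)"
  shows "star f \<alpha> (h \<cdot> g) (star g \<beta> h \<gamma>) A = star (g \<cdot> f) (star f \<alpha> g \<beta>) h \<gamma> A"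
proof -
  have hg: "h \<cdot> g \<in> Hom S X W" and gf: "g \<cdot> f \<in> Hom S Y V" and ob: "X \<in> Ob S" "Y \<in> Ob S" "V \<in> Ob S" "W \<in> Ob S"
    and as: "(h \<cdot> g) \<cdot> f = h \<cdot> (g \<cdot> f)"
    using Comp_in f g h Hom_ob Comp_assoc by auto
  note \<beta>\<gamma> = star_compat[OF g h \<beta> \<gamma>] and \<alpha>\<beta> = star_compat[OF f g \<alpha> \<beta>]
  interpret RY: shift_compatible_functor "fib H1 Y" "fib H2 Y" "R Y" using R_shift ob by blast
  interpret RX: shift_compatible_functor "fib H1 X" "fib H2 X" "R X" using R_shift ob by blast
  interpret RV: shift_compatible_functor "fib H1 V" "fib H2 V" "R V" using R_shift ob by blast
  interpret RW: shift_compatible_functor "fib H1 W" "fib H2 W" "R W" using R_shift ob by blast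
  interpret f1: shift_compatible_functor "fib H1 X" "fib H1 Y" "pull H1 f" using pull1_shift f .
  interpret g1: shift_compatible_functor "fib H1 V" "fib H1 X" "pull H1 g" using pull1_shift g .
  interpret h1: shift_compatible_functor "fib H1 W" "fib H1 V" "pull H1 h" using pull1_shift h .
  interpret hg1: shift_compatible_functor "fib H1 W" "fib H1 X" "pull H1 (h \<cdot> g)" using pull1_shift hg .
  interpret gf1: shift_compatible_functor "fib H1 V" "fib H1 Y" "pull H1 (g \<cdot> f)" using pull1_shift gf .
  interpret f2: shift_compatible_functor "fib H2 X" "fib H2 Y" "pull H2 f" using pull2_shift f .
  interpret g2: shift_compatible_functor "fib H2 V" "fib H2 X" "pull H2 g" using pull2_shift g .
  interpret h2: shift_compatible_functor "fib H2 W" "fib H2 V" "pull H2 h" using pull2_shift h .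
  interpret hg2: shift_compatible_functor "fib H2 W" "fib H2 X" "pull H2 (h \<cdot> g)" using pull2_shift hg .
  interpret gf2: shift_compatible_functor "fib H2 V" "fib H2 Y" "pull H2 (g \<cdot> f)" using pull2_shift gf .
  note [simp] = as one.conn_arr[OF f g] one.conn_arr[OF g h] one.conn_arr[OF f hg] one.conn_arr[OF gf h]
    two.conn_arr[OF f g] two.conn_arr[OF g h] two.conn_arr[OF f hg] two.conn_arr[OF gf h]
    compat_arr[OF f \<alpha>] compat_arr[OF g \<beta>] compat_arr[OF h \<gamma>] compat_arr[OF hg \<beta>\<gamma>] compat_arr[OF gf \<alpha>\<beta>]
    star_arr(1-3)[OF f hg \<alpha> \<beta>\<gamma>] star_arr(1-3)[OF gf h \<alpha>\<beta> \<gamma>]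
  let ?Y = "fib H2 Y" and ?B = "fo (R W) A"
  let ?l = "star f \<alpha> (h \<cdot> g) (star g \<beta> h \<gamma>) A" and ?r = "star (g \<cdot> f) (star f \<alpha> g \<beta>) h \<gamma> A"
  define k where "k = \<alpha> (fo (pull H1 g) (fo (pull H1 h) A)) \<cdot>\<^bsub>?Y\<^esub> fm (pull H2 f) (\<beta> (fo (pull H1 h) A))
      \<cdot>\<^bsub>?Y\<^esub> fm (pull H2 f) (fm (pull H2 g) (\<gamma> A)) \<cdot>\<^bsub>?Y\<^esub> conn H2 f g (fo (pull H2 h) ?B)
      \<cdot>\<^bsub>?Y\<^esub> conn H2 (g \<cdot> f) h ?B"
  have l: "fm (R Y) (fm (pull H1 f) (conn H1 g h A)) \<cdot>\<^bsub>?Y\<^esub> (fm (R Y) (conn H1 f (h \<cdot> g) A) \<cdot>\<^bsub>?Y\<^esub> ?l) = k"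
  proof -
    have "fm (R Y) (fm (pull H1 f) (conn H1 g h A)) \<cdot>\<^bsub>?Y\<^esub> (fm (R Y) (conn H1 f (h \<cdot> g) A) \<cdot>\<^bsub>?Y\<^esub> ?l)
      = fm (R Y) (fm (pull H1 f) (conn H1 g h A)) \<cdot>\<^bsub>?Y\<^esub> (\<alpha> (fo (pull H1 (h \<cdot> g)) A)
          \<cdot>\<^bsub>?Y\<^esub> (fm (pull H2 f) (star g \<beta> h \<gamma> A) \<cdot>\<^bsub>?Y\<^esub> conn H2 f (h \<cdot> g) ?B))"
      using conn_star[OF f hg \<alpha> \<beta>\<gamma> A] by simp
    also have "\<dots> = \<alpha> (fo (pull H1 g) (fo (pull H1 h) A))
        \<cdot>\<^bsub>?Y\<^esub> (fm (pull H2 f) (fm (R X) (conn H1 g h A))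
          \<cdot>\<^bsub>?Y\<^esub> (fm (pull H2 f) (star g \<beta> h \<gamma> A) \<cdot>\<^bsub>?Y\<^esub> conn H2 f (h \<cdot> g) ?B))"
      by (rule RY.D.subst_comp2) (use A compat_natural[OF f \<alpha>, of "conn H1 g h A"] in simp_all)
    also have "fm (pull H2 f) (fm (R X) (conn H1 g h A))
          \<cdot>\<^bsub>?Y\<^esub> (fm (pull H2 f) (star g \<beta> h \<gamma> A) \<cdot>\<^bsub>?Y\<^esub> conn H2 f (h \<cdot> g) ?B)
      = fm (pull H2 f) (\<beta> (fo (pull H1 h) A) \<cdot>\<^bsub>fib H2 X\<^esub> fm (pull H2 g) (\<gamma> A) \<cdot>\<^bsub>fib H2 X\<^esub> conn H2 g h ?B)
          \<cdot>\<^bsub>?Y\<^esub> conn H2 f (h \<cdot> g) ?B"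
      by (rule RY.D.subst_comp)
        (use A conn_star[OF g h \<beta> \<gamma> A] star_arr(1-3)[OF g h \<beta> \<gamma> A] in \<open>simp_all flip: f2.fm_comp\<close>)
    also have "\<dots> = fm (pull H2 f) (\<beta> (fo (pull H1 h) A)) \<cdot>\<^bsub>?Y\<^esub> fm (pull H2 f) (fm (pull H2 g) (\<gamma> A))
        \<cdot>\<^bsub>?Y\<^esub> (fm (pull H2 f) (conn H2 g h ?B) \<cdot>\<^bsub>?Y\<^esub> conn H2 f (h \<cdot> g) ?B)"
      using A by (simp add: f2.fm_comp)
    also have "fm (pull H2 f) (conn H2 g h ?B) \<cdot>\<^bsub>?Y\<^esub> conn H2 f (h \<cdot> g) ?B
        = conn H2 f g (fo (pull H2 h) ?B) \<cdot>\<^bsub>?Y\<^esub> conn H2 (g \<cdot> f) h ?B"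
      using two.conn_cocycle[OF f g h, of ?B] A by simp
    finally show ?thesis unfolding k_def .
  qed
  have r: "fm (R Y) (conn H1 f g (fo (pull H1 h) A)) \<cdot>\<^bsub>?Y\<^esub> (fm (R Y) (conn H1 (g \<cdot> f) h A) \<cdot>\<^bsub>?Y\<^esub> ?r) = k"
  proof -
    have "fm (R Y) (conn H1 f g (fo (pull H1 h) A)) \<cdot>\<^bsub>?Y\<^esub> (fm (R Y) (conn H1 (g \<cdot> f) h A) \<cdot>\<^bsub>?Y\<^esub> ?r)
      = fm (R Y) (conn H1 f g (fo (pull H1 h) A)) \<cdot>\<^bsub>?Y\<^esub> (star f \<alpha> g \<beta> (fo (pull H1 h) A)
        \<cdot>\<^bsub>?Y\<^esub> (fm (pull H2 (g \<cdot> f)) (\<gamma> A) \<cdot>\<^bsub>?Y\<^esub> conn H2 (g \<cdot> f) h ?B))"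
      using conn_star[OF gf h \<alpha>\<beta> \<gamma> A] by simp
    also have "\<dots> = (\<alpha> (fo (pull H1 g) (fo (pull H1 h) A)) \<cdot>\<^bsub>?Y\<^esub> fm (pull H2 f) (\<beta> (fo (pull H1 h) A))
        \<cdot>\<^bsub>?Y\<^esub> conn H2 f g (fo (R V) (fo (pull H1 h) A)))
        \<cdot>\<^bsub>?Y\<^esub> (fm (pull H2 (g \<cdot> f)) (\<gamma> A) \<cdot>\<^bsub>?Y\<^esub> conn H2 (g \<cdot> f) h ?B)"
      by (rule RY.D.subst_comp)
        (use A conn_star[OF f g \<alpha> \<beta>] star_arr(1-3)[OF f g \<alpha> \<beta>] in simp_all)
    also have "\<dots> = \<alpha> (fo (pull H1 g) (fo (pull H1 h) A)) \<cdot>\<^bsub>?Y\<^esub> fm (pull H2 f) (\<beta> (fo (pull H1 h) A))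
        \<cdot>\<^bsub>?Y\<^esub> (conn H2 f g (fo (R V) (fo (pull H1 h) A))
        \<cdot>\<^bsub>?Y\<^esub> (fm (pull H2 (g \<cdot> f)) (\<gamma> A) \<cdot>\<^bsub>?Y\<^esub> conn H2 (g \<cdot> f) h ?B))"
      using A by simp
    also have "conn H2 f g (fo (R V) (fo (pull H1 h) A))
        \<cdot>\<^bsub>?Y\<^esub> (fm (pull H2 (g \<cdot> f)) (\<gamma> A) \<cdot>\<^bsub>?Y\<^esub> conn H2 (g \<cdot> f) h ?B)
      = fm (pull H2 f) (fm (pull H2 g) (\<gamma> A)) \<cdot>\<^bsub>?Y\<^esub> (conn H2 f g (fo (pull H2 h) ?B)
        \<cdot>\<^bsub>?Y\<^esub> conn H2 (g \<cdot> f) h ?B)"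
      by (rule RY.D.subst_comp2) (use A two.conn_natural[OF f g, of "\<gamma> A"] in simp_all)
    finally show ?thesis unfolding k_def .
  qed
  have "fm (R Y) (fm (pull H1 f) (conn H1 g h A)) \<cdot>\<^bsub>?Y\<^esub> fm (R Y) (conn H1 f (h \<cdot> g) A)
      = fm (R Y) (conn H1 f g (fo (pull H1 h) A)) \<cdot>\<^bsub>?Y\<^esub> fm (R Y) (conn H1 (g \<cdot> f) h A)"
    using one.conn_cocycle[OF f g h A] A by (simp flip: RY.fm_comp)
  then have "fm (R Y) (fm (pull H1 f) (conn H1 g h A)) \<cdot>\<^bsub>?Y\<^esub> (fm (R Y) (conn H1 f (h \<cdot> g) A) \<cdot>\<^bsub>?Y\<^esub> ?r) = k"
    using r RY.D.subst_comp2[of "fm (R Y) (fm (pull H1 f) (conn H1 g h A))"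
        "fm (R Y) (conn H1 f (h \<cdot> g) A)" "fm (R Y) (conn H1 f g (fo (pull H1 h) A))"
        "fm (R Y) (conn H1 (g \<cdot> f) h A)" ?r] A by simp
  then have eq: "fm (R Y) (fm (pull H1 f) (conn H1 g h A)) \<cdot>\<^bsub>?Y\<^esub> (fm (R Y) (conn H1 f (h \<cdot> g) A) \<cdot>\<^bsub>?Y\<^esub> ?l)
      = fm (R Y) (fm (pull H1 f) (conn H1 g h A)) \<cdot>\<^bsub>?Y\<^esub> (fm (R Y) (conn H1 f (h \<cdot> g) A) \<cdot>\<^bsub>?Y\<^esub> ?r)"
    using l by simp
  have "fm (R Y) (conn H1 f (h \<cdot> g) A) \<cdot>\<^bsub>?Y\<^esub> ?l = fm (R Y) (conn H1 f (h \<cdot> g) A) \<cdot>\<^bsub>?Y\<^esub> ?r"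
    by (rule RY.D.iso_cancel_left[OF _ _ _ _ _ eq]) (use A in simp_all)
  then show ?thesis
    by (rule RY.D.iso_cancel_left[rotated -1]) (use A in simp_all)
qed

end

section \<open>Mates and shifts\<close>

text \<open>For \<open>F \<stileturn> G\<close> with \<open>F\<close> comparing shifts, \<open>shift_mate\<close> is the induced comparison \<open>(G B)[1] \<rightarrow> G (B[1])\<close>. It goes
  in the direction opposite to the shift isomorphism of a functor.\<close>

locale shift_adjunction = adjunction C D F G \<eta> \<epsilon> + shift_compatible_functor C D F
  for C :: "('o1, 'm1, 'x) tricat_scheme" and D :: "('o2, 'm2, 'y) tricat_scheme"
    and F :: "('o1, 'm1, 'o2, 'm2, 'z) tfctr_scheme"
    and G :: "('o2, 'm2, 'o1, 'm1, 'w) fctr_scheme" and \<eta> \<epsilon>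
begin

definition shift_mate where
  "shift_mate B = fm G (fm (Shift D) (\<epsilon> B)) \<cdot>\<^bsub>C\<^esub> fm G (fs F (fo G B)) \<cdot>\<^bsub>C\<^esub> \<eta> (fo (Shift C) (fo G B))"

lemma shift_mate_arr [simp]:
  assumes "B \<in> Ob D"
  shows "shift_mate B \<in> Arr C" "Dom C (shift_mate B) = fo (Shift C) (fo G B)"
    "Cod C (shift_mate B) = fo G (fo (Shift D) B)"
  using assms by (simp_all add: shift_mate_def)

lemma transpose_shift_mate:
  assumes B: "B \<in> Ob D"
  shows "\<epsilon> (fo (Shift D) B) \<cdot>\<^bsub>D\<^esub> fm F (shift_mate B) = fm (Shift D) (\<epsilon> B) \<cdot>\<^bsub>D\<^esub> fs F (fo G B)"
proof -
  have "shift_mate B = fm G (fm (Shift D) (\<epsilon> B) \<cdot>\<^bsub>D\<^esub> fs F (fo G B)) \<cdot>\<^bsub>C\<^esub> \<eta> (fo (Shift C) (fo G B))"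
    using B by (simp add: shift_mate_def right.fm_comp)
  then show ?thesis
    using transpose[of "fm (Shift D) (\<epsilon> B) \<cdot>\<^bsub>D\<^esub> fs F (fo G B)" "fo (Shift C) (fo G B)"] B by simp
qed

end

locale shift_mate_square =
  mate_square C1 D1 F1 G1 \<eta>1 \<epsilon>1 C2 D2 F2 G2 \<eta>2 \<epsilon>2 R Q +
  adj1: shift_adjunction C1 D1 F1 G1 \<eta>1 \<epsilon>1 + adj2: shift_adjunction C2 D2 F2 G2 \<eta>2 \<epsilon>2 +
  R: shift_compatible_functor C1 C2 R + Q: shift_compatible_functor D1 D2 Q
  for C1 :: "('o1, 'm1, 'x1) tricat_scheme" and D1 :: "('o2, 'm2, 'x2) tricat_scheme"
    and F1 :: "('o1, 'm1, 'o2, 'm2, 'z1) tfctr_scheme"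
    and G1 :: "('o2, 'm2, 'o1, 'm1, 'z2) fctr_scheme" and \<eta>1 \<epsilon>1
    and C2 :: "('o3, 'm3, 'x3) tricat_scheme" and D2 :: "('o4, 'm4, 'x4) tricat_scheme"
    and F2 :: "('o3, 'm3, 'o4, 'm4, 'z3) tfctr_scheme"
    and G2 :: "('o4, 'm4, 'o3, 'm3, 'z4) fctr_scheme" and \<eta>2 \<epsilon>2
    and R :: "('o1, 'm1, 'o3, 'm3, 'z5) tfctr_scheme"
    and Q :: "('o2, 'm2, 'o4, 'm4, 'z6) tfctr_scheme"
begin

text \<open>Shift compatibility passes between mates: after transposition the condition on \<open>\<omega>\<close> at \<open>B\<close> is the condition
  on \<open>\<alpha>\<close> at \<open>G1 B\<close>, up to the invertible arrow \<open>Q \<epsilon>1\<close>, and objects of the form \<open>G1 B\<close> suffice for \<open>\<alpha>\<close>. The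
  condition on \<open>\<omega>\<close> is written with \<open>shift_mate\<close> so that it contains no inverses.\<close>

lemma mates_shift_iff:
  assumes \<alpha>: "lnat \<alpha>" and \<omega>: "rnat \<omega>" and m: "mates \<alpha> \<omega>"
    and \<epsilon>1: "\<And>B. B \<in> Ob D1 \<Longrightarrow> is_iso D1 (\<epsilon>1 B)"
  shows "(\<forall>B \<in> Ob D1. fm G2 (fs Q B) \<cdot>\<^bsub>C2\<^esub> \<omega> (fo (Shift D1) B) \<cdot>\<^bsub>C2\<^esub> fm R (adj1.shift_mate B) =
      adj2.shift_mate (fo Q B) \<cdot>\<^bsub>C2\<^esub> fm (Shift C2) (\<omega> B) \<cdot>\<^bsub>C2\<^esub> fs R (fo G1 B)) \<longleftrightarrow>
    (\<forall>A \<in> Ob C1. fs (comp_tfctr D2 Q F1) A \<cdot>\<^bsub>D2\<^esub> \<alpha> (fo (Shift C1) A) =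
      fm (Shift D2) (\<alpha> A) \<cdot>\<^bsub>D2\<^esub> fs (comp_tfctr D2 F2 R) A)"
    (is "(\<forall>B \<in> Ob D1. ?l B = ?r B) \<longleftrightarrow> (\<forall>A \<in> Ob C1. ?\<phi> A = ?\<psi> A)")
proof -
  interpret QF: shift_compatible_functor C1 D2 "comp_tfctr D2 Q F1"
    by (rule shift_compatible_comp) unfold_locales
  interpret FR: shift_compatible_functor C1 D2 "comp_tfctr D2 F2 R"
    by (rule shift_compatible_comp) unfold_locales
  note [simp] = lnat_arr[OF \<alpha>] rnat_arr[OF \<omega>]
  \<comment> \<open>both families of equations say the same at \<open>G1 B\<close>\<close>
  have at_right: "?l B = ?r B \<longleftrightarrow> ?\<phi> (fo G1 B) = ?\<psi> (fo G1 B)" if B: "B \<in> Ob D1" for B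
  proof -
    let ?e = "fm (Shift D2) (fm Q (\<epsilon>1 B))"
    have l: "\<epsilon>2 (fo (Shift D2) (fo Q B)) \<cdot>\<^bsub>D2\<^esub> fm F2 (?l B) = ?e \<cdot>\<^bsub>D2\<^esub> ?\<phi> (fo G1 B)"
    proof -
      have "\<epsilon>2 (fo (Shift D2) (fo Q B)) \<cdot>\<^bsub>D2\<^esub> fm F2 (?l B)
          = fs Q B \<cdot>\<^bsub>D2\<^esub> (\<epsilon>2 (fo Q (fo (Shift D1) B)) \<cdot>\<^bsub>D2\<^esub> (fm F2 (\<omega> (fo (Shift D1) B))
            \<cdot>\<^bsub>D2\<^esub> fm F2 (fm R (adj1.shift_mate B))))"
        using B by (simp add: adj2.left.fm_comp adj2.counit_natural_comp)
      also have "\<epsilon>2 (fo Q (fo (Shift D1) B)) \<cdot>\<^bsub>D2\<^esub> (fm F2 (\<omega> (fo (Shift D1) B))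
            \<cdot>\<^bsub>D2\<^esub> fm F2 (fm R (adj1.shift_mate B)))
          = fm Q (\<epsilon>1 (fo (Shift D1) B)) \<cdot>\<^bsub>D2\<^esub> (\<alpha> (fo G1 (fo (Shift D1) B))
            \<cdot>\<^bsub>D2\<^esub> fm F2 (fm R (adj1.shift_mate B)))"
        by (rule adj2.left.cod.subst_comp2[OF matesD[OF m]]) (use B in simp_all)
      also have "\<dots> = fm Q (\<epsilon>1 (fo (Shift D1) B) \<cdot>\<^bsub>D1\<^esub> fm F1 (adj1.shift_mate B))
          \<cdot>\<^bsub>D2\<^esub> \<alpha> (fo (Shift C1) (fo G1 B))"
        using B lnat_nat[OF \<alpha>, of "adj1.shift_mate B"] by (simp add: Q.fm_comp)
      also have "\<dots> = fm Q (fm (Shift D1) (\<epsilon>1 B)) \<cdot>\<^bsub>D2\<^esub> (fm Q (fs F1 (fo G1 B))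
          \<cdot>\<^bsub>D2\<^esub> \<alpha> (fo (Shift C1) (fo G1 B)))"
        using B adj1.transpose_shift_mate[OF B] by (simp add: Q.fm_comp)
      also have "fs Q B \<cdot>\<^bsub>D2\<^esub> \<dots> = ?e \<cdot>\<^bsub>D2\<^esub> (fs Q (fo F1 (fo G1 B)) \<cdot>\<^bsub>D2\<^esub> (fm Q (fs F1 (fo G1 B))
          \<cdot>\<^bsub>D2\<^esub> \<alpha> (fo (Shift C1) (fo G1 B))))"
        by (rule adj2.left.cod.subst_comp2) (use B Q.fs_natural[of "\<epsilon>1 B"] in simp_all)
      finally show ?thesis using B by simp
    qed
    have r: "\<epsilon>2 (fo (Shift D2) (fo Q B)) \<cdot>\<^bsub>D2\<^esub> fm F2 (?r B) = ?e \<cdot>\<^bsub>D2\<^esub> ?\<psi> (fo G1 B)"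
    proof -
      have "\<epsilon>2 (fo (Shift D2) (fo Q B)) \<cdot>\<^bsub>D2\<^esub> fm F2 (?r B)
          = fm (Shift D2) (\<epsilon>2 (fo Q B)) \<cdot>\<^bsub>D2\<^esub> (fs F2 (fo G2 (fo Q B))
            \<cdot>\<^bsub>D2\<^esub> (fm F2 (fm (Shift C2) (\<omega> B)) \<cdot>\<^bsub>D2\<^esub> fm F2 (fs R (fo G1 B))))"
        using B adj2.left.cod.subst_comp2[OF adj2.transpose_shift_mate[of "fo Q B"], of
            "fm F2 (fm (Shift C2) (\<omega> B)) \<cdot>\<^bsub>D2\<^esub> fm F2 (fs R (fo G1 B))"]
        by (simp add: adj2.left.fm_comp)
      also have "fs F2 (fo G2 (fo Q B))
            \<cdot>\<^bsub>D2\<^esub> (fm F2 (fm (Shift C2) (\<omega> B)) \<cdot>\<^bsub>D2\<^esub> fm F2 (fs R (fo G1 B)))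
          = fm (Shift D2) (fm F2 (\<omega> B)) \<cdot>\<^bsub>D2\<^esub> (fs F2 (fo R (fo G1 B)) \<cdot>\<^bsub>D2\<^esub> fm F2 (fs R (fo G1 B)))"
        by (rule adj2.left.cod.subst_comp2) (use B adj2.fs_natural[of "\<omega> B"] in simp_all)
      also have "fm (Shift D2) (\<epsilon>2 (fo Q B)) \<cdot>\<^bsub>D2\<^esub> \<dots> = (?e \<cdot>\<^bsub>D2\<^esub> fm (Shift D2) (\<alpha> (fo G1 B)))
          \<cdot>\<^bsub>D2\<^esub> (fs F2 (fo R (fo G1 B)) \<cdot>\<^bsub>D2\<^esub> fm F2 (fs R (fo G1 B)))"
        by (rule adj2.left.cod.subst_comp)
          (use B matesD[OF m B] in \<open>simp_all flip: adj2.shD.fm_comp\<close>)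
      finally show ?thesis using B by simp
    qed
    have e: "is_iso D2 ?e" using B \<epsilon>1 by simp
    show ?thesis
    proof
      assume "?l B = ?r B"
      then have "?e \<cdot>\<^bsub>D2\<^esub> ?\<phi> (fo G1 B) = ?e \<cdot>\<^bsub>D2\<^esub> ?\<psi> (fo G1 B)" using l r by simp
      then show "?\<phi> (fo G1 B) = ?\<psi> (fo G1 B)"
        by (rule adj2.left.cod.iso_cancel_left[OF e, rotated -1]) (use B in simp_all)
    next
      assume "?\<phi> (fo G1 B) = ?\<psi> (fo G1 B)"
      then show "?l B = ?r B"
        by (intro adj2.transpose_inj[of _ _ "fo (Shift D2) (fo Q B)"]) (use B l r in simp_all)
    qed
  qed
  have extend: "?\<phi> A = ?\<psi> A" if A: "A \<in> Ob C1" and eq: "?\<phi> (fo G1 (fo F1 A)) = ?\<psi> (fo G1 (fo F1 A))" for A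
  proof -
    let ?K = "comp_fctr (comp_tfctr D2 F2 R) (Shift C1)" and ?L = "comp_fctr (Shift D2) (comp_tfctr D2 Q F1)"
    have \<phi>: "nat_trans C1 D2 ?K ?L ?\<phi>"
    proof (rule nat_transI)
      fix f assume f: "f \<in> Arr C1"
      have "?\<phi> (Cod C1 f) \<cdot>\<^bsub>D2\<^esub> fm ?K f = fs (comp_tfctr D2 Q F1) (Cod C1 f) \<cdot>\<^bsub>D2\<^esub>
          (fm (comp_tfctr D2 Q F1) (fm (Shift C1) f) \<cdot>\<^bsub>D2\<^esub> \<alpha> (fo (Shift C1) (Dom C1 f)))"
        using f lnat_nat[OF \<alpha>, of "fm (Shift C1) f"] by simp
      also have "\<dots> = fm ?L f \<cdot>\<^bsub>D2\<^esub> ?\<phi> (Dom C1 f)"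
        by (rule adj2.left.cod.subst_comp2) (use f QF.fs_natural[of f] in simp_all)
      finally show "?\<phi> (Cod C1 f) \<cdot>\<^bsub>D2\<^esub> fm ?K f = fm ?L f \<cdot>\<^bsub>D2\<^esub> ?\<phi> (Dom C1 f)" .
    qed simp
    have \<psi>: "nat_trans C1 D2 ?K ?L ?\<psi>"
    proof (rule nat_transI)
      fix f assume f: "f \<in> Arr C1"
      have "?\<psi> (Cod C1 f) \<cdot>\<^bsub>D2\<^esub> fm ?K f = fm (Shift D2) (\<alpha> (Cod C1 f)) \<cdot>\<^bsub>D2\<^esub>
          (fs (comp_tfctr D2 F2 R) (Cod C1 f) \<cdot>\<^bsub>D2\<^esub> fm (comp_tfctr D2 F2 R) (fm (Shift C1) f))"
        using f by simp
      also have "\<dots> = fm (Shift D2) (\<alpha> (Cod C1 f)) \<cdot>\<^bsub>D2\<^esub> (fm (Shift D2) (fm F2 (fm R f))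
          \<cdot>\<^bsub>D2\<^esub> fs (comp_tfctr D2 F2 R) (Dom C1 f))"
        using FR.fs_natural[OF f refl] by simp
      also have "\<dots> = fm ?L f \<cdot>\<^bsub>D2\<^esub> ?\<psi> (Dom C1 f)"
        by (rule adj2.left.cod.subst_comp2)
          (use f lnat_nat[OF \<alpha> f refl] in \<open>simp_all flip: adj2.shD.fm_comp\<close>)
      finally show "?\<psi> (Cod C1 f) \<cdot>\<^bsub>D2\<^esub> fm ?K f = fm ?L f \<cdot>\<^bsub>D2\<^esub> ?\<psi> (Dom C1 f)" .
    qed simp
    have "is_iso D2 (fm ?L (\<eta>1 A))" using adj1.fm_unit_iso[OF \<epsilon>1 A] by simp
    with agree_along[OF adj1.left.dom.category_axioms adj2.left.cod.category_axioms \<phi> \<psi>, of "\<eta>1 A"] A eq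
    show ?thesis by simp
  qed
  show ?thesis
    using at_right extend adj1.left.fo_ob adj1.right.fo_ob by meson
qed

end

section \<open>Direct images along closed immersions\<close>

context localic
begin

lemma push_shift_adj:
  assumes "z \<in> Cl S" "z \<in> Hom S Z X"
  shows "shift_adjunction (fib H X) (fib H Z) (pull H z) (push H z) (push_unit H z) (push_counit H z)"
proof -
  have "X \<in> Ob S" "Z \<in> Ob S" using assms by (auto simp: Hom_def)
  then show ?thesis
    by (intro shift_adjunction.intro push_adj assms triangulated_shift_compatible fib_triangulated
        pull_triangulated)
qed

lemma tpush_simps [simp]: "fo (tpush S H z) = fo (push H z)" "fm (tpush S H z) = fm (push H z)"
  by (simp_all add: tpush_def Let_def)

text \<open>The shift isomorphism of \<open>z\<^sub>*\<close> is defined as an inverse, which is meaningful because \<open>shift_mate\<close> is an arrow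
  between objects killed by \<open>u\<^sup>*\<close>, inverted by \<open>z\<^sup>*\<close>.\<close>

lemma push_shift_mate:
  assumes z: "z \<in> Cl S" "z \<in> Hom S Z X" and B: "B \<in> Ob (fib H Z)"
  defines "\<sigma> \<equiv> shift_adjunction.shift_mate (fib H X) (fib H Z) (pull H z) (push H z)
    (push_unit H z) (push_counit H z) B"
  shows "is_iso (fib H X) \<sigma>" "fs (tpush S H z) B = inv_arr (fib H X) \<sigma>"
proof -
  interpret z: shift_adjunction "fib H X" "fib H Z" "pull H z" "push H z" "push_unit H z" "push_counit H z"
    using push_shift_adj z .
  have dc: "Dom S z = Z" "Cod S z = X" using z by (auto simp: Hom_def)
  show "fs (tpush S H z) B = inv_arr (fib H X) \<sigma>"
    by (simp add: tpush_def Let_def dc \<sigma>_def z.shift_mate_def)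
  obtain U where u: "Opn S z \<in> Hom S U X"
    using Sm_Hom[OF Opn_Sm[OF z(1)]] Cod_Opn[OF z(1)] dc by auto
  have ob: "X \<in> Ob S" "Z \<in> Ob S" "U \<in> Ob S" using z u by (auto simp: Hom_def)
  interpret up: shift_compatible_functor "fib H X" "fib H U" "pull H (Opn S z)"
    using triangulated_shift_compatible fib_triangulated pull_triangulated[OF u] ob by blast
  show "is_iso (fib H X) \<sigma>"
  proof (rule iso_into_push[OF z u, of _ "fo (Shift (fib H Z)) B"])
    let ?zB = "fo (push H z) B"
    have "nat_iso (fib H X) (fib H U) (comp_fctr (pull H (Opn S z)) (Shift (fib H X)))
        (comp_fctr (Shift (fib H U)) (pull H (Opn S z))) (fs (pull H (Opn S z)))"
      using pull_triangulated[OF u] by (simp add: triangulated_functor_def)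
    then have "is_iso (fib H U) (fs (pull H (Opn S z)) ?zB)" using B by (simp add: nat_iso_def)
    moreover have "vanishes (fib H U) (fo (Shift (fib H U)) (fo (pull H (Opn S z)) ?zB))"
      using additive_functor_vanishes[OF up.D.shift_additive up.D.additive_category_axioms
          up.D.additive_category_axioms] pull_open_push_vanishes[OF z u B] by blast
    ultimately have "vanishes (fib H U) (fo (pull H (Opn S z)) (fo (Shift (fib H X)) ?zB))"
      using up.D.vanishes_iso(1)[of "fs (pull H (Opn S z)) ?zB"] B by simp
    then show "vanishes (fib H U) (fo (pull H (Opn S z)) (Dom (fib H X) \<sigma>))"
      using B by (simp add: \<sigma>_def)
    have "nat_iso (fib H X) (fib H Z) (comp_fctr (pull H z) (Shift (fib H X)))
        (comp_fctr (Shift (fib H Z)) (pull H z)) (fs (pull H z))"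
      using pull_triangulated[OF z(2)] by (simp add: triangulated_functor_def)
    then have "is_iso (fib H Z) (fs (pull H z) ?zB)" using B by (simp add: nat_iso_def)
    then show "is_iso (fib H Z) (push_counit H z (fo (Shift (fib H Z)) B) \<cdot>\<^bsub>fib H Z\<^esub> fm (pull H z) \<sigma>)"
      unfolding \<sigma>_def z.transpose_shift_mate[OF B]
      using z.left.cod.iso_comp push_counit_iso[OF z B] B by simp
  qed (use B in \<open>simp_all add: \<sigma>_def\<close>)
qed

text \<open>\<open>push_conn\<close> is a mate of the inverse of \<open>conn\<close>, as \<open>push_base_change\<close> is one of \<open>exchange\<close>; both are used through
  their transposes.\<close>

lemma transpose_push_conn:
  assumes z: "z \<in> Cl S" "z \<in> Hom S Z Y" and y: "y \<in> Cl S" "y \<in> Hom S Y X" and B: "B \<in> Ob (fib H Z)"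
  shows "push_counit H z B \<cdot>\<^bsub>fib H Z\<^esub>
      fm (pull H z) (push_counit H y (fo (push H z) B) \<cdot>\<^bsub>fib H Y\<^esub> fm (pull H y) (push_conn S H y z B))
    = push_counit H (y \<cdot> z) B \<cdot>\<^bsub>fib H Z\<^esub> inv_arr (fib H Z) (conn H z y (fo (push H (y \<cdot> z)) B))"
    (is "?t = ?s")
    and "push_conn S H y z B \<in> Arr (fib H X)"
    and "Dom (fib H X) (push_conn S H y z B) = fo (push H (y \<cdot> z)) B"
    and "Cod (fib H X) (push_conn S H y z B) = fo (push H y) (fo (push H z) B)"
proof -
  have dc: "Dom S z = Z" "Cod S z = Y" "Dom S y = Y" "Cod S y = X" using z y by (auto simp: Hom_def)
  have yz: "y \<cdot> z \<in> Cl S" "y \<cdot> z \<in> Hom S Z X" using Cl_Comp[of z y] z y Comp_in dc by auto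
  interpret z: adjunction "fib H Y" "fib H Z" "pull H z" "push H z" "push_unit H z" "push_counit H z"
    using push_adj z .
  interpret y: adjunction "fib H X" "fib H Y" "pull H y" "push H y" "push_unit H y" "push_counit H y"
    using push_adj y .
  interpret yz: adjunction "fib H X" "fib H Z" "pull H (y \<cdot> z)" "push H (y \<cdot> z)" "push_unit H (y \<cdot> z)"
    "push_counit H (y \<cdot> z)"
    using push_adj yz .
  let ?P = "fo (push H (y \<cdot> z)) B"
  note [simp] = conn_arr[OF z(2) y(2), of ?P]
  have pc: "push_conn S H y z B = fm (push H y) (fm (push H z) ?s \<cdot>\<^bsub>fib H Y\<^esub> push_unit H z (fo (pull H y) ?P))
      \<cdot>\<^bsub>fib H X\<^esub> push_unit H y ?P"
    using B by (simp add: push_conn_def Let_def dc y.right.fm_comp z.right.fm_comp)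
  show "push_conn S H y z B \<in> Arr (fib H X)"
    "Dom (fib H X) (push_conn S H y z B) = ?P"
    "Cod (fib H X) (push_conn S H y z B) = fo (push H y) (fo (push H z) B)"
    using B by (simp_all add: pc)
  have "push_counit H y (fo (push H z) B) \<cdot>\<^bsub>fib H Y\<^esub> fm (pull H y) (push_conn S H y z B)
      = fm (push H z) ?s \<cdot>\<^bsub>fib H Y\<^esub> push_unit H z (fo (pull H y) ?P)"
    unfolding pc
    using y.transpose[of "fm (push H z) ?s \<cdot>\<^bsub>fib H Y\<^esub> push_unit H z (fo (pull H y) ?P)" ?P] B by simp
  then show "?t = ?s" using z.transpose[of ?s "fo (pull H y) ?P"] B by simp
qed

lemma transpose_push_base_change:
  assumes p: "p \<in> Hom S P X" and z: "z \<in> Cl S" "z \<in> Hom S Z X" and p': "p' \<in> Hom S V Z"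
    and z': "z' \<in> Cl S" "z' \<in> Hom S V P" and eq: "p \<cdot> z' = z \<cdot> p'" and B: "B \<in> Ob (fib H Z)"
  shows "push_counit H z' (fo (pull H p') B) \<cdot>\<^bsub>fib H V\<^esub> fm (pull H z') (push_base_change S H p z p' z' B)
    = fm (pull H p') (push_counit H z B) \<cdot>\<^bsub>fib H V\<^esub> exchange S H z' p p' z (fo (push H z) B)"
    (is "?t = ?s")
    and "push_base_change S H p z p' z' B \<in> Arr (fib H P)"
    and "Dom (fib H P) (push_base_change S H p z p' z' B) = fo (pull H p) (fo (push H z) B)"
    and "Cod (fib H P) (push_base_change S H p z p' z' B) = fo (push H z') (fo (pull H p') B)"
proof -
  have dc: "Dom S p = P" using p by (auto simp: Hom_def)
  interpret z: adjunction "fib H X" "fib H Z" "pull H z" "push H z" "push_unit H z" "push_counit H z"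
    using push_adj z .
  interpret z': adjunction "fib H P" "fib H V" "pull H z'" "push H z'" "push_unit H z'" "push_counit H z'"
    using push_adj z' .
  interpret p: cat_functor "fib H X" "fib H P" "pull H p" using pull_functor p .
  interpret p': cat_functor "fib H Z" "fib H V" "pull H p'" using pull_functor p' .
  note [simp] = exchange_arr[OF z'(2) p p' z(2) eq]
  have bc: "push_base_change S H p z p' z' B
      = fm (push H z') ?s \<cdot>\<^bsub>fib H P\<^esub> push_unit H z' (fo (pull H p) (fo (push H z) B))"
    using B by (simp add: push_base_change_def dc z'.right.fm_comp)
  show "?t = ?s" "push_base_change S H p z p' z' B \<in> Arr (fib H P)"
    "Dom (fib H P) (push_base_change S H p z p' z' B) = fo (pull H p) (fo (push H z) B)"
    "Cod (fib H P) (push_base_change S H p z p' z' B) = fo (push H z') (fo (pull H p') B)"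
    using B z'.transpose[of ?s "fo (pull H p) (fo (push H z) B)"] by (simp_all add: bc)
qed

end

section \<open>Passing between \<open>z\<^sup>*\<close> and \<open>z\<^sub>*\<close>\<close>

context localic_pair
begin

lemma mate_square:
  assumes z: "z \<in> Cl S" "z \<in> Hom S Z X"
  shows "shift_mate_square (fib H1 X) (fib H1 Z) (pull H1 z) (push H1 z) (push_unit H1 z) (push_counit H1 z)
    (fib H2 X) (fib H2 Z) (pull H2 z) (push H2 z) (push_unit H2 z) (push_counit H2 z) (R X) (R Z)"
proof -
  interpret RX: shift_compatible_functor "fib H1 X" "fib H2 X" "R X" using R_shift Hom_ob z by blast
  interpret RZ: shift_compatible_functor "fib H1 Z" "fib H2 Z" "R Z" using R_shift Hom_ob z by blast
  show ?thesis
    by (intro shift_mate_square.intro mate_square.intro one.push_shift_adj two.push_shift_adj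
        one.push_adj two.push_adj z) unfold_locales
qed

definition pull_natural :: "'a \<Rightarrow> ('o1 \<Rightarrow> 'm2) \<Rightarrow> bool" where
  "pull_natural z \<equiv> nat_trans (fib H1 (Cod S z)) (fib H2 (Dom S z))
     (comp_fctr (pull H2 z) (R (Cod S z))) (comp_fctr (R (Dom S z)) (pull H1 z))"

definition push_natural :: "'a \<Rightarrow> ('o1 \<Rightarrow> 'm2) \<Rightarrow> bool" where
  "push_natural z \<equiv> nat_trans (fib H1 (Dom S z)) (fib H2 (Cod S z))
     (comp_fctr (R (Cod S z)) (push H1 z)) (comp_fctr (push H2 z) (R (Dom S z)))"

definition push_compat :: "'a \<Rightarrow> ('o1 \<Rightarrow> 'm2) \<Rightarrow> bool" where
  "push_compat z \<omega> \<longleftrightarrow> tri_nat_iso (fib H1 (Dom S z)) (fib H2 (Cod S z))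
     (comp_tfctr (fib H2 (Cod S z)) (R (Cod S z)) (tpush S H1 z))
     (comp_tfctr (fib H2 (Cod S z)) (tpush S H2 z) (R (Dom S z))) \<omega>"

text \<open>For natural \<open>\<alpha>\<close> and \<open>\<omega>\<close> this relation is the graph of the bijection between transformations
  \<open>z\<^sup>* R \<rightarrow> R z\<^sup>*\<close> and \<open>R z\<^sub>* \<rightarrow> z\<^sub>* R\<close>.\<close>

definition mated :: "'a \<Rightarrow> ('o1 \<Rightarrow> 'm2) \<Rightarrow> ('o1 \<Rightarrow> 'm2) \<Rightarrow> bool" where
  "mated z \<alpha> \<omega> \<longleftrightarrow> (\<forall>B \<in> Ob (fib H1 (Dom S z)).
     push_counit H2 z (fo (R (Dom S z)) B) \<cdot>\<^bsub>fib H2 (Dom S z)\<^esub> fm (pull H2 z) (\<omega> B) =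
     fm (R (Dom S z)) (push_counit H1 z B) \<cdot>\<^bsub>fib H2 (Dom S z)\<^esub> \<alpha> (fo (push H1 z) B))"

lemma compat_pull_natural: "compat f \<alpha> \<Longrightarrow> pull_natural f \<alpha>"
  by (simp add: compat_def pull_natural_def tri_nat_iso_def nat_iso_def nat_trans_def)

lemma push_compat_push_natural:
  assumes "push_compat z \<omega>"
  shows "push_natural z \<omega>"
  using assms
  by (simp add: push_compat_def push_natural_def tri_nat_iso_def nat_iso_def nat_trans_def)

text \<open>The mates of \<open>\<theta>\<close> and \<open>\<omega>\<close> at \<open>z\<close> read only the families \<open>\<theta> z\<close> and \<open>\<omega> z\<close>; constant families thus express the
  mate of a single transformation.\<close>

lemma
  assumes z: "z \<in> Cl S"
  shows mated_push_mate: "pull_natural z \<alpha> \<Longrightarrow> mated z \<alpha> (push_mate S H1 H2 R (\<lambda>_. \<alpha>) z)"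
    and push_mate_natural: "pull_natural z \<alpha> \<Longrightarrow> push_natural z (push_mate S H1 H2 R (\<lambda>_. \<alpha>) z)"
    and mated_pull_mate: "push_natural z \<omega> \<Longrightarrow> mated z (pull_mate S H1 H2 R (\<lambda>_. \<omega>) z) \<omega>"
    and pull_mate_natural: "push_natural z \<omega> \<Longrightarrow> pull_natural z (pull_mate S H1 H2 R (\<lambda>_. \<omega>) z)"
    and pull_mate_eq: "\<lbrakk>pull_natural z \<alpha>; push_natural z \<omega>; mated z \<alpha> \<omega>; A \<in> Ob (fib H1 (Cod S z))\<rbrakk>
      \<Longrightarrow> pull_mate S H1 H2 R (\<lambda>_. \<omega>) z A = \<alpha> A"
    and push_mate_eq: "\<lbrakk>pull_natural z \<alpha>; push_natural z \<omega>; mated z \<alpha> \<omega>; B \<in> Ob (fib H1 (Dom S z))\<rbrakk>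
      \<Longrightarrow> push_mate S H1 H2 R (\<lambda>_. \<alpha>) z B = \<omega> B"
proof -
  let ?X = "Cod S z" and ?Z = "Dom S z"
  interpret sq: shift_mate_square "fib H1 ?X" "fib H1 ?Z" "pull H1 z" "push H1 z" "push_unit H1 z"
    "push_counit H1 z" "fib H2 ?X" "fib H2 ?Z" "pull H2 z" "push H2 z" "push_unit H2 z" "push_counit H2 z"
    "R ?X" "R ?Z"
    using mate_square[OF z one.Cl_Hom[OF z]] .
  have push: "push_mate S H1 H2 R (\<lambda>_. \<alpha>) z = sq.rmate \<alpha>" for \<alpha>
    by (simp add: push_mate_def sq.rmate_def fun_eq_iff)
  have pull: "pull_mate S H1 H2 R (\<lambda>_. \<omega>) z = sq.lmate \<omega>" for \<omega>
    by (simp add: pull_mate_def sq.lmate_def fun_eq_iff)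
  have m: "mated z = sq.mates" by (simp add: mated_def sq.mates_def fun_eq_iff)
  show "pull_natural z \<alpha> \<Longrightarrow> mated z \<alpha> (push_mate S H1 H2 R (\<lambda>_. \<alpha>) z)"
    and "pull_natural z \<alpha> \<Longrightarrow> push_natural z (push_mate S H1 H2 R (\<lambda>_. \<alpha>) z)"
    and "push_natural z \<omega> \<Longrightarrow> mated z (pull_mate S H1 H2 R (\<lambda>_. \<omega>) z) \<omega>"
    and "push_natural z \<omega> \<Longrightarrow> pull_natural z (pull_mate S H1 H2 R (\<lambda>_. \<omega>) z)"
    and "\<lbrakk>pull_natural z \<alpha>; push_natural z \<omega>; mated z \<alpha> \<omega>; A \<in> Ob (fib H1 (Cod S z))\<rbrakk>
      \<Longrightarrow> pull_mate S H1 H2 R (\<lambda>_. \<omega>) z A = \<alpha> A"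
    and "\<lbrakk>pull_natural z \<alpha>; push_natural z \<omega>; mated z \<alpha> \<omega>; B \<in> Ob (fib H1 (Dom S z))\<rbrakk>
      \<Longrightarrow> push_mate S H1 H2 R (\<lambda>_. \<alpha>) z B = \<omega> B"
    unfolding push pull m pull_natural_def push_natural_def
    using sq.mates_rmate sq.rmate_nat sq.mates_lmate sq.lmate_nat sq.lmate_unique sq.rmate_unique
    by blast+
qed

lemma push_mate_cong: "\<theta> z = \<theta>' z \<Longrightarrow> push_mate S H1 H2 R \<theta> z = push_mate S H1 H2 R \<theta>' z"
  and pull_mate_cong: "\<omega> z = \<omega>' z \<Longrightarrow> pull_mate S H1 H2 R \<omega> z = pull_mate S H1 H2 R \<omega>' z"
  by (simp_all add: push_mate_def pull_mate_def fun_eq_iff)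

text \<open>The shift isomorphism of \<open>tpush\<close> is the inverse of \<open>shift_mate\<close>. Clearing it on both sides leads to the
  condition of \<open>mates_shift_iff\<close>.\<close>

lemma mated_compat_iff:
  assumes z: "z \<in> Cl S" and \<alpha>: "pull_natural z \<alpha>" and \<omega>: "push_natural z \<omega>" and m: "mated z \<alpha> \<omega>"
    and iso_\<alpha>: "\<And>A. A \<in> Ob (fib H1 (Cod S z)) \<Longrightarrow> is_iso (fib H2 (Dom S z)) (\<alpha> A)"
    and iso_\<omega>: "\<And>B. B \<in> Ob (fib H1 (Dom S z)) \<Longrightarrow> is_iso (fib H2 (Cod S z)) (\<omega> B)"
  shows "compat z \<alpha> \<longleftrightarrow> push_compat z \<omega>"
proof -
  let ?X = "Cod S z" and ?Z = "Dom S z"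
  note zH = one.Cl_Hom[OF z]
  interpret sq: shift_mate_square "fib H1 ?X" "fib H1 ?Z" "pull H1 z" "push H1 z" "push_unit H1 z"
    "push_counit H1 z" "fib H2 ?X" "fib H2 ?Z" "pull H2 z" "push H2 z" "push_unit H2 z" "push_counit H2 z"
    "R ?X" "R ?Z"
    using mate_square[OF z zH] .
  have ln: "sq.lnat \<alpha>" and rn: "sq.rnat \<omega>" and ms: "sq.mates \<alpha> \<omega>"
    using \<alpha> \<omega> m by (simp_all add: pull_natural_def push_natural_def mated_def sq.mates_def)
  note [simp] = sq.lnat_arr[OF ln] sq.rnat_arr[OF rn]
  let ?s1 = "sq.adj1.shift_mate" and ?s2 = "sq.adj2.shift_mate"
  have conv: "fs (comp_tfctr (fib H2 ?X) (tpush S H2 z) (R ?Z)) B \<cdot>\<^bsub>fib H2 ?X\<^esub> \<omega> (fo (Shift (fib H1 ?Z)) B)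
        = fm (Shift (fib H2 ?X)) (\<omega> B) \<cdot>\<^bsub>fib H2 ?X\<^esub> fs (comp_tfctr (fib H2 ?X) (R ?X) (tpush S H1 z)) B \<longleftrightarrow>
      fm (push H2 z) (fs (R ?Z) B) \<cdot>\<^bsub>fib H2 ?X\<^esub> \<omega> (fo (Shift (fib H1 ?Z)) B) \<cdot>\<^bsub>fib H2 ?X\<^esub> fm (R ?X) (?s1 B)
        = ?s2 (fo (R ?Z) B) \<cdot>\<^bsub>fib H2 ?X\<^esub> fm (Shift (fib H2 ?X)) (\<omega> B) \<cdot>\<^bsub>fib H2 ?X\<^esub> fs (R ?X) (fo (push H1 z) B)"
    (is "?l = ?r \<longleftrightarrow> ?l' = ?r'") if B: "B \<in> Ob (fib H1 ?Z)" for B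
  proof -
    let ?a = "?s2 (fo (R ?Z) B)" and ?b = "fm (R ?X) (?s1 B)"
    have iso: "is_iso (fib H2 ?X) ?a" "is_iso (fib H1 ?X) (?s1 B)"
      and fs: "fs (tpush S H2 z) (fo (R ?Z) B) = inv_arr (fib H2 ?X) ?a"
        "fs (tpush S H1 z) B = inv_arr (fib H1 ?X) (?s1 B)"
      using one.push_shift_mate[OF z zH B] two.push_shift_mate[OF z zH, of "fo (R ?Z) B"] B by simp_all
    have b: "is_iso (fib H2 ?X) ?b" using iso by simp
    have binv: "fm (R ?X) (inv_arr (fib H1 ?X) (?s1 B)) = inv_arr (fib H2 ?X) ?b"
      using sq.R.inv_arr_fm[OF iso(2)] by simp
    have l: "?a \<cdot>\<^bsub>fib H2 ?X\<^esub> (?l \<cdot>\<^bsub>fib H2 ?X\<^esub> ?b) = ?l'"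
      using iso b B by (simp add: fs)
    have r: "?a \<cdot>\<^bsub>fib H2 ?X\<^esub> (?r \<cdot>\<^bsub>fib H2 ?X\<^esub> ?b) = ?r'"
      using iso b B by (simp add: fs binv)
    have "?l = ?r" if "?l' = ?r'"
    proof -
      have "?l \<cdot>\<^bsub>fib H2 ?X\<^esub> ?b = ?r \<cdot>\<^bsub>fib H2 ?X\<^esub> ?b"
        by (rule sq.adj2.left.dom.iso_cancel_left[OF iso(1)]) (use that l r iso b B in \<open>simp_all add: fs binv\<close>)
      then show ?thesis
        by (rule sq.adj2.left.dom.iso_cancel_right[OF b, rotated -1]) (use iso b B in \<open>simp_all add: fs binv\<close>)
    qed
    then show ?thesis using l r by metis
  qed
  have "compat z \<alpha> \<longleftrightarrow> (\<forall>A \<in> Ob (fib H1 ?X). fs (comp_tfctr (fib H2 ?Z) (R ?Z) (pull H1 z)) A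
      \<cdot>\<^bsub>fib H2 ?Z\<^esub> \<alpha> (fo (Shift (fib H1 ?X)) A) =
      fm (Shift (fib H2 ?Z)) (\<alpha> A) \<cdot>\<^bsub>fib H2 ?Z\<^esub> fs (comp_tfctr (fib H2 ?Z) (pull H2 z) (R ?X)) A)"
    using \<alpha> iso_\<alpha> by (simp add: compat_def pull_natural_def tri_nat_iso_def nat_iso_def nat_trans_def)
  also have "\<dots> \<longleftrightarrow> (\<forall>B \<in> Ob (fib H1 ?Z).
      fm (push H2 z) (fs (R ?Z) B) \<cdot>\<^bsub>fib H2 ?X\<^esub> \<omega> (fo (Shift (fib H1 ?Z)) B) \<cdot>\<^bsub>fib H2 ?X\<^esub> fm (R ?X) (?s1 B)
        = ?s2 (fo (R ?Z) B) \<cdot>\<^bsub>fib H2 ?X\<^esub> fm (Shift (fib H2 ?X)) (\<omega> B) \<cdot>\<^bsub>fib H2 ?X\<^esub> fs (R ?X) (fo (push H1 z) B))"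
    using sq.mates_shift_iff[OF ln rn ms one.push_counit_iso[OF z zH]] by simp
  also have "\<dots> \<longleftrightarrow> push_compat z \<omega>"
    using \<omega> iso_\<omega> conv
    by (simp add: push_compat_def push_natural_def tri_nat_iso_def nat_iso_def nat_trans_def)
  finally show ?thesis .
qed

text \<open>The source \<open>R z\<^sub>* B\<close> of \<open>\<omega> B\<close> is killed by \<open>u\<^sup>*\<close>, because \<open>\<tau>\<close> moves \<open>u\<^sup>*\<close> past \<open>R\<close>; the transpose of \<open>\<omega> B\<close> is a
  composite of isomorphisms.\<close>

lemma mated_push_iso:
  assumes z: "z \<in> Cl S" and \<alpha>: "pull_natural z \<alpha>" and \<omega>: "push_natural z \<omega>" and m: "mated z \<alpha> \<omega>"
    and \<tau>: "compat (Opn S z) \<tau>"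
    and iso: "\<And>A. A \<in> Ob (fib H1 (Cod S z)) \<Longrightarrow> is_iso (fib H2 (Dom S z)) (\<alpha> A)"
    and B: "B \<in> Ob (fib H1 (Dom S z))"
  shows "is_iso (fib H2 (Cod S z)) (\<omega> B)"
proof -
  let ?X = "Cod S z" and ?Z = "Dom S z" and ?U = "Dom S (Opn S z)"
  note zH = one.Cl_Hom[OF z]
  have u: "Opn S z \<in> Hom S ?U ?X" using one.Sm_Hom[OF Opn_Sm[OF z]] Cod_Opn[OF z] by simp
  have ob: "?X \<in> Ob S" "?Z \<in> Ob S" "?U \<in> Ob S" using Hom_ob zH u by auto
  interpret sq: shift_mate_square "fib H1 ?X" "fib H1 ?Z" "pull H1 z" "push H1 z" "push_unit H1 z"
    "push_counit H1 z" "fib H2 ?X" "fib H2 ?Z" "pull H2 z" "push H2 z" "push_unit H2 z" "push_counit H2 z"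
    "R ?X" "R ?Z"
    using mate_square[OF z zH] .
  interpret U: additive_category "fib H2 ?U" using two.fib_additive ob by simp
  have ln: "sq.lnat \<alpha>" and rn: "sq.rnat \<omega>"
    using \<alpha> \<omega> by (simp_all add: pull_natural_def push_natural_def)
  note [simp] = sq.lnat_arr[OF ln] sq.rnat_arr[OF rn]
  let ?zB = "fo (push H1 z) B"
  have "vanishes (fib H2 ?U) (fo (R ?U) (fo (pull H1 (Opn S z)) ?zB))"
    using additive_functor_vanishes[OF _ one.fib_additive two.fib_additive
        one.pull_open_push_vanishes[OF z zH u B]] R_triangulated ob
    by (auto simp: triangulated_functor_def)
  then have "vanishes (fib H2 ?U) (fo (pull H2 (Opn S z)) (fo (R ?X) ?zB))"
    using U.vanishes_iso(1)[of "\<tau> ?zB"] compat_arr[OF u \<tau>, of ?zB] B by simp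
  moreover have "is_iso (fib H2 ?Z) (push_counit H2 z (fo (R ?Z) B) \<cdot>\<^bsub>fib H2 ?Z\<^esub> fm (pull H2 z) (\<omega> B))"
  proof -
    have "is_iso (fib H2 ?Z) (fm (R ?Z) (push_counit H1 z B) \<cdot>\<^bsub>fib H2 ?Z\<^esub> \<alpha> ?zB)"
      by (rule sq.adj2.left.cod.iso_comp) (use iso B one.push_counit_iso[OF z zH B] in simp_all)
    then show ?thesis using m B by (simp add: mated_def)
  qed
  ultimately show ?thesis
    using two.iso_into_push[OF z zH u, of "\<omega> B" "fo (R ?Z) B"] B by simp
qed

text \<open>By the formula for \<open>\<alpha> A\<close> in terms of \<open>\<omega>\<close>, it is enough that \<open>z\<^sup>* R\<close> inverts the unit \<open>A \<rightarrow> z\<^sub>* z\<^sup>* A\<close>, that is,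
  kills its cone \<open>G\<close>. Now \<open>G\<close> has the form \<open>u\<^sub># C\<close>, and left adjointability identifies \<open>R u\<^sub># C\<close> with
  \<open>u\<^sub># R C\<close>, which \<open>z\<^sup>*\<close> kills.\<close>

lemma mated_pull_iso:
  assumes z: "z \<in> Cl S" and \<alpha>: "pull_natural z \<alpha>" and \<omega>: "push_natural z \<omega>" and m: "mated z \<alpha> \<omega>"
    and \<tau>: "compat (Opn S z) (\<theta> (Opn S z))" and la: "left_adjointable S H1 H2 R \<theta>"
    and iso: "\<And>B. B \<in> Ob (fib H1 (Dom S z)) \<Longrightarrow> is_iso (fib H2 (Cod S z)) (\<omega> B)"
    and A: "A \<in> Ob (fib H1 (Cod S z))"
  shows "is_iso (fib H2 (Dom S z)) (\<alpha> A)"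
proof -
  let ?X = "Cod S z" and ?Z = "Dom S z" and ?u = "Opn S z" and ?U = "Dom S (Opn S z)"
  note zH = one.Cl_Hom[OF z]
  have du: "Cod S ?u = ?X" and u: "?u \<in> Hom S ?U ?X" and uS: "?u \<in> Sm S"
    using one.Sm_Hom[OF Opn_Sm[OF z]] Cod_Opn[OF z] Opn_Sm[OF z] by simp_all
  have ob: "?X \<in> Ob S" "?Z \<in> Ob S" "?U \<in> Ob S" using Hom_ob zH u by auto
  interpret Z2: triangulated_category "fib H2 ?Z" using two.fib_triangulated ob by simp
  interpret X1: triangulated_category "fib H1 ?X" using one.fib_triangulated ob by simp
  interpret sq: shift_mate_square "fib H1 ?X" "fib H1 ?Z" "pull H1 z" "push H1 z" "push_unit H1 z"
    "push_counit H1 z" "fib H2 ?X" "fib H2 ?Z" "pull H2 z" "push H2 z" "push_unit H2 z" "push_counit H2 z"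
    "R ?X" "R ?Z"
    using mate_square[OF z zH] .
  interpret RU: shift_compatible_functor "fib H1 ?U" "fib H2 ?U" "R ?U" using R_shift ob by blast
  interpret u1: adjunction "fib H1 ?U" "fib H1 ?X" "sharp H1 ?u" "pull H1 ?u" "sharp_unit H1 ?u" "sharp_counit H1 ?u"
    using one.sharp_adj[OF uS u] .
  interpret u2: adjunction "fib H2 ?U" "fib H2 ?X" "sharp H2 ?u" "pull H2 ?u" "sharp_unit H2 ?u" "sharp_counit H2 ?u"
    using two.sharp_adj[OF uS u] .
  have ln: "sq.lnat \<alpha>" and rn: "sq.rnat \<omega>" and ms: "sq.mates \<alpha> \<omega>"
    using \<alpha> \<omega> m by (simp_all add: pull_natural_def push_natural_def mated_def sq.mates_def)
  note [simp] = sq.lnat_arr[OF ln] sq.rnat_arr[OF rn]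
  have van: "vanishes (fib H2 ?Z) (fo (pull H2 z) (fo (R ?X) G))"
    if G: "G \<in> Ob (fib H1 ?X)" and v: "vanishes (fib H1 ?Z) (fo (pull H1 z) G)" for G
  proof -
    let ?V = "fo (pull H1 ?u) G" and ?c = "sharp_counit H1 ?u G"
    let ?m = "sharp_mate S H1 H2 R \<theta> ?u ?V"
    have V: "?V \<in> Ob (fib H1 ?U)" using G by simp
    have m: "?m \<in> Arr (fib H2 ?X)" "Dom (fib H2 ?X) ?m = fo (sharp H2 ?u) (fo (R ?U) ?V)"
      "Cod (fib H2 ?X) ?m = fo (R ?X) (fo (sharp H1 ?u) ?V)"
      using V compat_arr[OF u \<tau>, of "fo (sharp H1 ?u) ?V"] by (simp_all add: sharp_mate_def du)
    have "is_iso (fib H2 ?X) ?m" using la uS V du unfolding left_adjointable_def by metis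
    moreover have "is_iso (fib H2 ?X) (fm (R ?X) ?c)"
      using one.sharp_open_counit_iso[OF z zH u G v] by simp
    ultimately have "is_iso (fib H2 ?Z) (fm (pull H2 z) (fm (R ?X) ?c \<cdot>\<^bsub>fib H2 ?X\<^esub> ?m))"
      using sq.adj2.left.dom.iso_comp[of ?m "fm (R ?X) ?c"] m G by simp
    then show ?thesis
      using Z2.vanishes_iso(2)[of "fm (pull H2 z) (fm (R ?X) ?c \<cdot>\<^bsub>fib H2 ?X\<^esub> ?m)"] m G
        two.pull_closed_sharp_open_vanishes[OF z zH u, of "fo (R ?U) ?V"] V by simp
  qed
  obtain g h where t: "(push_unit H1 z A, g, h) \<in> Dist (fib H1 ?X)"
    and v: "vanishes (fib H1 ?Z) (fo (pull H1 z) (Cod (fib H1 ?X) g))"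
    using one.push_unit_cone[OF z zH A] .
  note garr = X1.triangle_arr[OF t]
  have "is_iso (fib H2 ?Z) (fm (pull H2 z) (fm (R ?X) (push_unit H1 z A)))"
  proof -
    obtain h' where "(fm (R ?X) (push_unit H1 z A), fm (R ?X) g, h') \<in> Dist (fib H2 ?X)"
      using R_triangulated[OF ob(1)] t unfolding triangulated_functor_def by blast
    then obtain h'' where "(fm (pull H2 z) (fm (R ?X) (push_unit H1 z A)),
        fm (pull H2 z) (fm (R ?X) g), h'') \<in> Dist (fib H2 ?Z)"
      using two.pull_triangulated[OF zH] unfolding triangulated_functor_def by blast
    then show ?thesis
      using Z2.iso_if_cone_vanishes van[of "Cod (fib H1 ?X) g"] v garr by fastforce
  qed
  moreover have "is_iso (fib H2 ?Z) (push_counit H2 z (fo (R ?Z) (fo (pull H1 z) A)))"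
    using two.push_counit_iso[OF z zH] A by simp
  moreover have "is_iso (fib H2 ?Z) (fm (pull H2 z) (\<omega> (fo (pull H1 z) A)))"
    using iso A by simp
  ultimately have "is_iso (fib H2 ?Z) (sq.lmate \<omega> A)"
    unfolding sq.lmate_def using A by (intro Z2.iso_comp) simp_all
  then show ?thesis using sq.lmate_unique[OF ln rn ms A] by simp
qed

text \<open>\<open>(z \<cdot> k)\<^sup>*\<close> factors through \<open>z\<^sup>*\<close> up to isomorphism and therefore inverts the unit of \<open>z\<^sup>* \<stileturn> z\<^sub>*\<close>.\<close>

lemma compat_agree:
  assumes z: "z \<in> Cl S" "z \<in> Hom S Z X" and k: "k \<in> Hom S Y Z"
    and \<phi>: "compat (z \<cdot> k) \<phi>" and \<psi>: "compat (z \<cdot> k) \<psi>"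
    and eq: "\<And>B. B \<in> Ob (fib H1 Z) \<Longrightarrow> \<phi> (fo (push H1 z) B) = \<psi> (fo (push H1 z) B)"
    and A: "A \<in> Ob (fib H1 X)"
  shows "\<phi> A = \<psi> A"
proof -
  have zk: "z \<cdot> k \<in> Hom S Y X" using Comp_in k z by blast
  have ob: "X \<in> Ob S" "Z \<in> Ob S" "Y \<in> Ob S" using Hom_ob z k by auto
  interpret z: adjunction "fib H1 X" "fib H1 Z" "pull H1 z" "push H1 z" "push_unit H1 z" "push_counit H1 z"
    using one.push_adj z .
  interpret k: cat_functor "fib H1 Z" "fib H1 Y" "pull H1 k" using one.pull_functor k .
  interpret zk: cat_functor "fib H1 X" "fib H1 Y" "pull H1 (z \<cdot> k)" using one.pull_functor zk .
  interpret RY: shift_compatible_functor "fib H1 Y" "fib H2 Y" "R Y" using R_shift ob by blast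
  have "is_iso (fib H1 Z) (fm (pull H1 z) (push_unit H1 z A))"
    using z.fm_unit_iso[OF one.push_counit_iso[OF z] A] .
  then have "is_iso (fib H1 Y) (fm (pull H1 k) (fm (pull H1 z) (push_unit H1 z A))
      \<cdot>\<^bsub>fib H1 Y\<^esub> conn H1 k z A)"
    using one.conn_arr[OF k z(2) A] A by (intro k.cod.iso_comp) simp_all
  then have "is_iso (fib H1 Y) (conn H1 k z (fo (push H1 z) (fo (pull H1 z) A))
      \<cdot>\<^bsub>fib H1 Y\<^esub> fm (pull H1 (z \<cdot> k)) (push_unit H1 z A))"
    using one.conn_natural[OF k z(2), of "push_unit H1 z A"] A by simp
  then have "is_iso (fib H1 Y) (fm (pull H1 (z \<cdot> k)) (push_unit H1 z A))"
    by (rule k.cod.iso_of_comp_left) (use one.conn_arr[OF k z(2)] A in simp_all)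
  then have iso: "is_iso (fib H2 Y) (fm (R Y) (fm (pull H1 (z \<cdot> k)) (push_unit H1 z A)))" by simp
  have nat: "nat_trans (fib H1 X) (fib H2 Y) (comp_fctr (pull H2 (z \<cdot> k)) (R X))
      (comp_fctr (R Y) (pull H1 (z \<cdot> k))) \<phi>" if "compat (z \<cdot> k) \<phi>" for \<phi>
    using compat_pull_natural[OF that] zk by (simp add: pull_natural_def Hom_def)
  show ?thesis
    using agree_along[OF z.left.dom.category_axioms RY.D.category_axioms nat[OF \<phi>] nat[OF \<psi>],
        of "push_unit H1 z A"] iso A eq by simp
qed

end

section \<open>Cocycle and exchange conditions for mates\<close>

text \<open>Converts the cocycle condition on the inverses of \<open>\<omega>\<close> into one without inverses.\<close>

lemma (in category) inverse_square_iff: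
  assumes a: "is_iso C a" and b: "is_iso C b" and w: "is_iso C w"
    and x: "x \<in> Arr C" "Dom C x = Dom C w" "Cod C x = Dom C b"
    and y: "y \<in> Arr C" "Dom C y = Cod C w" "Cod C y = Cod C a" and ab: "Cod C b = Dom C a"
  shows "x \<cdot> inv_arr C w = inv_arr C b \<cdot> inv_arr C a \<cdot> y \<longleftrightarrow> a \<cdot> b \<cdot> x = y \<cdot> w"
proof
  note [simp] = iso_arr[OF a] iso_arr[OF b] iso_arr[OF w]
  assume eq: "x \<cdot> inv_arr C w = inv_arr C b \<cdot> inv_arr C a \<cdot> y"
  have "a \<cdot> b \<cdot> x = a \<cdot> b \<cdot> (x \<cdot> inv_arr C w) \<cdot> w" using assms by simp
  also have "\<dots> = y \<cdot> w" unfolding eq using assms by simp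
  finally show "a \<cdot> b \<cdot> x = y \<cdot> w" .
next
  note [simp] = iso_arr[OF a] iso_arr[OF b] iso_arr[OF w]
  assume eq: "a \<cdot> b \<cdot> x = y \<cdot> w"
  have "x \<cdot> inv_arr C w = inv_arr C b \<cdot> inv_arr C a \<cdot> (a \<cdot> b \<cdot> x) \<cdot> inv_arr C w"
    using assms by simp
  also have "\<dots> = inv_arr C b \<cdot> inv_arr C a \<cdot> y" unfolding eq using assms by simp
  finally show "x \<cdot> inv_arr C w = inv_arr C b \<cdot> inv_arr C a \<cdot> y" .
qed

context tri_fibered_category
begin

lemma conn_inv_natural:
  assumes f: "f \<in> Hom S Y X" and g: "g \<in> Hom S X V" and \<phi>: "\<phi> \<in> Arr (fib H V)" "Cod (fib H V) \<phi> = B"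
  shows "inv_arr (fib H Y) (conn H f g B) \<cdot>\<^bsub>fib H Y\<^esub> fm (pull H f) (fm (pull H g) \<phi>)
    = fm (pull H (g \<cdot> f)) \<phi> \<cdot>\<^bsub>fib H Y\<^esub> inv_arr (fib H Y) (conn H f g (Dom (fib H V) \<phi>))"
proof -
  interpret f: cat_functor "fib H X" "fib H Y" "pull H f" using pull_functor f .
  interpret g: cat_functor "fib H V" "fib H X" "pull H g" using pull_functor g .
  interpret gf: cat_functor "fib H V" "fib H Y" "pull H (g \<cdot> f)" using pull_functor Comp_in f g by blast
  note [simp] = conn_arr[OF f g]
  let ?A = "Dom (fib H V) \<phi>" and ?i = "\<lambda>A. inv_arr (fib H Y) (conn H f g A)"
  have B: "B \<in> Ob (fib H V)" using \<phi> by auto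
  have "?i B \<cdot>\<^bsub>fib H Y\<^esub> fm (pull H f) (fm (pull H g) \<phi>) = ?i B \<cdot>\<^bsub>fib H Y\<^esub>
      ((fm (pull H f) (fm (pull H g) \<phi>) \<cdot>\<^bsub>fib H Y\<^esub> conn H f g ?A) \<cdot>\<^bsub>fib H Y\<^esub> ?i ?A)"
    using \<phi> B by simp
  also have "\<dots> = ?i B \<cdot>\<^bsub>fib H Y\<^esub>
      ((conn H f g B \<cdot>\<^bsub>fib H Y\<^esub> fm (pull H (g \<cdot> f)) \<phi>) \<cdot>\<^bsub>fib H Y\<^esub> ?i ?A)"
    using conn_natural[OF f g \<phi>] by simp
  also have "\<dots> = fm (pull H (g \<cdot> f)) \<phi> \<cdot>\<^bsub>fib H Y\<^esub> ?i ?A" using \<phi> B by simp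
  finally show ?thesis .
qed

lemma exchange_natural:
  assumes a: "a \<in> Hom S Y X" and b: "b \<in> Hom S X V" and c: "c \<in> Hom S Y X'" and d: "d \<in> Hom S X' V"
    and eq: "b \<cdot> a = d \<cdot> c" and \<phi>: "\<phi> \<in> Arr (fib H V)" "Cod (fib H V) \<phi> = B"
  shows "exchange S H a b c d B \<cdot>\<^bsub>fib H Y\<^esub> fm (pull H a) (fm (pull H b) \<phi>)
    = fm (pull H c) (fm (pull H d) \<phi>) \<cdot>\<^bsub>fib H Y\<^esub> exchange S H a b c d (Dom (fib H V) \<phi>)"
proof -
  have da: "Dom S a = Y" using a by (simp add: Hom_def)
  interpret a: cat_functor "fib H X" "fib H Y" "pull H a" using pull_functor a .
  interpret b: cat_functor "fib H V" "fib H X" "pull H b" using pull_functor b .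
  interpret c: cat_functor "fib H X'" "fib H Y" "pull H c" using pull_functor c .
  interpret d: cat_functor "fib H V" "fib H X'" "pull H d" using pull_functor d .
  interpret ba: cat_functor "fib H V" "fib H Y" "pull H (b \<cdot> a)" using pull_functor Comp_in a b by blast
  note [simp] = conn_arr[OF a b] conn_arr[OF c d, folded eq]
  have B: "B \<in> Ob (fib H V)" using \<phi> by auto
  have "exchange S H a b c d B \<cdot>\<^bsub>fib H Y\<^esub> fm (pull H a) (fm (pull H b) \<phi>)
      = conn H c d B \<cdot>\<^bsub>fib H Y\<^esub> (fm (pull H (b \<cdot> a)) \<phi>
        \<cdot>\<^bsub>fib H Y\<^esub> inv_arr (fib H Y) (conn H a b (Dom (fib H V) \<phi>)))"
    using conn_inv_natural[OF a b \<phi>] \<phi> B by (simp add: exchange_def da)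
  also have "\<dots> = fm (pull H c) (fm (pull H d) \<phi>) \<cdot>\<^bsub>fib H Y\<^esub> exchange S H a b c d (Dom (fib H V) \<phi>)"
    unfolding exchange_def da
    by (rule a.cod.subst_comp2) (use conn_natural[OF c d \<phi>, folded eq] \<phi> B in simp_all)
  finally show ?thesis .
qed

end

context localic_pair
begin

lemma matedD:
  "\<lbrakk>mated z \<alpha> \<omega>; z \<in> Hom S Z X; B \<in> Ob (fib H1 Z)\<rbrakk> \<Longrightarrow>
    push_counit H2 z (fo (R Z) B) \<cdot>\<^bsub>fib H2 Z\<^esub> fm (pull H2 z) (\<omega> B) =
    fm (R Z) (push_counit H1 z B) \<cdot>\<^bsub>fib H2 Z\<^esub> \<alpha> (fo (push H1 z) B)"
  by (auto simp: mated_def Hom_def)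

lemma push_natural_arr:
  assumes "push_natural z \<omega>" "z \<in> Hom S Z X" "B \<in> Ob (fib H1 Z)"
  shows "\<omega> B \<in> Arr (fib H2 X)" "Dom (fib H2 X) (\<omega> B) = fo (R X) (fo (push H1 z) B)"
    "Cod (fib H2 X) (\<omega> B) = fo (push H2 z) (fo (R Z) B)"
  using assms nat_trans_arr[of "fib H1 Z" "fib H2 X" "comp_fctr (R X) (push H1 z)"
      "comp_fctr (push H2 z) (R Z)" \<omega> B]
  by (auto simp: push_natural_def Hom_def)

lemma star_unfold:
  assumes f: "f \<in> Hom S Y X" and g: "g \<in> Hom S X V" and \<alpha>: "compat f \<alpha>" and \<beta>: "compat g \<beta>"
    and A: "A \<in> Ob (fib H1 V)"
  shows "\<alpha> (fo (pull H1 g) A) \<cdot>\<^bsub>fib H2 Y\<^esub> fm (pull H2 f) (\<beta> A) =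
    fm (R Y) (conn H1 f g A) \<cdot>\<^bsub>fib H2 Y\<^esub> star f \<alpha> g \<beta> A
      \<cdot>\<^bsub>fib H2 Y\<^esub> inv_arr (fib H2 Y) (conn H2 f g (fo (R V) A))"
proof -
  interpret RY: shift_compatible_functor "fib H1 Y" "fib H2 Y" "R Y" using R_shift Hom_ob f by blast
  interpret RV: shift_compatible_functor "fib H1 V" "fib H2 V" "R V" using R_shift Hom_ob g by blast
  interpret f2: shift_compatible_functor "fib H2 X" "fib H2 Y" "pull H2 f" using pull2_shift f .
  interpret g1: shift_compatible_functor "fib H1 V" "fib H1 X" "pull H1 g" using pull1_shift g .
  note [simp] = one.conn_arr[OF f g A] two.conn_arr[OF f g] compat_arr[OF f \<alpha>] compat_arr[OF g \<beta>]
    star_arr(1-3)[OF f g \<alpha> \<beta> A]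
  let ?k = "inv_arr (fib H2 Y) (conn H2 f g (fo (R V) A))"
  have "fm (R Y) (conn H1 f g A) \<cdot>\<^bsub>fib H2 Y\<^esub> star f \<alpha> g \<beta> A \<cdot>\<^bsub>fib H2 Y\<^esub> ?k
      = (fm (R Y) (conn H1 f g A) \<cdot>\<^bsub>fib H2 Y\<^esub> star f \<alpha> g \<beta> A) \<cdot>\<^bsub>fib H2 Y\<^esub> ?k"
    using A by simp
  also have "\<dots> = \<alpha> (fo (pull H1 g) A) \<cdot>\<^bsub>fib H2 Y\<^esub> fm (pull H2 f) (\<beta> A)"
    unfolding conn_star[OF f g \<alpha> \<beta> A] using A by simp
  finally show ?thesis by simp
qed

text \<open>Multiplicativity of \<open>\<alpha>\<close> for composites of closed immersions against the cocycle condition for \<open>\<omega>\<close>. Transposing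
  the latter at \<open>B\<close> along \<open>y\<close> and then along \<open>z\<close> turns it into the former at \<open>(y \<cdot> z)\<^sub>* B\<close>, composed with
  isomorphisms on both sides.\<close>

lemma push_cocycle_iff:
  assumes z: "z \<in> Cl S" "z \<in> Hom S Z Y" and y: "y \<in> Cl S" "y \<in> Hom S Y X"
    and \<alpha>z: "compat z \<alpha>z" and \<alpha>y: "compat y \<alpha>y" and \<alpha>: "compat (y \<cdot> z) \<alpha>"
    and \<omega>z: "push_compat z \<omega>z" and \<omega>y: "push_compat y \<omega>y" and \<omega>: "push_compat (y \<cdot> z) \<omega>"
    and mz: "mated z \<alpha>z \<omega>z" and my: "mated y \<alpha>y \<omega>y" and m: "mated (y \<cdot> z) \<alpha> \<omega>"
  shows "(\<forall>A \<in> Ob (fib H1 X). \<alpha> A = star z \<alpha>z y \<alpha>y A) \<longleftrightarrow>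
    (\<forall>B \<in> Ob (fib H1 Z). fm (R X) (push_conn S H1 y z B) \<cdot>\<^bsub>fib H2 X\<^esub> inv_arr (fib H2 X) (\<omega> B) =
      inv_arr (fib H2 X) (\<omega>y (fo (push H1 z) B)) \<cdot>\<^bsub>fib H2 X\<^esub>
      fm (push H2 y) (inv_arr (fib H2 Y) (\<omega>z B)) \<cdot>\<^bsub>fib H2 X\<^esub> push_conn S H2 y z (fo (R Z) B))"
    (is "_ \<longleftrightarrow> (\<forall>B \<in> Ob (fib H1 Z). ?c B)")
proof -
  have dc: "Dom S z = Z" "Cod S z = Y" "Dom S y = Y" "Cod S y = X" using z y by (auto simp: Hom_def)
  have yz: "y \<cdot> z \<in> Cl S" "y \<cdot> z \<in> Hom S Z X" using Cl_Comp[of z y] z y Comp_in dc by auto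
  have ob: "X \<in> Ob S" "Y \<in> Ob S" "Z \<in> Ob S" using z y Hom_ob by auto
  interpret RX: shift_compatible_functor "fib H1 X" "fib H2 X" "R X" using R_shift ob by blast
  interpret RY: shift_compatible_functor "fib H1 Y" "fib H2 Y" "R Y" using R_shift ob by blast
  interpret RZ: shift_compatible_functor "fib H1 Z" "fib H2 Z" "R Z" using R_shift ob by blast
  interpret z1: adjunction "fib H1 Y" "fib H1 Z" "pull H1 z" "push H1 z" "push_unit H1 z" "push_counit H1 z"
    using one.push_adj z .
  interpret y1: adjunction "fib H1 X" "fib H1 Y" "pull H1 y" "push H1 y" "push_unit H1 y" "push_counit H1 y"
    using one.push_adj y .
  interpret yz1: adjunction "fib H1 X" "fib H1 Z" "pull H1 (y \<cdot> z)" "push H1 (y \<cdot> z)"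
    "push_unit H1 (y \<cdot> z)" "push_counit H1 (y \<cdot> z)"
    using one.push_adj yz .
  interpret z2: adjunction "fib H2 Y" "fib H2 Z" "pull H2 z" "push H2 z" "push_unit H2 z" "push_counit H2 z"
    using two.push_adj z .
  interpret y2: adjunction "fib H2 X" "fib H2 Y" "pull H2 y" "push H2 y" "push_unit H2 y" "push_counit H2 y"
    using two.push_adj y .
  interpret yz2: adjunction "fib H2 X" "fib H2 Z" "pull H2 (y \<cdot> z)" "push H2 (y \<cdot> z)"
    "push_unit H2 (y \<cdot> z)" "push_counit H2 (y \<cdot> z)"
    using two.push_adj yz .
  have push_iso: "is_iso (fib H2 Y) (\<omega>z B)" "is_iso (fib H2 X) (\<omega> B)" if "B \<in> Ob (fib H1 Z)" for B
    using \<omega>z \<omega> yz z that by (auto simp: push_compat_def tri_nat_iso_def nat_iso_def Hom_def)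
  have push_iso_y: "is_iso (fib H2 X) (\<omega>y B)" if "B \<in> Ob (fib H1 Y)" for B
    using \<omega>y y that by (auto simp: push_compat_def tri_nat_iso_def nat_iso_def Hom_def)
  note [simp] = one.conn_arr[OF z(2) y(2)] two.conn_arr[OF z(2) y(2)]
    compat_arr[OF z(2) \<alpha>z] compat_arr[OF y(2) \<alpha>y] compat_arr[OF yz(2) \<alpha>]
    push_natural_arr[OF push_compat_push_natural[OF \<omega>z] z(2)]
    push_natural_arr[OF push_compat_push_natural[OF \<omega>y] y(2)]
    push_natural_arr[OF push_compat_push_natural[OF \<omega>] yz(2)]
    push_iso push_iso_y
    one.transpose_push_conn(2-4)[OF z y] two.transpose_push_conn(2-4)[OF z y]
    star_arr(1-3)[OF z(2) y(2) \<alpha>z \<alpha>y]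
  have at_right: "?c B \<longleftrightarrow> \<alpha> (fo (push H1 (y \<cdot> z)) B) = star z \<alpha>z y \<alpha>y (fo (push H1 (y \<cdot> z)) B)"
    if B: "B \<in> Ob (fib H1 Z)" for B
  proof -
    let ?Z = "fib H2 Z" and ?P = "fo (push H1 (y \<cdot> z)) B"
    let ?E = "fm (R Z) (push_counit H1 (y \<cdot> z) B)" and ?J = "inv_arr (fib H2 Z) (conn H2 z y (fo (R X) ?P))"
    let ?pc1 = "push_conn S H1 y z B" and ?pc2 = "push_conn S H2 y z (fo (R Z) B)"
    let ?l = "?pc2 \<cdot>\<^bsub>fib H2 X\<^esub> \<omega> B"
      and ?r = "fm (push H2 y) (\<omega>z B) \<cdot>\<^bsub>fib H2 X\<^esub> \<omega>y (fo (push H1 z) B) \<cdot>\<^bsub>fib H2 X\<^esub> fm (R X) ?pc1"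
    let ?T = "\<lambda>\<phi>. push_counit H2 z (fo (R Z) B) \<cdot>\<^bsub>?Z\<^esub> fm (pull H2 z)
        (push_counit H2 y (fo (push H2 z) (fo (R Z) B)) \<cdot>\<^bsub>fib H2 Y\<^esub> fm (pull H2 y) \<phi>)"
    have l: "?T ?l = ?E \<cdot>\<^bsub>?Z\<^esub> \<alpha> ?P \<cdot>\<^bsub>?Z\<^esub> ?J"
    proof -
      have "?T ?l = ?T ?pc2 \<cdot>\<^bsub>?Z\<^esub> fm (pull H2 z) (fm (pull H2 y) (\<omega> B))"
        using B by (simp add: y2.left.fm_comp z2.left.fm_comp)
      also have "\<dots> = push_counit H2 (y \<cdot> z) (fo (R Z) B) \<cdot>\<^bsub>?Z\<^esub>
          (inv_arr ?Z (conn H2 z y (fo (push H2 (y \<cdot> z)) (fo (R Z) B)))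
            \<cdot>\<^bsub>?Z\<^esub> fm (pull H2 z) (fm (pull H2 y) (\<omega> B)))"
        using two.transpose_push_conn(1)[OF z y, of "fo (R Z) B"] B by simp
      also have "\<dots> = push_counit H2 (y \<cdot> z) (fo (R Z) B) \<cdot>\<^bsub>?Z\<^esub> (fm (pull H2 (y \<cdot> z)) (\<omega> B) \<cdot>\<^bsub>?Z\<^esub> ?J)"
        using two.conn_inv_natural[OF z(2) y(2), of "\<omega> B"] B by simp
      also have "\<dots> = ?E \<cdot>\<^bsub>?Z\<^esub> (\<alpha> ?P \<cdot>\<^bsub>?Z\<^esub> ?J)"
        by (rule RZ.D.subst_comp2) (use matedD[OF m yz(2) B] B in simp_all)
      finally show ?thesis .
    qed
    have r: "?T ?r = ?E \<cdot>\<^bsub>?Z\<^esub> star z \<alpha>z y \<alpha>y ?P \<cdot>\<^bsub>?Z\<^esub> ?J"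
    proof -
      let ?zB = "fo (push H1 z) B"
      let ?k = "push_counit H1 y ?zB \<cdot>\<^bsub>fib H1 Y\<^esub> fm (pull H1 y) ?pc1"
      have "push_counit H2 y (fo (push H2 z) (fo (R Z) B)) \<cdot>\<^bsub>fib H2 Y\<^esub> fm (pull H2 y) ?r
        = \<omega>z B \<cdot>\<^bsub>fib H2 Y\<^esub> (push_counit H2 y (fo (R Y) ?zB) \<cdot>\<^bsub>fib H2 Y\<^esub>
            (fm (pull H2 y) (\<omega>y ?zB) \<cdot>\<^bsub>fib H2 Y\<^esub> fm (pull H2 y) (fm (R X) ?pc1)))"
        using B by (simp add: y2.left.fm_comp y2.counit_natural_comp)
      also have "push_counit H2 y (fo (R Y) ?zB) \<cdot>\<^bsub>fib H2 Y\<^esub>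
            (fm (pull H2 y) (\<omega>y ?zB) \<cdot>\<^bsub>fib H2 Y\<^esub> fm (pull H2 y) (fm (R X) ?pc1))
        = fm (R Y) (push_counit H1 y ?zB) \<cdot>\<^bsub>fib H2 Y\<^esub> (\<alpha>y (fo (push H1 y) ?zB)
            \<cdot>\<^bsub>fib H2 Y\<^esub> fm (pull H2 y) (fm (R X) ?pc1))"
        by (rule RY.D.subst_comp2) (use matedD[OF my y(2), of ?zB] B in simp_all)
      also have "\<dots> = fm (R Y) ?k \<cdot>\<^bsub>fib H2 Y\<^esub> \<alpha>y ?P"
        using compat_natural[OF y(2) \<alpha>y, of ?pc1] B by (simp add: RY.fm_comp)
      finally have "?T ?r = push_counit H2 z (fo (R Z) B) \<cdot>\<^bsub>?Z\<^esub> (fm (pull H2 z) (\<omega>z B)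
          \<cdot>\<^bsub>?Z\<^esub> (fm (pull H2 z) (fm (R Y) ?k) \<cdot>\<^bsub>?Z\<^esub> fm (pull H2 z) (\<alpha>y ?P)))"
        using B by (simp add: z2.left.fm_comp)
      also have "\<dots> = fm (R Z) (push_counit H1 z B) \<cdot>\<^bsub>?Z\<^esub> (\<alpha>z ?zB
          \<cdot>\<^bsub>?Z\<^esub> (fm (pull H2 z) (fm (R Y) ?k) \<cdot>\<^bsub>?Z\<^esub> fm (pull H2 z) (\<alpha>y ?P)))"
        by (rule RZ.D.subst_comp2) (use matedD[OF mz z(2) B] B in simp_all)
      also have "\<alpha>z ?zB \<cdot>\<^bsub>?Z\<^esub> (fm (pull H2 z) (fm (R Y) ?k) \<cdot>\<^bsub>?Z\<^esub> fm (pull H2 z) (\<alpha>y ?P))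
        = fm (R Z) (fm (pull H1 z) ?k) \<cdot>\<^bsub>?Z\<^esub> (\<alpha>z (fo (pull H1 y) ?P) \<cdot>\<^bsub>?Z\<^esub> fm (pull H2 z) (\<alpha>y ?P))"
        by (rule RZ.D.subst_comp2) (use compat_natural[OF z(2) \<alpha>z, of ?k] B in simp_all)
      also have "fm (R Z) (push_counit H1 z B) \<cdot>\<^bsub>?Z\<^esub> \<dots>
        = fm (R Z) (push_counit H1 z B \<cdot>\<^bsub>fib H1 Z\<^esub> fm (pull H1 z) ?k)
          \<cdot>\<^bsub>?Z\<^esub> (\<alpha>z (fo (pull H1 y) ?P) \<cdot>\<^bsub>?Z\<^esub> fm (pull H2 z) (\<alpha>y ?P))"
        by (rule RZ.D.subst_comp) (use B in \<open>simp_all add: RZ.fm_comp\<close>)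
      also have "push_counit H1 z B \<cdot>\<^bsub>fib H1 Z\<^esub> fm (pull H1 z) ?k
        = push_counit H1 (y \<cdot> z) B \<cdot>\<^bsub>fib H1 Z\<^esub> inv_arr (fib H1 Z) (conn H1 z y ?P)"
        using one.transpose_push_conn(1)[OF z y B] .
      also have "\<alpha>z (fo (pull H1 y) ?P) \<cdot>\<^bsub>?Z\<^esub> fm (pull H2 z) (\<alpha>y ?P)
        = fm (R Z) (conn H1 z y ?P) \<cdot>\<^bsub>?Z\<^esub> star z \<alpha>z y \<alpha>y ?P \<cdot>\<^bsub>?Z\<^esub> ?J"
        using star_unfold[OF z(2) y(2) \<alpha>z \<alpha>y] B by simp
      also have "fm (R Z) (push_counit H1 (y \<cdot> z) B \<cdot>\<^bsub>fib H1 Z\<^esub> inv_arr (fib H1 Z) (conn H1 z y ?P))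
          \<cdot>\<^bsub>?Z\<^esub> \<dots> = ?E \<cdot>\<^bsub>?Z\<^esub> star z \<alpha>z y \<alpha>y ?P \<cdot>\<^bsub>?Z\<^esub> ?J"
        using B by (simp add: RZ.fm_comp RZ.inv_arr_fm[symmetric])
      finally show ?thesis .
    qed
    have T_inj: "\<phi> = \<psi>" if "?T \<phi> = ?T \<psi>" and "\<phi> \<in> Arr (fib H2 X)" "\<psi> \<in> Arr (fib H2 X)"
      "Dom (fib H2 X) \<phi> = Dom (fib H2 X) \<psi>"
      "Cod (fib H2 X) \<phi> = fo (push H2 y) (fo (push H2 z) (fo (R Z) B))"
      "Cod (fib H2 X) \<psi> = fo (push H2 y) (fo (push H2 z) (fo (R Z) B))" for \<phi> \<psi>
    proof (rule y2.transpose_inj[of \<phi> \<psi> "fo (push H2 z) (fo (R Z) B)"])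
      show "push_counit H2 y (fo (push H2 z) (fo (R Z) B)) \<cdot>\<^bsub>fib H2 Y\<^esub> fm (pull H2 y) \<phi>
          = push_counit H2 y (fo (push H2 z) (fo (R Z) B)) \<cdot>\<^bsub>fib H2 Y\<^esub> fm (pull H2 y) \<psi>"
        by (rule z2.transpose_inj[OF _ _ _ _ _ _ that(1)]) (use that(2-) B in simp_all)
    qed (use that(2-) B in simp_all)
    have E: "is_iso ?Z ?E" using one.push_counit_iso[OF yz B] by simp
    have "?c B \<longleftrightarrow> ?r = ?l"
      using RX.D.inverse_square_iff[of "fm (push H2 y) (\<omega>z B)" "\<omega>y (fo (push H1 z) B)" "\<omega> B"
          "fm (R X) ?pc1" ?pc2] B
      by (simp add: y2.right.inv_arr_fm[symmetric])
    also have "\<dots> \<longleftrightarrow> ?T ?r = ?T ?l"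
      using T_inj[of ?r ?l] B by auto
    also have "\<dots> \<longleftrightarrow> ?E \<cdot>\<^bsub>?Z\<^esub> \<alpha> ?P \<cdot>\<^bsub>?Z\<^esub> ?J = ?E \<cdot>\<^bsub>?Z\<^esub> star z \<alpha>z y \<alpha>y ?P \<cdot>\<^bsub>?Z\<^esub> ?J"
      unfolding l r by auto
    also have "\<dots> \<longleftrightarrow> \<alpha> ?P = star z \<alpha>z y \<alpha>y ?P"
    proof
      assume eq: "?E \<cdot>\<^bsub>?Z\<^esub> \<alpha> ?P \<cdot>\<^bsub>?Z\<^esub> ?J = ?E \<cdot>\<^bsub>?Z\<^esub> star z \<alpha>z y \<alpha>y ?P \<cdot>\<^bsub>?Z\<^esub> ?J"
      have "\<alpha> ?P \<cdot>\<^bsub>?Z\<^esub> ?J = star z \<alpha>z y \<alpha>y ?P \<cdot>\<^bsub>?Z\<^esub> ?J"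
        by (rule RZ.D.iso_cancel_left[OF E _ _ _ _ eq]) (use B in simp_all)
      then show "\<alpha> ?P = star z \<alpha>z y \<alpha>y ?P"
        by (rule RZ.D.iso_cancel_right[rotated -1]) (use B in simp_all)
    qed simp
    finally show ?thesis .
  qed
  have "\<forall>A \<in> Ob (fib H1 X). \<alpha> A = star z \<alpha>z y \<alpha>y A"
    if eq: "\<And>B. B \<in> Ob (fib H1 Z) \<Longrightarrow>
      \<alpha> (fo (push H1 (y \<cdot> z)) B) = star z \<alpha>z y \<alpha>y (fo (push H1 (y \<cdot> z)) B)"
  proof
    fix A assume A: "A \<in> Ob (fib H1 X)"
    have i: "Ide S Z \<in> Hom S Z Z" "(y \<cdot> z) \<cdot> Ide S Z = y \<cdot> z"
      using Ide_in[OF ob(3)] Comp_Ide_right[OF yz(2)] by auto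
    show "\<alpha> A = star z \<alpha>z y \<alpha>y A"
      by (rule compat_agree[OF yz i(1)]) (use i(2) \<alpha> star_compat[OF z(2) y(2) \<alpha>z \<alpha>y] eq A in simp_all)
  qed
  then show ?thesis using at_right yz1.right.fo_ob by metis
qed

text \<open>The condition \<open>core_C\<close> on \<open>\<omega>\<close>, transposed along \<open>z'\<close>, says that the two products over the diagonal of the
  Cartesian square agree at \<open>z\<^sub>* B\<close>; the diagonal factors through \<open>z\<close>, so they agree everywhere.\<close>

lemma cross_iff:
  assumes p: "p \<in> Hom S P X" and z: "z \<in> Cl S" "z \<in> Hom S Z X" and p': "p' \<in> Hom S V Z"
    and z': "z' \<in> Cl S" "z' \<in> Hom S V P" and eq: "p \<cdot> z' = z \<cdot> p'"
    and \<tau>: "compat p \<tau>" and \<tau>': "compat p' \<tau>'" and \<alpha>: "compat z \<alpha>" and \<alpha>': "compat z' \<alpha>'"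
    and \<omega>: "push_natural z \<omega>" and \<omega>': "push_natural z' \<omega>'"
    and m: "mated z \<alpha> \<omega>" and m': "mated z' \<alpha>' \<omega>'"
  shows "(\<forall>A \<in> Ob (fib H1 X). star z' \<alpha>' p \<tau> A = star p' \<tau>' z \<alpha> A) \<longleftrightarrow>
    (\<forall>B \<in> Ob (fib H1 Z). fm (push H2 z') (\<tau>' B) \<cdot>\<^bsub>fib H2 P\<^esub>
        push_base_change S H2 p z p' z' (fo (R Z) B) \<cdot>\<^bsub>fib H2 P\<^esub> fm (pull H2 p) (\<omega> B) =
      \<omega>' (fo (pull H1 p') B) \<cdot>\<^bsub>fib H2 P\<^esub>
        fm (R P) (push_base_change S H1 p z p' z' B) \<cdot>\<^bsub>fib H2 P\<^esub> \<tau> (fo (push H1 z) B))"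
    (is "_ \<longleftrightarrow> (\<forall>B \<in> Ob (fib H1 Z). ?l B = ?r B)")
proof -
  have ob: "X \<in> Ob S" "P \<in> Ob S" "Z \<in> Ob S" "V \<in> Ob S" using p z z' Hom_ob by auto
  have zp: "z \<cdot> p' \<in> Hom S V X" using Comp_in p' z by blast
  have dz': "Dom S z' = V" using z' by (simp add: Hom_def)
  interpret RX: shift_compatible_functor "fib H1 X" "fib H2 X" "R X" using R_shift ob by blast
  interpret RP: shift_compatible_functor "fib H1 P" "fib H2 P" "R P" using R_shift ob by blast
  interpret RZ: shift_compatible_functor "fib H1 Z" "fib H2 Z" "R Z" using R_shift ob by blast
  interpret RV: shift_compatible_functor "fib H1 V" "fib H2 V" "R V" using R_shift ob by blast
  interpret z1: adjunction "fib H1 X" "fib H1 Z" "pull H1 z" "push H1 z" "push_unit H1 z" "push_counit H1 z"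
    using one.push_adj z .
  interpret z1': adjunction "fib H1 P" "fib H1 V" "pull H1 z'" "push H1 z'" "push_unit H1 z'" "push_counit H1 z'"
    using one.push_adj z' .
  interpret z2: adjunction "fib H2 X" "fib H2 Z" "pull H2 z" "push H2 z" "push_unit H2 z" "push_counit H2 z"
    using two.push_adj z .
  interpret z2': adjunction "fib H2 P" "fib H2 V" "pull H2 z'" "push H2 z'" "push_unit H2 z'" "push_counit H2 z'"
    using two.push_adj z' .
  interpret p1: shift_compatible_functor "fib H1 X" "fib H1 P" "pull H1 p" using pull1_shift p .
  interpret p2: shift_compatible_functor "fib H2 X" "fib H2 P" "pull H2 p" using pull2_shift p .
  interpret p1': shift_compatible_functor "fib H1 Z" "fib H1 V" "pull H1 p'" using pull1_shift p' .
  interpret p2': shift_compatible_functor "fib H2 Z" "fib H2 V" "pull H2 p'" using pull2_shift p' .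
  interpret zp1: shift_compatible_functor "fib H1 X" "fib H1 V" "pull H1 (z \<cdot> p')" using pull1_shift zp .
  interpret zp2: shift_compatible_functor "fib H2 X" "fib H2 V" "pull H2 (z \<cdot> p')" using pull2_shift zp .
  note [simp] = one.conn_arr[OF z'(2) p, unfolded eq] two.conn_arr[OF z'(2) p, unfolded eq]
    one.conn_arr[OF p' z(2)] two.conn_arr[OF p' z(2)]
    one.exchange_arr[OF z'(2) p p' z(2) eq] two.exchange_arr[OF z'(2) p p' z(2) eq]
    compat_arr[OF p \<tau>] compat_arr[OF p' \<tau>'] compat_arr[OF z(2) \<alpha>] compat_arr[OF z'(2) \<alpha>']
    push_natural_arr[OF \<omega> z(2)] push_natural_arr[OF \<omega>' z'(2)]
    one.transpose_push_base_change(2-4)[OF p z p' z' eq]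
    two.transpose_push_base_change(2-4)[OF p z p' z' eq]
    star_arr(1-3)[OF z'(2) p \<alpha>' \<tau>, unfolded eq] star_arr(1-3)[OF p' z(2) \<tau>' \<alpha>]
  have at_right: "?l B = ?r B \<longleftrightarrow>
      star z' \<alpha>' p \<tau> (fo (push H1 z) B) = star p' \<tau>' z \<alpha> (fo (push H1 z) B)"
    if B: "B \<in> Ob (fib H1 Z)" for B
  proof -
    let ?V = "fib H2 V" and ?zB = "fo (push H1 z) B"
    let ?\<epsilon> = "fm (R V) (fm (pull H1 p') (push_counit H1 z B))" and ?c = "fm (R V) (conn H1 p' z ?zB)"
    let ?J = "inv_arr ?V (conn H2 z' p (fo (R X) ?zB))"
    let ?ex1 = "exchange S H1 z' p p' z ?zB" and ?ex2 = "exchange S H2 z' p p' z (fo (R X) ?zB)"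
    let ?bc1 = "push_base_change S H1 p z p' z' B" and ?bc2 = "push_base_change S H2 p z p' z' (fo (R Z) B)"
    let ?T = "\<lambda>\<phi>. push_counit H2 z' (fo (R V) (fo (pull H1 p') B)) \<cdot>\<^bsub>?V\<^esub> fm (pull H2 z') \<phi>"
    have l: "?T (?l B) = ?\<epsilon> \<cdot>\<^bsub>?V\<^esub> ?c \<cdot>\<^bsub>?V\<^esub> star p' \<tau>' z \<alpha> ?zB \<cdot>\<^bsub>?V\<^esub> ?J"
    proof -
      have "?T (?l B) = \<tau>' B \<cdot>\<^bsub>?V\<^esub> (push_counit H2 z' (fo (pull H2 p') (fo (R Z) B)) \<cdot>\<^bsub>?V\<^esub>
          (fm (pull H2 z') ?bc2 \<cdot>\<^bsub>?V\<^esub> fm (pull H2 z') (fm (pull H2 p) (\<omega> B))))"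
        using B by (simp add: z2'.left.fm_comp z2'.counit_natural_comp)
      also have "push_counit H2 z' (fo (pull H2 p') (fo (R Z) B)) \<cdot>\<^bsub>?V\<^esub>
          (fm (pull H2 z') ?bc2 \<cdot>\<^bsub>?V\<^esub> fm (pull H2 z') (fm (pull H2 p) (\<omega> B)))
        = fm (pull H2 p') (push_counit H2 z (fo (R Z) B)) \<cdot>\<^bsub>?V\<^esub>
          (exchange S H2 z' p p' z (fo (push H2 z) (fo (R Z) B)) \<cdot>\<^bsub>?V\<^esub> fm (pull H2 z') (fm (pull H2 p) (\<omega> B)))"
        by (rule RV.D.subst_comp2[OF two.transpose_push_base_change(1)[OF p z p' z' eq]]) (use B in simp_all)
      also have "exchange S H2 z' p p' z (fo (push H2 z) (fo (R Z) B)) \<cdot>\<^bsub>?V\<^esub> fm (pull H2 z') (fm (pull H2 p) (\<omega> B))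
        = fm (pull H2 p') (fm (pull H2 z) (\<omega> B)) \<cdot>\<^bsub>?V\<^esub> ?ex2"
        using two.exchange_natural[OF z'(2) p p' z(2) eq, of "\<omega> B"] B by simp
      also have "fm (pull H2 p') (push_counit H2 z (fo (R Z) B)) \<cdot>\<^bsub>?V\<^esub> \<dots>
        = fm (pull H2 p') (fm (R Z) (push_counit H1 z B)) \<cdot>\<^bsub>?V\<^esub> (fm (pull H2 p') (\<alpha> ?zB) \<cdot>\<^bsub>?V\<^esub> ?ex2)"
        by (rule RV.D.subst_comp2) (use matedD[OF m z(2) B] B in \<open>simp_all flip: p2'.fm_comp\<close>)
      also have "\<tau>' B \<cdot>\<^bsub>?V\<^esub> \<dots> = ?\<epsilon> \<cdot>\<^bsub>?V\<^esub>
          (\<tau>' (fo (pull H1 z) ?zB) \<cdot>\<^bsub>?V\<^esub> (fm (pull H2 p') (\<alpha> ?zB) \<cdot>\<^bsub>?V\<^esub> ?ex2))"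
        by (rule RV.D.subst_comp2) (use compat_natural[OF p' \<tau>', of "push_counit H1 z B"] B in simp_all)
      also have "\<tau>' (fo (pull H1 z) ?zB) \<cdot>\<^bsub>?V\<^esub> (fm (pull H2 p') (\<alpha> ?zB) \<cdot>\<^bsub>?V\<^esub> ?ex2)
        = (?c \<cdot>\<^bsub>?V\<^esub> star p' \<tau>' z \<alpha> ?zB) \<cdot>\<^bsub>?V\<^esub> ?J"
        unfolding conn_star[OF p' z(2) \<tau>' \<alpha> z1.right.fo_ob[OF B]] using B
        by (simp add: exchange_def dz')
      finally show ?thesis using B by simp
    qed
    have r: "?T (?r B) = ?\<epsilon> \<cdot>\<^bsub>?V\<^esub> ?c \<cdot>\<^bsub>?V\<^esub> star z' \<alpha>' p \<tau> ?zB \<cdot>\<^bsub>?V\<^esub> ?J"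
    proof -
      let ?pB = "fo (pull H1 p') B"
      have "?T (?r B) = push_counit H2 z' (fo (R V) ?pB) \<cdot>\<^bsub>?V\<^esub> (fm (pull H2 z') (\<omega>' ?pB) \<cdot>\<^bsub>?V\<^esub>
          (fm (pull H2 z') (fm (R P) ?bc1) \<cdot>\<^bsub>?V\<^esub> fm (pull H2 z') (\<tau> ?zB)))"
        using B by (simp add: z2'.left.fm_comp)
      also have "\<dots> = fm (R V) (push_counit H1 z' ?pB) \<cdot>\<^bsub>?V\<^esub> (\<alpha>' (fo (push H1 z') ?pB) \<cdot>\<^bsub>?V\<^esub>
          (fm (pull H2 z') (fm (R P) ?bc1) \<cdot>\<^bsub>?V\<^esub> fm (pull H2 z') (\<tau> ?zB)))"
        by (rule RV.D.subst_comp2) (use matedD[OF m' z'(2), of ?pB] B in simp_all)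
      also have "\<alpha>' (fo (push H1 z') ?pB) \<cdot>\<^bsub>?V\<^esub>
          (fm (pull H2 z') (fm (R P) ?bc1) \<cdot>\<^bsub>?V\<^esub> fm (pull H2 z') (\<tau> ?zB))
        = fm (R V) (fm (pull H1 z') ?bc1) \<cdot>\<^bsub>?V\<^esub>
          (\<alpha>' (fo (pull H1 p) ?zB) \<cdot>\<^bsub>?V\<^esub> fm (pull H2 z') (\<tau> ?zB))"
        by (rule RV.D.subst_comp2) (use compat_natural[OF z'(2) \<alpha>', of ?bc1] B in simp_all)
      also have "fm (R V) (push_counit H1 z' ?pB) \<cdot>\<^bsub>?V\<^esub> \<dots>
        = fm (R V) (fm (pull H1 p') (push_counit H1 z B) \<cdot>\<^bsub>fib H1 V\<^esub> ?ex1) \<cdot>\<^bsub>?V\<^esub>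
          (\<alpha>' (fo (pull H1 p) ?zB) \<cdot>\<^bsub>?V\<^esub> fm (pull H2 z') (\<tau> ?zB))"
        unfolding one.transpose_push_base_change(1)[OF p z p' z' eq B, symmetric]
        by (rule RV.D.subst_comp) (use B in \<open>simp_all add: RV.fm_comp\<close>)
      also have "\<alpha>' (fo (pull H1 p) ?zB) \<cdot>\<^bsub>?V\<^esub> fm (pull H2 z') (\<tau> ?zB)
        = fm (R V) (conn H1 z' p ?zB) \<cdot>\<^bsub>?V\<^esub> star z' \<alpha>' p \<tau> ?zB \<cdot>\<^bsub>?V\<^esub> ?J"
        using star_unfold[OF z'(2) p \<alpha>' \<tau>] B by simp
      also have "fm (R V) (fm (pull H1 p') (push_counit H1 z B) \<cdot>\<^bsub>fib H1 V\<^esub> ?ex1) \<cdot>\<^bsub>?V\<^esub> \<dots>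
        = ?\<epsilon> \<cdot>\<^bsub>?V\<^esub> ?c \<cdot>\<^bsub>?V\<^esub> star z' \<alpha>' p \<tau> ?zB \<cdot>\<^bsub>?V\<^esub> ?J"
        using B by (simp add: exchange_def dz' RV.fm_comp RV.inv_arr_fm[symmetric])
      finally show ?thesis .
    qed
    show ?thesis
    proof
      assume "?l B = ?r B"
      then have e1: "?\<epsilon> \<cdot>\<^bsub>?V\<^esub> (?c \<cdot>\<^bsub>?V\<^esub> (star z' \<alpha>' p \<tau> ?zB \<cdot>\<^bsub>?V\<^esub> ?J))
          = ?\<epsilon> \<cdot>\<^bsub>?V\<^esub> (?c \<cdot>\<^bsub>?V\<^esub> (star p' \<tau>' z \<alpha> ?zB \<cdot>\<^bsub>?V\<^esub> ?J))" using l r by simp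
      have "is_iso ?V ?\<epsilon>" using one.push_counit_iso[OF z B] by simp
      then have e2: "?c \<cdot>\<^bsub>?V\<^esub> (star z' \<alpha>' p \<tau> ?zB \<cdot>\<^bsub>?V\<^esub> ?J) = ?c \<cdot>\<^bsub>?V\<^esub> (star p' \<tau>' z \<alpha> ?zB \<cdot>\<^bsub>?V\<^esub> ?J)"
        by (rule RV.D.iso_cancel_left[OF _ _ _ _ _ e1]) (use B in simp_all)
      have "star z' \<alpha>' p \<tau> ?zB \<cdot>\<^bsub>?V\<^esub> ?J = star p' \<tau>' z \<alpha> ?zB \<cdot>\<^bsub>?V\<^esub> ?J"
        by (rule RV.D.iso_cancel_left[OF _ _ _ _ _ e2]) (use B in simp_all)
      then show "star z' \<alpha>' p \<tau> ?zB = star p' \<tau>' z \<alpha> ?zB"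
        by (rule RV.D.iso_cancel_right[rotated -1]) (use B in simp_all)
    next
      assume "star z' \<alpha>' p \<tau> ?zB = star p' \<tau>' z \<alpha> ?zB"
      then have "?T (?l B) = ?T (?r B)" unfolding l r by simp
      then show "?l B = ?r B"
        by (rule z2'.transpose_inj[rotated -1]) (use B in simp_all)
    qed
  qed
  have "\<forall>A \<in> Ob (fib H1 X). star z' \<alpha>' p \<tau> A = star p' \<tau>' z \<alpha> A"
    if "\<And>B. B \<in> Ob (fib H1 Z) \<Longrightarrow>
      star z' \<alpha>' p \<tau> (fo (push H1 z) B) = star p' \<tau>' z \<alpha> (fo (push H1 z) B)"
    using compat_agree[OF z p' star_compat[OF z'(2) p \<alpha>' \<tau>, unfolded eq] star_compat[OF p' z(2) \<tau>' \<alpha>]]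
      that by blast
  then show ?thesis using at_right z1.right.fo_ob by meson
qed

end

section \<open>Gluing along factorizations\<close>

text \<open>The formal part of the argument. Elements of \<open>N f\<close> lie over the arrow \<open>f\<close>, and \<open>star\<close> is an associative
  product covering composition in \<open>S\<close>. Two multiplicative sections, over smooth morphisms and over closed
  immersions, are glued to a multiplicative section over all arrows.\<close>

locale crossed_sections = base_category S for S :: "('s, 'a, 'x) basecat_scheme" (structure) +
  fixes N :: "'a \<Rightarrow> 'e set"
    and star :: "'a \<Rightarrow> 'e \<Rightarrow> 'a \<Rightarrow> 'e \<Rightarrow> 'e"
    and sm cl :: "'a \<Rightarrow> 'e"
  assumes star_in: "\<lbrakk>f \<in> Arr S; g \<in> Arr S; Cod S f = Dom S g; \<alpha> \<in> N f; \<beta> \<in> N g\<rbrakk>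
      \<Longrightarrow> star f \<alpha> g \<beta> \<in> N (g \<cdot> f)"
    and star_assoc: "\<lbrakk>f \<in> Arr S; g \<in> Arr S; h \<in> Arr S; Cod S f = Dom S g; Cod S g = Dom S h;
        \<alpha> \<in> N f; \<beta> \<in> N g; \<gamma> \<in> N h\<rbrakk>
      \<Longrightarrow> star f \<alpha> (h \<cdot> g) (star g \<beta> h \<gamma>) = star (g \<cdot> f) (star f \<alpha> g \<beta>) h \<gamma>"
    and sm_in: "p \<in> Sm S \<Longrightarrow> sm p \<in> N p"
    and cl_in: "z \<in> Cl S \<Longrightarrow> cl z \<in> N z"
    and sm_comp: "\<lbrakk>p \<in> Sm S; q \<in> Sm S; Cod S p = Dom S q\<rbrakk> \<Longrightarrow> sm (q \<cdot> p) = star p (sm p) q (sm q)"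
    and cl_comp: "\<lbrakk>y \<in> Cl S; z \<in> Cl S; Cod S y = Dom S z\<rbrakk> \<Longrightarrow> cl (z \<cdot> y) = star y (cl y) z (cl z)"
    and sm_Ide_cl_Ide: "X \<in> Ob S \<Longrightarrow> sm (Ide S X) = cl (Ide S X)"
    and cross: "\<lbrakk>p \<in> Sm S; z \<in> Cl S; cartesian S p z p' z'\<rbrakk>
      \<Longrightarrow> star z' (cl z') p (sm p) = star p' (sm p') z (cl z)"
    and triangle: "\<lbrakk>p \<in> Sm S; p \<cdot> h \<in> Sm S; h \<in> Cl S; Cod S h = Dom S p\<rbrakk>
      \<Longrightarrow> sm (p \<cdot> h) = star h (cl h) p (sm p)"
begin

lemma Ide_Sm: "X \<in> Ob S \<Longrightarrow> Ide S X \<in> Sm S"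
  and Ide_Cl: "X \<in> Ob S \<Longrightarrow> Ide S X \<in> Cl S"
proof -
  assume X: "X \<in> Ob S"
  then have "inverse_arrows S (Ide S X) (Ide S X)"
    using Ide_in[OF X] Comp_Ide_left[OF Ide_in[OF X]] by (auto simp: inverse_arrows_def Hom_def)
  then have "is_iso S (Ide S X)" unfolding is_iso_def by blast
  then show "Ide S X \<in> Sm S" "Ide S X \<in> Cl S" using Sm_iso Cl_iso by auto
qed

text \<open>A smooth base change, completed by a map into the fibre product. The induced map is a closed
  immersion as soon as one of its components is, by cancellation.\<close>

lemma closed_into_pullback:
  assumes "p \<in> Sm S" "f \<in> Arr S" "Cod S f = Cod S p"
    and "a \<in> Arr S" "b \<in> Arr S" "Dom S a = Dom S b" "Cod S a = Dom S p" "Cod S b = Dom S f"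
    and "p \<cdot> a = f \<cdot> b" and cl: "a \<in> Cl S \<or> b \<in> Cl S"
  obtains p' f' m where "cartesian S p f p' f'" "p' \<in> Sm S" "m \<in> Cl S" "Dom S m = Dom S a"
    "Cod S m = Dom S p'" "f' \<cdot> m = a" "p' \<cdot> m = b" "p' \<in> Arr S" "f' \<in> Arr S" "Dom S f' = Dom S p'"
    "Cod S f' = Dom S p" "Cod S p' = Dom S f" "p \<cdot> f' = f \<cdot> p'"
proof -
  obtain p' f' where c: "cartesian S p f p' f'" using Sm_pullback_exists assms(1-3) by blast
  have pb: "p' \<in> Arr S" "f' \<in> Arr S" "Dom S f' = Dom S p'" "Cod S f' = Dom S p" "Cod S p' = Dom S f"
    "p \<cdot> f' = f \<cdot> p'"
    using c by (auto simp: cartesian_def)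
  have "Dom S a \<in> Ob S" using assms(4) Dom_in by blast
  moreover have "a \<in> Hom S (Dom S a) (Dom S p)" "b \<in> Hom S (Dom S a) (Dom S f)"
    using assms by (auto simp: Hom_def)
  ultimately obtain m where m: "m \<in> Hom S (Dom S a) (Dom S p')" "f' \<cdot> m = a" "p' \<cdot> m = b"
    using c \<open>p \<cdot> a = f \<cdot> b\<close> unfolding cartesian_def by metis
  then have m': "m \<in> Arr S" "Dom S m = Dom S a" "Cod S m = Dom S p'" by (auto simp: Hom_def)
  have "m \<in> Cl S" using cl Cl_cancel[of m f'] Cl_cancel[of m p'] m m' pb by auto
  with that c m m' pb Sm_base_change[OF assms(1) c] show ?thesis by blast
qed

text \<open>Factoring a closed immersion \<open>t\<close> through a smooth morphism \<open>p\<close>: the pullback of \<open>p\<close> along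
  \<open>t\<close> acquires a section, to which the triangle condition applies.\<close>

lemma cl_factor:
  assumes p: "p \<in> Sm S" and w: "w \<in> Cl S" and pw: "p \<cdot> w \<in> Cl S" and c: "Cod S w = Dom S p"
  shows "cl (p \<cdot> w) = star w (cl w) p (sm p)"
proof -
  let ?t = "p \<cdot> w" and ?T = "Dom S w"
  have arr: "p \<in> Arr S" "w \<in> Arr S" using p w Sm_Arr Cl_Arr by auto
  have T: "?T \<in> Ob S" using arr Dom_in by auto
  have t: "?t \<in> Hom S ?T (Cod S p)" using arr c Comp_in[of w] by (auto simp: Hom_def)
  then have t': "?t \<in> Arr S" "Dom S ?t = ?T" "Cod S ?t = Cod S p" by (auto simp: Hom_def)
  have i: "Ide S ?T \<in> Arr S" "Dom S (Ide S ?T) = ?T" "Cod S (Ide S ?T) = ?T"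
    using Ide_in[OF T] by (auto simp: Hom_def)
  have ti: "?t \<cdot> Ide S ?T = ?t" using Comp_Ide_right[OF t] .
  obtain p' t1 s where s: "cartesian S p ?t p' t1" "p' \<in> Sm S" "s \<in> Cl S" "Dom S s = ?T"
    "Cod S s = Dom S p'" "t1 \<cdot> s = w" "p' \<cdot> s = Ide S ?T" "p' \<in> Arr S" "t1 \<in> Arr S"
    "Dom S t1 = Dom S p'" "Cod S t1 = Dom S p" "Cod S p' = ?T" "p \<cdot> t1 = ?t \<cdot> p'"
    using closed_into_pullback[of p ?t w "Ide S ?T"] p arr t' i c w ti by metis
  have t1: "t1 \<in> Cl S" using Cl_base_change[OF p pw s(1)] .
  have sA: "s \<in> Arr S" using s(3) Cl_Arr by auto
  have "star w (cl w) p (sm p) = star (t1 \<cdot> s) (star s (cl s) t1 (cl t1)) p (sm p)"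
    using cl_comp[of s t1] s t1 by simp
  also have "\<dots> = star s (cl s) (p \<cdot> t1) (star t1 (cl t1) p (sm p))"
    using star_assoc[of s t1 p "cl s" "cl t1" "sm p"] s t1 sA arr p cl_in sm_in by simp
  also have "\<dots> = star s (cl s) (?t \<cdot> p') (star p' (sm p') ?t (cl ?t))"
    using cross[OF p pw s(1)] s(13) by simp
  also have "\<dots> = star (p' \<cdot> s) (star s (cl s) p' (sm p')) ?t (cl ?t)"
    using star_assoc[of s p' ?t "cl s" "sm p'" "cl ?t"] s sA t' pw cl_in sm_in by simp
  also have "star s (cl s) p' (sm p') = sm (Ide S ?T)"
    using triangle[of p' s] s Ide_Sm[OF T] by simp
  also have "\<dots> = cl (Ide S ?T)" using sm_Ide_cl_Ide[OF T] .
  also have "star (p' \<cdot> s) (cl (Ide S ?T)) ?t (cl ?t) = cl ?t"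
    using cl_comp[of "Ide S ?T" ?t] Ide_Cl[OF T] pw i t' s(7) ti by simp
  finally show ?thesis by simp
qed

text \<open>Two factorizations through \<open>p\<close> and \<open>q\<close> are compared with the one through the fibre product of \<open>p\<close> and \<open>q\<close>,
  whose closed part \<open>w\<close> refines both \<open>t\<close> and \<open>s\<close>.\<close>

lemma factorization_independent:
  assumes "p \<in> Sm S" "t \<in> Cl S" "Cod S t = Dom S p" "q \<in> Sm S" "s \<in> Cl S" "Cod S s = Dom S q"
    and eq: "p \<cdot> t = q \<cdot> s"
  shows "star t (cl t) p (sm p) = star s (cl s) q (sm q)"
proof -
  have arr: "p \<in> Arr S" "t \<in> Arr S" "q \<in> Arr S" "s \<in> Arr S" using assms Sm_Arr Cl_Arr by auto
  then have dc: "Dom S t = Dom S s" "Cod S q = Cod S p"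
    using comp_arr(2,3)[of t p] comp_arr(2,3)[of s q] assms(3,6) eq by metis+
  obtain a b w where w: "cartesian S p q a b" "a \<in> Sm S" "w \<in> Cl S" "Dom S w = Dom S t"
    "Cod S w = Dom S a" "b \<cdot> w = t" "a \<cdot> w = s" "a \<in> Arr S" "b \<in> Arr S"
    "Dom S b = Dom S a" "Cod S b = Dom S p" "Cod S a = Dom S q" "p \<cdot> b = q \<cdot> a"
    using closed_into_pullback[of p q t s] assms arr dc by metis
  have "cartesian S q p b a"
    using w(1) unfolding cartesian_def by (auto 0 3 dest: spec simp: eq_commute) metis+
  then have b: "b \<in> Sm S" using Sm_base_change assms by blast
  have wA: "w \<in> Arr S" using w Cl_Arr by auto
  have "star t (cl t) p (sm p) = star (b \<cdot> w) (star w (cl w) b (sm b)) p (sm p)"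
    using cl_factor[of b w] b w assms by simp
  also have "\<dots> = star w (cl w) (p \<cdot> b) (sm (p \<cdot> b))"
    using star_assoc[of w b p "cl w" "sm b" "sm p"] sm_comp[of b p] w wA b arr assms cl_in sm_in
    by simp
  also have "\<dots> = star (a \<cdot> w) (star w (cl w) a (sm a)) q (sm q)"
    using star_assoc[of w a q "cl w" "sm a" "sm q"] sm_comp[of a q] w wA b arr assms cl_in sm_in
    by simp
  also have "\<dots> = star s (cl s) q (sm q)"
    using cl_factor[of a w] w assms by simp
  finally show ?thesis .
qed

text \<open>A product in the wrong order, smooth before closed, can be rearranged along any commutative square, not only
  a Cartesian one: a general square maps to the Cartesian one by a closed immersion \<open>k\<close>, and the triangle
  condition absorbs \<open>k\<close>.\<close>

lemma sm_cl_exchange: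
  assumes "p \<in> Sm S" "s \<in> Cl S" "Cod S p = Dom S s" "v \<in> Cl S" "r \<in> Sm S" "Cod S v = Dom S r"
    and eq: "s \<cdot> p = r \<cdot> v"
  shows "star p (sm p) s (cl s) = star v (cl v) r (sm r)"
proof -
  have arr: "p \<in> Arr S" "s \<in> Arr S" "v \<in> Arr S" "r \<in> Arr S" using assms Sm_Arr Cl_Arr by auto
  then have dc: "Dom S v = Dom S p" "Cod S s = Cod S r"
    using comp_arr(2,3)[of p s] comp_arr(2,3)[of v r] assms(3,6) eq by metis+
  obtain r' s' k where k: "cartesian S r s r' s'" "r' \<in> Sm S" "k \<in> Cl S" "Dom S k = Dom S v"
    "Cod S k = Dom S r'" "s' \<cdot> k = v" "r' \<cdot> k = p" "r' \<in> Arr S" "s' \<in> Arr S"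
    "Dom S s' = Dom S r'" "Cod S s' = Dom S r" "Cod S r' = Dom S s" "r \<cdot> s' = s \<cdot> r'"
    using closed_into_pullback[of r s v p] assms arr dc by metis
  have s': "s' \<in> Cl S" using Cl_base_change[OF assms(5,2) k(1)] .
  have kA: "k \<in> Arr S" using k Cl_Arr by auto
  have "star p (sm p) s (cl s) = star (r' \<cdot> k) (star k (cl k) r' (sm r')) s (cl s)"
    using triangle[of r' k] k assms by simp
  also have "\<dots> = star k (cl k) (s \<cdot> r') (star r' (sm r') s (cl s))"
    using star_assoc[of k r' s "cl k" "sm r'" "cl s"] k kA arr assms cl_in sm_in by simp
  also have "\<dots> = star k (cl k) (r \<cdot> s') (star s' (cl s') r (sm r))"
    using cross[OF assms(5,2) k(1)] k(13) by simp
  also have "\<dots> = star (s' \<cdot> k) (star k (cl k) s' (cl s')) r (sm r)"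
    using star_assoc[of k s' r "cl k" "cl s'" "sm r"] k kA s' arr assms cl_in sm_in by simp
  also have "\<dots> = star v (cl v) r (sm r)"
    using cl_comp[of k s'] k s' by simp
  finally show ?thesis .
qed

definition ext :: "'a \<Rightarrow> 'e" where
  "ext f = (SOME e. \<exists>t \<in> Cl S. \<exists>p \<in> Sm S. Cod S t = Dom S p \<and> f = p \<cdot> t \<and>
     e = star t (cl t) p (sm p))"

lemma ext_eq:
  assumes "t \<in> Cl S" "p \<in> Sm S" "Cod S t = Dom S p"
  shows "ext (p \<cdot> t) = star t (cl t) p (sm p)"
  unfolding ext_def
proof (rule some_equality)
  show "\<exists>t' \<in> Cl S. \<exists>p' \<in> Sm S. Cod S t' = Dom S p' \<and> p \<cdot> t = p' \<cdot> t' \<and>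
      star t (cl t) p (sm p) = star t' (cl t') p' (sm p')"
    using assms by blast
qed (use assms factorization_independent in metis)

lemma ext_in: assumes "f \<in> Arr S" shows "ext f \<in> N f"
proof -
  obtain t p where tp: "t \<in> Cl S" "p \<in> Sm S" "Cod S t = Dom S p" "f = p \<cdot> t"
    using factorization[OF assms] by blast
  have "t \<in> Arr S" "p \<in> Arr S" using tp Sm_Arr Cl_Arr by auto
  then show ?thesis using ext_eq star_in[of t p "cl t" "sm p"] tp cl_in sm_in by simp
qed

lemma ext_comp:
  assumes f: "f \<in> Arr S" and g: "g \<in> Arr S" and c: "Cod S f = Dom S g"
  shows "ext (g \<cdot> f) = star f (ext f) g (ext g)"
proof -
  obtain t p where tp: "t \<in> Cl S" "p \<in> Sm S" "Cod S t = Dom S p" "f = p \<cdot> t"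
    using factorization[OF f] by blast
  obtain s q where sq: "s \<in> Cl S" "q \<in> Sm S" "Cod S s = Dom S q" "g = q \<cdot> s"
    using factorization[OF g] by blast
  have arr: "t \<in> Arr S" "p \<in> Arr S" "s \<in> Arr S" "q \<in> Arr S" using tp sq Sm_Arr Cl_Arr by auto
  have "p \<cdot> t \<in> Hom S (Dom S t) (Cod S p)" "q \<cdot> s \<in> Hom S (Dom S s) (Cod S q)"
    using arr tp sq Comp_in by (auto simp: Hom_def)
  then have fg: "Dom S f = Dom S t" "Cod S f = Cod S p" "Dom S g = Dom S s" "Cod S g = Cod S q"
    using tp sq by (auto simp: Hom_def)
  have ps: "Cod S p = Dom S s" using c fg by simp
  have sp: "s \<cdot> p \<in> Hom S (Dom S p) (Cod S s)" using arr ps Comp_in by (auto simp: Hom_def)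
  then obtain v r where vr: "v \<in> Cl S" "r \<in> Sm S" "Cod S v = Dom S r" "s \<cdot> p = r \<cdot> v"
    using factorization[of "s \<cdot> p"] by (auto simp: Hom_def)
  have arr': "v \<in> Arr S" "r \<in> Arr S" using vr Sm_Arr Cl_Arr by auto
  have "r \<cdot> v \<in> Hom S (Dom S v) (Cod S r)" using arr' vr Comp_in by (auto simp: Hom_def)
  then have dc: "Dom S v = Dom S p" "Cod S r = Cod S s" using sp vr(4) by (auto simp: Hom_def)
  have vt: "v \<cdot> t \<in> Cl S" "Cod S (v \<cdot> t) = Cod S v" and qr: "q \<cdot> r \<in> Sm S" "Dom S (q \<cdot> r) = Dom S r"
    using Cl_Comp[of t v] Sm_Comp[of r q] tp sq vr dc
      Comp_in[of t _ _ v] Comp_in[of r _ _ q] arr arr' by (auto simp: Hom_def)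
  have eq: "g \<cdot> f = (q \<cdot> r) \<cdot> (v \<cdot> t)" and sf: "s \<cdot> f = r \<cdot> (v \<cdot> t)" and gp: "g \<cdot> p = (q \<cdot> r) \<cdot> v"
  proof -
    have H: "t \<in> Hom S (Dom S t) (Dom S p)" "p \<in> Hom S (Dom S p) (Dom S s)" "s \<in> Hom S (Dom S s) (Dom S q)"
      "q \<in> Hom S (Dom S q) (Cod S q)" "v \<in> Hom S (Dom S p) (Dom S r)" "r \<in> Hom S (Dom S r) (Dom S q)"
      using arr arr' tp sq vr dc ps by (auto simp: Hom_def)
    show sf: "s \<cdot> f = r \<cdot> (v \<cdot> t)"
      using Comp_assoc[OF H(1,2,3)] Comp_assoc[OF H(1,5,6)] tp vr by simp
    show gp: "g \<cdot> p = (q \<cdot> r) \<cdot> v"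
      using Comp_assoc[OF H(2,3,4)] Comp_assoc[OF H(5,6,4)] sq vr by simp
    show "g \<cdot> f = (q \<cdot> r) \<cdot> (v \<cdot> t)"
      using gp Comp_assoc[OF H(1,2) Comp_in[OF H(3,4)]] Comp_assoc[OF H(1,5) Comp_in[OF H(6,4)]] tp sq
      by simp
  qed
  have N: "cl t \<in> N t" "sm p \<in> N p" "cl s \<in> N s" "sm q \<in> N q" "cl v \<in> N v" "sm r \<in> N r"
    using tp sq vr cl_in sm_in by auto
  have "star f (ext f) g (ext g) = star (p \<cdot> t) (star t (cl t) p (sm p)) g (ext g)"
    using ext_eq tp by simp
  also have "\<dots> = star t (cl t) (g \<cdot> p) (star p (sm p) g (ext g))"
    using star_assoc[of t p g "cl t" "sm p" "ext g"] arr g tp fg ps N ext_in by simp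
  also have "star p (sm p) g (ext g) = star (s \<cdot> p) (star p (sm p) s (cl s)) q (sm q)"
    using star_assoc[of p s q "sm p" "cl s" "sm q"] arr sq ps N ext_eq by simp
  also have "star p (sm p) s (cl s) = star v (cl v) r (sm r)"
    using sm_cl_exchange tp sq vr ps by simp
  also have "star (s \<cdot> p) (star v (cl v) r (sm r)) q (sm q) = star v (cl v) (q \<cdot> r) (sm (q \<cdot> r))"
    using star_assoc[of v r q "cl v" "sm r" "sm q"] sm_comp[of r q] arr arr' vr sq dc N by simp
  also have "star t (cl t) (g \<cdot> p) \<dots> = star (v \<cdot> t) (cl (v \<cdot> t)) (q \<cdot> r) (sm (q \<cdot> r))"
    using star_assoc[of t v "q \<cdot> r" "cl t" "cl v" "sm (q \<cdot> r)"] cl_comp[of t v] arr arr' tp vr dc N qr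
      sm_in Sm_Arr gp by auto
  also have "\<dots> = ext (g \<cdot> f)" using ext_eq[of "v \<cdot> t" "q \<cdot> r"] vt qr vr eq by simp
  finally show ?thesis by simp
qed

lemma ext_sm: assumes "p \<in> Sm S" shows "ext p = sm p"
proof -
  have p: "p \<in> Arr S" "Dom S p \<in> Ob S" using assms Sm_Arr Dom_in by auto
  then have i: "Ide S (Dom S p) \<in> Hom S (Dom S p) (Dom S p)" "p \<cdot> Ide S (Dom S p) = p"
    using Ide_in Comp_Ide_right by (auto simp: Hom_def)
  then show ?thesis
    using ext_eq[of "Ide S (Dom S p)" p] triangle[of p "Ide S (Dom S p)"] Ide_Cl p assms
    by (auto simp: Hom_def)
qed

lemma ext_cl: assumes "z \<in> Cl S" shows "ext z = cl z"
proof -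
  let ?i = "Ide S (Cod S z)"
  have z: "z \<in> Arr S" "Cod S z \<in> Ob S" using assms Cl_Arr Cod_in by auto
  then have i: "?i \<in> Hom S (Cod S z) (Cod S z)" "?i \<cdot> z = z"
    using Ide_in Comp_Ide_left by (auto simp: Hom_def)
  then show ?thesis
    using ext_eq[of z ?i] cl_comp[of z ?i] sm_Ide_cl_Ide[of "Cod S z"] Ide_Cl Ide_Sm z assms
    by (auto simp: Hom_def)
qed

end

section \<open>Localic structures and cores\<close>

context localic_pair
begin

lemma Arr_Hom: "f \<in> Arr S \<Longrightarrow> f \<in> Hom S (Dom S f) (Cod S f)"
  by (simp add: Hom_def)

lemma compat_cong:
  assumes f: "f \<in> Arr S" and \<alpha>: "compat f \<alpha>" and eq: "\<And>A. A \<in> Ob (fib H1 (Cod S f)) \<Longrightarrow> \<alpha> A = \<beta> A"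
  shows "compat f \<beta>"
proof -
  interpret X: triangulated_category "fib H1 (Cod S f)" using one.fib_triangulated f by simp
  interpret sh: cat_functor "fib H1 (Cod S f)" "fib H1 (Cod S f)" "Shift (fib H1 (Cod S f))"
    by (rule X.shift_functor)
  show ?thesis
    unfolding compat_def
    by (rule tri_nat_iso_cong[OF X.category_axioms \<alpha>[unfolded compat_def] tfctr_eq_refl tfctr_eq_refl eq sh.fo_ob])
qed

lemma star_cong:
  assumes f: "f \<in> Hom S Y X" and g: "g \<in> Hom S X V" and A: "A \<in> Ob (fib H1 V)"
    and eq: "\<And>B. B \<in> Ob (fib H1 X) \<Longrightarrow> \<alpha> B = \<alpha>' B" "\<And>B. B \<in> Ob (fib H1 V) \<Longrightarrow> \<beta> B = \<beta>' B"
  shows "star f \<alpha> g \<beta> A = star f \<alpha>' g \<beta>' A"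
proof -
  interpret g1: cat_functor "fib H1 V" "fib H1 X" "pull H1 g" using one.pull_functor g .
  show ?thesis using eq A by (simp add: star_def)
qed

lemma pull_structure_iff:
  assumes K: "K \<subseteq> Arr S" and comp: "\<And>f g. \<lbrakk>f \<in> K; g \<in> K; Cod S f = Dom S g\<rbrakk> \<Longrightarrow> g \<cdot> f \<in> K"
  shows "pull_structure S H1 H2 R K \<theta> \<longleftrightarrow> (\<forall>f \<in> K. compat f (\<theta> f)) \<and>
    (\<forall>f \<in> K. \<forall>g \<in> K. Cod S f = Dom S g \<longrightarrow>
      (\<forall>A \<in> Ob (fib H1 (Cod S g)). \<theta> (g \<cdot> f) A = star f (\<theta> f) g (\<theta> g) A))"
proof -
  have "\<theta> (g \<cdot> f) A = star f (\<theta> f) g (\<theta> g) A \<longleftrightarrow>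
      fm (R (Dom S f)) (conn H1 f g A) \<cdot>\<^bsub>fib H2 (Dom S f)\<^esub> \<theta> (g \<cdot> f) A =
      \<theta> f (fo (pull H1 g) A) \<cdot>\<^bsub>fib H2 (Dom S f)\<^esub> fm (pull H2 f) (\<theta> g A) \<cdot>\<^bsub>fib H2 (Dom S f)\<^esub>
        conn H2 f g (fo (R (Cod S g)) A)"
    if c: "\<forall>f \<in> K. compat f (\<theta> f)" and f: "f \<in> K" and g: "g \<in> K" and fg: "Cod S f = Dom S g"
      and A: "A \<in> Ob (fib H1 (Cod S g))" for f g A
  proof -
    have H: "f \<in> Hom S (Dom S f) (Dom S g)" "g \<in> Hom S (Dom S g) (Cod S g)"
      using f g K fg by (auto simp: Hom_def)
    note gf = Comp_in[OF H]
    show ?thesis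
      using star_eq_iff[OF H _ _ A] compat_arr[OF gf _ A, of "\<theta> (g \<cdot> f)"] c f g comp[OF f g fg] by simp
  qed
  then show ?thesis unfolding pull_structure_def compat_def by blast
qed

lemma pull_structure_Sm_iff:
  "pull_structure S H1 H2 R (Sm S) \<theta> \<longleftrightarrow> (\<forall>f \<in> Sm S. compat f (\<theta> f)) \<and>
    (\<forall>f \<in> Sm S. \<forall>g \<in> Sm S. Cod S f = Dom S g \<longrightarrow>
      (\<forall>A \<in> Ob (fib H1 (Cod S g)). \<theta> (g \<cdot> f) A = star f (\<theta> f) g (\<theta> g) A))"
  by (rule pull_structure_iff[OF Sm_Arr]) (rule Sm_Comp)

lemma pull_structure_Arr_iff:
  "pull_structure S H1 H2 R (Arr S) \<theta> \<longleftrightarrow> (\<forall>f \<in> Arr S. compat f (\<theta> f)) \<and>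
    (\<forall>f \<in> Arr S. \<forall>g \<in> Arr S. Cod S f = Dom S g \<longrightarrow>
      (\<forall>A \<in> Ob (fib H1 (Cod S g)). \<theta> (g \<cdot> f) A = star f (\<theta> f) g (\<theta> g) A))"
  by (rule pull_structure_iff) auto

lemma push_structure_iff:
  "push_structure S H1 H2 R \<omega> \<longleftrightarrow> (\<forall>z \<in> Cl S. push_compat z (\<omega> z)) \<and>
    (\<forall>z \<in> Cl S. \<forall>y \<in> Cl S. Cod S z = Dom S y \<longrightarrow> (\<forall>A \<in> Ob (fib H1 (Dom S z)).
        fm (R (Cod S y)) (push_conn S H1 y z A) \<cdot>\<^bsub>fib H2 (Cod S y)\<^esub> inv_arr (fib H2 (Cod S y)) (\<omega> (y \<cdot> z) A) =
        inv_arr (fib H2 (Cod S y)) (\<omega> y (fo (push H1 z) A)) \<cdot>\<^bsub>fib H2 (Cod S y)\<^esub>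
          fm (push H2 y) (inv_arr (fib H2 (Cod S z)) (\<omega> z A)) \<cdot>\<^bsub>fib H2 (Cod S y)\<^esub>
          push_conn S H2 y z (fo (R (Dom S z)) A)))"
  unfolding push_structure_def push_compat_def Let_def ..

lemma cartesian_Hom:
  assumes p: "p \<in> Sm S" and z: "z \<in> Cl S" and c: "cartesian S p z p' z'"
  shows "p \<in> Hom S (Dom S p) (Cod S p)" "z \<in> Hom S (Dom S z) (Cod S p)"
    "p' \<in> Hom S (Dom S p') (Dom S z)" "z' \<in> Hom S (Dom S p') (Dom S p)" "p \<cdot> z' = z \<cdot> p'"
    "p' \<in> Sm S" "z' \<in> Cl S"
  using c Sm_base_change[OF p c] Cl_base_change[OF p z c] by (auto simp: cartesian_def Hom_def)

text \<open>Here \<open>\<theta>sm\<close> and \<open>\<omega>\<close> are only known to agree with \<open>\<theta>\<close> and its mate on objects, so the properties of \<open>\<theta>\<close> are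
  first carried over to them. The cocycle, exchange and triangle conditions are then instances of the multiplicativity of \<open>\<theta>\<close>,
  read for \<open>\<omega>\<close> through the equivalences for mates.\<close>

theorem localic_structure_core:
  assumes \<theta>: "localic_structure S H1 H2 R \<theta>" and det: "determines S H1 H2 R \<theta> \<theta>sm \<omega>"
  shows "core S H1 H2 R \<theta>sm \<omega>"
proof -
  have compat: "compat f (\<theta> f)" if "f \<in> Arr S" for f
    using \<theta> that pull_structure_Arr_iff[of \<theta>] by (simp add: localic_structure_def)
  have comp: "\<theta> (g \<cdot> f) A = star f (\<theta> f) g (\<theta> g) A"
    if "f \<in> Arr S" "g \<in> Arr S" "Cod S f = Dom S g" "A \<in> Ob (fib H1 (Cod S g))" for f g A
    using \<theta> that pull_structure_Arr_iff[of \<theta>] by (simp add: localic_structure_def)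
  have sm: "\<theta> p A = \<theta>sm p A" if "p \<in> Sm S" "A \<in> Ob (fib H1 (Cod S p))" for p A
    using det that by (simp add: determines_def pull_structure_eq_def)
  have cl: "push_mate S H1 H2 R \<theta> z B = \<omega> z B" if "z \<in> Cl S" "B \<in> Ob (fib H1 (Dom S z))" for z B
    using det that by (simp add: determines_def push_structure_eq_def)
  have Sm: "p \<in> Arr S" "compat p (\<theta>sm p)" if "p \<in> Sm S" for p
    using that Sm_Arr compat_cong[OF _ compat, of p "\<theta>sm p"] sm by auto
  have Cl: "z \<in> Arr S" "pull_natural z (\<theta> z)" "push_natural z (\<omega> z)" "mated z (\<theta> z) (\<omega> z)"
    if z: "z \<in> Cl S" for z
  proof -
    show A: "z \<in> Arr S" using z Cl_Arr by auto
    show n: "pull_natural z (\<theta> z)" using compat_pull_natural compat A by blast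
    have e: "push_mate S H1 H2 R (\<lambda>_. \<theta> z) z B = \<omega> z B" if "B \<in> Ob (fib H1 (Dom S z))" for B
      using cl[OF z that] push_mate_cong[of \<theta> z "\<lambda>_. \<theta> z"] by simp
    interpret Z: category "fib H1 (Dom S z)" using one.fib_category A by simp
    show "push_natural z (\<omega> z)"
      using push_mate_natural[OF z n] e by (auto simp: push_natural_def nat_trans_def Z.Hom_iff)
    show "mated z (\<theta> z) (\<omega> z)" using mated_push_mate[OF z n] e by (simp add: mated_def)
  qed
  have push: "push_compat z (\<omega> z)" if z: "z \<in> Cl S" for z
  proof -
    have i: "is_iso (fib H2 (Dom S z)) (\<theta> z A)" if "A \<in> Ob (fib H1 (Cod S z))" for A
      using compat_arr(4)[OF Arr_Hom compat that] Cl(1)[OF z] by simp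
    have "is_iso (fib H2 (Cod S z)) (\<omega> z B)" if "B \<in> Ob (fib H1 (Dom S z))" for B
      using mated_push_iso[OF z Cl(2-4)[OF z] compat i that] Opn_Sm[OF z] Sm_Arr by blast
    with i show ?thesis
      using mated_compat_iff[OF z Cl(2-4)[OF z]] compat Cl(1)[OF z] by blast
  qed
  have "pull_structure S H1 H2 R (Sm S) \<theta>sm"
    unfolding pull_structure_Sm_iff
  proof (intro conjI ballI impI)
    fix p q A assume p: "p \<in> Sm S" and q: "q \<in> Sm S" and c: "Cod S p = Dom S q"
      and A: "A \<in> Ob (fib H1 (Cod S q))"
    have H: "p \<in> Hom S (Dom S p) (Dom S q)" "q \<in> Hom S (Dom S q) (Cod S q)"
      using p q c Sm_Arr by (auto simp: Hom_def)
    have "\<theta> (q \<cdot> p) A = star p (\<theta>sm p) q (\<theta>sm q) A"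
      using comp[of p q A] star_cong[OF H A, of "\<theta> p" "\<theta>sm p" "\<theta> q" "\<theta>sm q"] sm p q c A Sm by simp
    then show "\<theta>sm (q \<cdot> p) A = star p (\<theta>sm p) q (\<theta>sm q) A"
      using sm[OF Sm_Comp[OF p q c], of A] A p q c Sm by simp
  qed (rule Sm(2))
  moreover have "left_adjointable S H1 H2 R \<theta>sm"
    unfolding left_adjointable_def
  proof (intro ballI)
    fix p A assume p: "p \<in> Sm S" and A: "A \<in> Ob (fib H1 (Dom S p))"
    interpret p1: adjunction "fib H1 (Dom S p)" "fib H1 (Cod S p)" "sharp H1 p" "pull H1 p"
      "sharp_unit H1 p" "sharp_counit H1 p"
      using one.sharp_adjunction[OF p] .
    have "is_iso (fib H2 (Cod S p)) (sharp_mate S H1 H2 R \<theta> p A)"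
      using \<theta> p A by (simp add: localic_structure_def left_adjointable_def)
    then show "is_iso (fib H2 (Cod S p)) (sharp_mate S H1 H2 R \<theta>sm p A)"
      using sm[OF p, of "fo (sharp H1 p) A"] A by (simp add: sharp_mate_def)
  qed
  moreover have "push_structure S H1 H2 R \<omega>"
    unfolding push_structure_iff
  proof (rule conjI, blast intro: push, intro ballI impI)
    fix z y A assume z: "z \<in> Cl S" and y: "y \<in> Cl S" and c: "Cod S z = Dom S y"
      and A: "A \<in> Ob (fib H1 (Dom S z))"
    have H: "z \<in> Hom S (Dom S z) (Cod S z)" "y \<in> Hom S (Cod S z) (Cod S y)"
      using z y c Cl_Arr by (auto simp: Hom_def)
    have yz: "y \<cdot> z \<in> Cl S" using Cl_Comp z y c by simp
    show "fm (R (Cod S y)) (push_conn S H1 y z A) \<cdot>\<^bsub>fib H2 (Cod S y)\<^esub> inv_arr (fib H2 (Cod S y)) (\<omega> (y \<cdot> z) A) =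
        inv_arr (fib H2 (Cod S y)) (\<omega> y (fo (push H1 z) A)) \<cdot>\<^bsub>fib H2 (Cod S y)\<^esub>
          fm (push H2 y) (inv_arr (fib H2 (Cod S z)) (\<omega> z A)) \<cdot>\<^bsub>fib H2 (Cod S y)\<^esub>
          push_conn S H2 y z (fo (R (Dom S z)) A)"
      using push_cocycle_iff[OF z H(1) y H(2) compat compat compat push push push Cl(4) Cl(4) Cl(4)]
        z y yz Cl(1) comp[of z y] c A by blast
  qed
  moreover have "core_C S H1 H2 R \<theta>sm \<omega>"
    unfolding core_C_def Let_def
  proof (intro ballI allI impI)
    fix p z p' z' A
    assume p: "p \<in> Sm S" and z: "z \<in> Cl S" and c: "cartesian S p z p' z'"
      and A: "A \<in> Ob (fib H1 (Dom S z))"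
    note H = cartesian_Hom[OF p z c]
    have "star z' (\<theta> z') p (\<theta>sm p) B = star p' (\<theta>sm p') z (\<theta> z) B" if B: "B \<in> Ob (fib H1 (Cod S p))" for B
    proof -
      have "star z' (\<theta> z') p (\<theta>sm p) B = star z' (\<theta> z') p (\<theta> p) B"
        using star_cong[OF H(4,1) B, of "\<theta> z'" "\<theta> z'" "\<theta> p" "\<theta>sm p"] sm[OF p] by simp
      also have "\<dots> = star p' (\<theta> p') z (\<theta> z) B"
        using comp[of z' p B] comp[of p' z B] H(1-5) B by (auto simp: Hom_def)
      also have "\<dots> = star p' (\<theta>sm p') z (\<theta> z) B"
        using star_cong[OF H(3,2) B, of "\<theta> p'" "\<theta>sm p'" "\<theta> z" "\<theta> z"] sm[OF H(6)] H(3)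
        by (simp add: Hom_def)
      finally show ?thesis .
    qed
    then show "fm (push H2 z') (\<theta>sm p' A) \<cdot>\<^bsub>fib H2 (Dom S p)\<^esub>
          push_base_change S H2 p z p' z' (fo (R (Dom S z)) A) \<cdot>\<^bsub>fib H2 (Dom S p)\<^esub> fm (pull H2 p) (\<omega> z A) =
        \<omega> z' (fo (pull H1 p') A) \<cdot>\<^bsub>fib H2 (Dom S p)\<^esub>
          fm (R (Dom S p)) (push_base_change S H1 p z p' z' A) \<cdot>\<^bsub>fib H2 (Dom S p)\<^esub> \<theta>sm p (fo (push H1 z) A)"
      using cross_iff[OF H(1) z H(2,3,7,4,5) Sm(2)[OF p] Sm(2)[OF H(6)] compat[OF Cl(1)[OF z]]
          compat[OF Cl(1)[OF H(7)]] Cl(3)[OF z] Cl(3)[OF H(7)] Cl(4)[OF z] Cl(4)[OF H(7)]] A by blast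
  qed
  moreover have "core_T S H1 H2 R \<theta>sm \<omega>"
    unfolding core_T_def Let_def
  proof (intro ballI impI)
    fix p q h A
    assume p: "p \<in> Sm S" and q: "q \<in> Sm S" and h: "h \<in> Cl S" and c: "Cod S h = Dom S p \<and> q = p \<cdot> h"
      and A: "A \<in> Ob (fib H1 (Cod S p))"
    have H: "h \<in> Hom S (Dom S h) (Dom S p)" "p \<in> Hom S (Dom S p) (Cod S p)"
      using p h c Sm_Arr Cl_Arr by (auto simp: Hom_def)
    have ph: "p \<cdot> h \<in> Hom S (Dom S h) (Cod S p)" using Comp_in[OF H] .
    interpret p1: cat_functor "fib H1 (Cod S p)" "fib H1 (Dom S p)" "pull H1 p" using one.pull_functor H(2) .
    have "pull_mate S H1 H2 R \<omega> h (fo (pull H1 p) A) = \<theta> h (fo (pull H1 p) A)"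
      using pull_mate_eq[OF h Cl(2-4)[OF h], of "fo (pull H1 p) A"] A c pull_mate_cong[of \<omega> h "\<lambda>_. \<omega> h"] by simp
    moreover have "\<theta>sm q A = star h (\<theta> h) p (\<theta>sm p) A"
      using star_cong[OF H A, of "\<theta> h" "\<theta> h" "\<theta> p" "\<theta>sm p"] sm[OF p] sm[OF q, of A] comp[of h p A]
        c A H ph by (simp add: Hom_def)
    ultimately show "fm (R (Dom S h)) (conn H1 h p A) \<cdot>\<^bsub>fib H2 (Dom S h)\<^esub> \<theta>sm q A =
        pull_mate S H1 H2 R \<omega> h (fo (pull H1 p) A) \<cdot>\<^bsub>fib H2 (Dom S h)\<^esub> fm (pull H2 h) (\<theta>sm p A) \<cdot>\<^bsub>fib H2 (Dom S h)\<^esub>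
          conn H2 h p (fo (R (Cod S p)) A)"
      using conn_star[OF H compat[OF Cl(1)[OF h]] Sm(2)[OF p] A] by simp
  qed
  ultimately show ?thesis unfolding core_def by blast
qed

text \<open>The mates \<open>\<theta>cl\<close> of \<open>\<omega>\<close> and the family \<open>\<theta>sm\<close> are sections to which the gluing applies. Uniqueness holds because
  any extension must restrict to \<open>\<theta>sm\<close> and \<open>\<theta>cl\<close>, and every arrow factors.\<close>

theorem core_extends_uniquely:
  assumes core: "core S H1 H2 R \<theta>sm \<omega>"
  obtains \<theta> where "localic_structure S H1 H2 R \<theta>" "determines S H1 H2 R \<theta> \<theta>sm \<omega>"
    "\<And>\<theta>'. \<lbrakk>localic_structure S H1 H2 R \<theta>'; determines S H1 H2 R \<theta>' \<theta>sm \<omega>\<rbrakk> \<Longrightarrow>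
      pull_structure_eq S H1 (Arr S) \<theta>' \<theta>"
proof -
  have la: "left_adjointable S H1 H2 R \<theta>sm" using core by (simp add: core_def)
  have Sm: "p \<in> Arr S" "compat p (\<theta>sm p)" if "p \<in> Sm S" for p
    using core that Sm_Arr pull_structure_Sm_iff by (auto simp: core_def)
  have sm_comp: "\<theta>sm (q \<cdot> p) A = star p (\<theta>sm p) q (\<theta>sm q) A"
    if "p \<in> Sm S" "q \<in> Sm S" "Cod S p = Dom S q" "A \<in> Ob (fib H1 (Cod S q))" for p q A
    using core that pull_structure_Sm_iff by (simp add: core_def)
  have push: "push_compat z (\<omega> z)" if "z \<in> Cl S" for z
    using core that push_structure_iff by (simp add: core_def)
  define \<theta>cl where "\<theta>cl = pull_mate S H1 H2 R \<omega>"
  have mate: "\<theta>cl z = pull_mate S H1 H2 R (\<lambda>_. \<omega> z) z" for z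
    unfolding \<theta>cl_def by (rule pull_mate_cong) simp
  have Cl: "z \<in> Arr S" "push_natural z (\<omega> z)" "pull_natural z (\<theta>cl z)" "mated z (\<theta>cl z) (\<omega> z)"
    if z: "z \<in> Cl S" for z
    using Cl_Arr z mated_pull_mate[OF z] pull_mate_natural[OF z] push_compat_push_natural push unfolding mate by auto
  have compat_cl: "compat z (\<theta>cl z)" if z: "z \<in> Cl S" for z
  proof -
    have i: "is_iso (fib H2 (Cod S z)) (\<omega> z B)" if "B \<in> Ob (fib H1 (Dom S z))" for B
      using tri_nat_iso_arr(4)[OF push[OF z, unfolded push_compat_def] that] .
    have "is_iso (fib H2 (Dom S z)) (\<theta>cl z A)" if "A \<in> Ob (fib H1 (Cod S z))" for A
      using mated_pull_iso[OF z Cl(3)[OF z] Cl(2)[OF z] Cl(4)[OF z] Sm(2)[OF Opn_Sm[OF z]] la i that] .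
    with i show ?thesis
      using mated_compat_iff[OF z Cl(3)[OF z] Cl(2)[OF z] Cl(4)[OF z]] push[OF z] by blast
  qed
  have cl_comp: "\<theta>cl (y \<cdot> z) A = star z (\<theta>cl z) y (\<theta>cl y) A"
    if z: "z \<in> Cl S" and y: "y \<in> Cl S" and c: "Cod S z = Dom S y" and A: "A \<in> Ob (fib H1 (Cod S y))" for z y A
  proof -
    have H: "z \<in> Hom S (Dom S z) (Cod S z)" "y \<in> Hom S (Cod S z) (Cod S y)"
      using z y c Cl_Arr by (auto simp: Hom_def)
    have yz: "y \<cdot> z \<in> Cl S" using Cl_Comp z y c by simp
    have "\<forall>A\<in>Ob (fib H1 (Dom S z)).
        fm (R (Cod S y)) (push_conn S H1 y z A) \<cdot>\<^bsub>fib H2 (Cod S y)\<^esub> inv_arr (fib H2 (Cod S y)) (\<omega> (y \<cdot> z) A) =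
        inv_arr (fib H2 (Cod S y)) (\<omega> y (fo (push H1 z) A)) \<cdot>\<^bsub>fib H2 (Cod S y)\<^esub>
          fm (push H2 y) (inv_arr (fib H2 (Cod S z)) (\<omega> z A)) \<cdot>\<^bsub>fib H2 (Cod S y)\<^esub>
          push_conn S H2 y z (fo (R (Dom S z)) A)"
      using core z y c unfolding core_def push_structure_iff by blast
    then show ?thesis
      using push_cocycle_iff[OF z H(1) y H(2) compat_cl[OF z] compat_cl[OF y] compat_cl[OF yz]
          push[OF z] push[OF y] push[OF yz] Cl(4)[OF z] Cl(4)[OF y] Cl(4)[OF yz]] A by blast
  qed
  have cross: "star z' (\<theta>cl z') p (\<theta>sm p) A = star p' (\<theta>sm p') z (\<theta>cl z) A"
    if p: "p \<in> Sm S" and z: "z \<in> Cl S" and c: "cartesian S p z p' z'" and A: "A \<in> Ob (fib H1 (Cod S p))"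
    for p z p' z' A
  proof -
    note H = cartesian_Hom[OF p z c]
    have "\<forall>A \<in> Ob (fib H1 (Dom S z)). fm (push H2 z') (\<theta>sm p' A) \<cdot>\<^bsub>fib H2 (Dom S p)\<^esub>
          push_base_change S H2 p z p' z' (fo (R (Dom S z)) A) \<cdot>\<^bsub>fib H2 (Dom S p)\<^esub> fm (pull H2 p) (\<omega> z A) =
        \<omega> z' (fo (pull H1 p') A) \<cdot>\<^bsub>fib H2 (Dom S p)\<^esub>
          fm (R (Dom S p)) (push_base_change S H1 p z p' z' A) \<cdot>\<^bsub>fib H2 (Dom S p)\<^esub> \<theta>sm p (fo (push H1 z) A)"
      using core p z c unfolding core_def core_C_def Let_def by blast
    then show ?thesis
      using cross_iff[OF H(1) z H(2,3,7,4,5) Sm(2)[OF p] Sm(2)[OF H(6)] compat_cl[OF z]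
          compat_cl[OF H(7)] Cl(2)[OF z] Cl(2)[OF H(7)] Cl(4)[OF z] Cl(4)[OF H(7)]] A by blast
  qed
  have triangle: "\<theta>sm (p \<cdot> h) A = star h (\<theta>cl h) p (\<theta>sm p) A"
    if p: "p \<in> Sm S" and q: "p \<cdot> h \<in> Sm S" and h: "h \<in> Cl S" and c: "Cod S h = Dom S p"
      and A: "A \<in> Ob (fib H1 (Cod S p))" for p h A
  proof -
    have H: "h \<in> Hom S (Dom S h) (Dom S p)" "p \<in> Hom S (Dom S p) (Cod S p)"
      using p h c Sm_Arr Cl_Arr by (auto simp: Hom_def)
    have "fm (R (Dom S h)) (conn H1 h p A) \<cdot>\<^bsub>fib H2 (Dom S h)\<^esub> \<theta>sm (p \<cdot> h) A =
        \<theta>cl h (fo (pull H1 p) A) \<cdot>\<^bsub>fib H2 (Dom S h)\<^esub> fm (pull H2 h) (\<theta>sm p A) \<cdot>\<^bsub>fib H2 (Dom S h)\<^esub>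
          conn H2 h p (fo (R (Cod S p)) A)"
      using core p q h c A unfolding core_def core_T_def Let_def \<theta>cl_def by blast
    then show ?thesis
      using star_eq_iff[OF H compat_cl[OF h] Sm(2)[OF p] A]
        compat_arr(1,3)[OF Comp_in[OF H] Sm(2)[OF q] A] by blast
  qed
  \<comment> \<open>\<open>conn H (Ide S X) (Ide S X)\<close> may differ from the identity, and then so does \<open>\<theta>sm (Ide S X)\<close>; the comparison
    with \<open>\<theta>cl\<close> comes from \<open>Ide = Ide \<cdot> Ide\<close>, read once as a smooth composite and once as a triangle\<close>
  have Ide: "\<theta>sm (Ide S X) A = \<theta>cl (Ide S X) A" if X: "X \<in> Ob S" and A: "A \<in> Ob (fib H1 X)" for X A
  proof -
    let ?i = "Ide S X"
    have iS: "?i \<in> Sm S" and iC: "?i \<in> Cl S" and i: "?i \<in> Hom S X X"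
      and ii: "?i \<cdot> ?i = ?i" and di: "Dom S ?i = X" "Cod S ?i = X"
      using X Sm_iso Cl_iso Ide_in by simp_all
    interpret RX: shift_compatible_functor "fib H1 X" "fib H2 X" "R X" using R_shift X .
    interpret i2: cat_functor "fib H2 X" "fib H2 X" "pull H2 ?i" using two.pull_functor i .
    note c1 = compat_arr[OF i Sm(2)[OF iS] A] and c2 = compat_arr[OF i compat_cl[OF iC] A]
    let ?k = "fm (pull H2 ?i) (\<theta>sm ?i A) \<cdot>\<^bsub>fib H2 X\<^esub> conn H2 ?i ?i (fo (R X) A)"
    note [simp] = c1 c2 two.conn_arr[OF i i] one.pull_Ide_simps[OF X] two.pull_Ide_simps[OF X]
    have k: "is_iso (fib H2 X) ?k" by (rule RX.D.iso_comp) (use A ii in simp_all)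
    have "star ?i (\<theta>sm ?i) ?i (\<theta>sm ?i) A = star ?i (\<theta>cl ?i) ?i (\<theta>sm ?i) A"
      using sm_comp[OF iS iS] triangle[OF iS _ iC] di A ii iS by simp
    then have "\<theta>sm ?i A \<cdot>\<^bsub>fib H2 X\<^esub> ?k = \<theta>cl ?i A \<cdot>\<^bsub>fib H2 X\<^esub> ?k"
      using conn_star[OF i i Sm(2)[OF iS] Sm(2)[OF iS] A]
        conn_star[OF i i compat_cl[OF iC] Sm(2)[OF iS] A] A by simp
    then show ?thesis
      by (rule RX.D.iso_cancel_right[OF k, rotated -1]) (use A ii in simp_all)
  qed
  \<comment> \<open>restricting to objects turns agreement of transformations into equality of functions\<close>
  let ?ob = "\<lambda>f. Ob (fib H1 (Cod S f))"
  let ?N = "\<lambda>f. {\<alpha> \<in> extensional (?ob f). compat f \<alpha>}"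
  let ?star = "\<lambda>f \<alpha> g \<beta>. restrict (star f \<alpha> g \<beta>) (?ob g)"
  let ?sm = "\<lambda>p. restrict (\<theta>sm p) (?ob p)" and ?cl = "\<lambda>z. restrict (\<theta>cl z) (?ob z)"
  have restrict_compat: "compat f (restrict \<alpha> (?ob f))" if "f \<in> Arr S" "compat f \<alpha>" for f \<alpha>
    by (rule compat_cong[OF that]) simp
  have star_compat': "compat (g \<cdot> f) (star f \<alpha> g \<beta>)"
    if "f \<in> Arr S" "g \<in> Arr S" "Cod S f = Dom S g" "compat f \<alpha>" "compat g \<beta>" for f g \<alpha> \<beta>
    using star_compat[of f "Dom S f" "Dom S g" g "Cod S g"] that by (simp add: Hom_def)
  have star_cong': "star f \<alpha> g \<beta> A = star f \<alpha>' g \<beta>' A"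
    if "f \<in> Arr S" "g \<in> Arr S" "Cod S f = Dom S g" "A \<in> ?ob g"
      "\<And>B. B \<in> ?ob f \<Longrightarrow> \<alpha> B = \<alpha>' B" "\<And>B. B \<in> ?ob g \<Longrightarrow> \<beta> B = \<beta>' B" for f g \<alpha> \<beta> \<alpha>' \<beta>' A
    by (rule star_cong[of f "Dom S f" "Dom S g" g "Cod S g" A]) (use that in \<open>simp_all add: Hom_def\<close>)
  interpret ext: crossed_sections S ?N ?star ?sm ?cl
  proof unfold_locales
    fix f g \<alpha> \<beta> assume "f \<in> Arr S" "g \<in> Arr S" "Cod S f = Dom S g" "\<alpha> \<in> ?N f" "\<beta> \<in> ?N g"
    then show "?star f \<alpha> g \<beta> \<in> ?N (g \<cdot> f)"
      using restrict_compat[of "g \<cdot> f" "star f \<alpha> g \<beta>"] star_compat'[of f g \<alpha> \<beta>] by simp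
  next
    fix f g h \<alpha> \<beta> \<gamma>
    assume a: "f \<in> Arr S" "g \<in> Arr S" "h \<in> Arr S" "Cod S f = Dom S g" "Cod S g = Dom S h"
      "\<alpha> \<in> ?N f" "\<beta> \<in> ?N g" "\<gamma> \<in> ?N h"
    have "star f \<alpha> (h \<cdot> g) (?star g \<beta> h \<gamma>) A = star (g \<cdot> f) (?star f \<alpha> g \<beta>) h \<gamma> A" if A: "A \<in> ?ob h" for A
    proof -
      have "star f \<alpha> (h \<cdot> g) (?star g \<beta> h \<gamma>) A = star f \<alpha> (h \<cdot> g) (star g \<beta> h \<gamma>) A"
        by (rule star_cong') (use a A in simp_all)
      also have "\<dots> = star (g \<cdot> f) (star f \<alpha> g \<beta>) h \<gamma> A"
        using star_assoc_at[of f "Dom S f" "Dom S g" g "Dom S h" h "Cod S h" \<alpha> \<beta> \<gamma> A] a A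
        by (simp add: Hom_def)
      also have "\<dots> = star (g \<cdot> f) (?star f \<alpha> g \<beta>) h \<gamma> A"
        by (rule star_cong') (use a A in simp_all)
      finally show ?thesis .
    qed
    then show "?star f \<alpha> (h \<cdot> g) (?star g \<beta> h \<gamma>) = ?star (g \<cdot> f) (?star f \<alpha> g \<beta>) h \<gamma>"
      using a by (intro ext) simp
  next
    fix p assume "p \<in> Sm S"
    then show "?sm p \<in> ?N p" using restrict_compat Sm by simp
  next
    fix z assume "z \<in> Cl S"
    then show "?cl z \<in> ?N z" using restrict_compat Cl(1) compat_cl by simp
  next
    fix p q assume a: "p \<in> Sm S" "q \<in> Sm S" "Cod S p = Dom S q"
    show "?sm (q \<cdot> p) = ?star p (?sm p) q (?sm q)"
    proof (intro ext)
      fix A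
      show "?sm (q \<cdot> p) A = ?star p (?sm p) q (?sm q) A"
        using star_cong'[of p q A "\<theta>sm p" "?sm p" "\<theta>sm q" "?sm q"] sm_comp[of p q A] a Sm by auto
    qed
  next
    fix y z assume a: "y \<in> Cl S" "z \<in> Cl S" "Cod S y = Dom S z"
    show "?cl (z \<cdot> y) = ?star y (?cl y) z (?cl z)"
    proof (intro ext)
      fix A
      show "?cl (z \<cdot> y) A = ?star y (?cl y) z (?cl z) A"
        using star_cong'[of y z A "\<theta>cl y" "?cl y" "\<theta>cl z" "?cl z"] cl_comp[of y z A] a Cl(1) by auto
    qed
  next
    fix X assume "X \<in> Ob S"
    then show "?sm (Ide S X) = ?cl (Ide S X)" using Ide by (auto simp: restrict_def)
  next
    fix p z p' z' assume a: "p \<in> Sm S" "z \<in> Cl S" "cartesian S p z p' z'"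
    note H = cartesian_Hom[OF a]
    have t: "p \<in> Arr S" "z \<in> Arr S" "p' \<in> Arr S" "z' \<in> Arr S" "Cod S z' = Dom S p" "Cod S p' = Dom S z"
      "Cod S z = Cod S p" using H by (simp_all add: Hom_def)
    show "?star z' (?cl z') p (?sm p) = ?star p' (?sm p') z (?cl z)"
    proof (intro ext)
      fix A
      show "?star z' (?cl z') p (?sm p) A = ?star p' (?sm p') z (?cl z) A"
        using star_cong'[of z' p A "\<theta>cl z'" "?cl z'" "\<theta>sm p" "?sm p"]
          star_cong'[of p' z A "\<theta>sm p'" "?sm p'" "\<theta>cl z" "?cl z"] cross[OF a] t by auto
    qed
  next
    fix p h assume a: "p \<in> Sm S" "p \<cdot> h \<in> Sm S" "h \<in> Cl S" "Cod S h = Dom S p"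
    show "?sm (p \<cdot> h) = ?star h (?cl h) p (?sm p)"
    proof (intro ext)
      fix A
      show "?sm (p \<cdot> h) A = ?star h (?cl h) p (?sm p) A"
        using star_cong'[of h p A "\<theta>cl h" "?cl h" "\<theta>sm p" "?sm p"] triangle[OF a, of A] a Cl(1) Sm(1) by auto
    qed
  qed
  let ?\<theta> = ext.ext
  have sm_eq: "?\<theta> p A = \<theta>sm p A" if "p \<in> Sm S" "A \<in> ?ob p" for p A
    using ext.ext_sm that by simp
  have cl_eq: "?\<theta> z A = \<theta>cl z A" if "z \<in> Cl S" "A \<in> ?ob z" for z A
    using ext.ext_cl that by simp
  have "pull_structure S H1 H2 R (Arr S) ?\<theta>"
    using pull_structure_Arr_iff[of ?\<theta>] ext.ext_in ext.ext_comp by simp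
  moreover have "left_adjointable S H1 H2 R ?\<theta>"
    unfolding left_adjointable_def
  proof (intro ballI)
    fix p A assume p: "p \<in> Sm S" and A: "A \<in> Ob (fib H1 (Dom S p))"
    interpret p1: adjunction "fib H1 (Dom S p)" "fib H1 (Cod S p)" "sharp H1 p" "pull H1 p"
      "sharp_unit H1 p" "sharp_counit H1 p"
      using one.sharp_adjunction[OF p] .
    have "is_iso (fib H2 (Cod S p)) (sharp_mate S H1 H2 R \<theta>sm p A)"
      using la p A by (simp add: left_adjointable_def)
    then show "is_iso (fib H2 (Cod S p)) (sharp_mate S H1 H2 R ?\<theta> p A)"
      using sm_eq[OF p, of "fo (sharp H1 p) A"] A by (simp add: sharp_mate_def)
  qed
  ultimately have loc: "localic_structure S H1 H2 R ?\<theta>" by (simp add: localic_structure_def)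
  have det: "determines S H1 H2 R ?\<theta> \<theta>sm \<omega>"
    unfolding determines_def pull_structure_eq_def push_structure_eq_def
  proof (intro conjI ballI)
    fix z B assume z: "z \<in> Cl S" and B: "B \<in> Ob (fib H1 (Dom S z))"
    interpret z1: adjunction "fib H1 (Cod S z)" "fib H1 (Dom S z)" "pull H1 z" "push H1 z"
      "push_unit H1 z" "push_counit H1 z"
      using one.push_adjunction[OF z] .
    have "push_mate S H1 H2 R ?\<theta> z B = push_mate S H1 H2 R (\<lambda>_. \<theta>cl z) z B"
      using cl_eq[OF z, of "fo (push H1 z) B"] B by (simp add: push_mate_def)
    then show "push_mate S H1 H2 R ?\<theta> z B = \<omega> z B"
      using push_mate_eq[OF z Cl(3)[OF z] Cl(2)[OF z] Cl(4)[OF z] B] by simp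
  qed (rule sm_eq)
  have unique: "pull_structure_eq S H1 (Arr S) \<theta>' ?\<theta>"
    if \<theta>': "localic_structure S H1 H2 R \<theta>'" and det': "determines S H1 H2 R \<theta>' \<theta>sm \<omega>" for \<theta>'
    unfolding pull_structure_eq_def
  proof (intro ballI)
    fix f A assume f: "f \<in> Arr S" and A: "A \<in> ?ob f"
    obtain t p where tp: "t \<in> Cl S" "p \<in> Sm S" "Cod S t = Dom S p" "f = p \<cdot> t"
      using factorization[OF f] by blast
    have arr: "t \<in> Arr S" "p \<in> Arr S" using tp Cl_Arr Sm_Arr by auto
    have A': "A \<in> ?ob p" using A tp arr by simp
    have t_eq: "\<theta>' t B = \<theta>cl t B" if B: "B \<in> ?ob t" for B
    proof -
      have n: "pull_natural t (\<theta>' t)"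
        using \<theta>' arr pull_structure_Arr_iff[of \<theta>'] compat_pull_natural
        by (simp add: localic_structure_def)
      have "push_mate S H1 H2 R (\<lambda>_. \<theta>' t) t C = \<omega> t C" if "C \<in> Ob (fib H1 (Dom S t))" for C
      proof -
        have "push_mate S H1 H2 R \<theta>' t C = \<omega> t C"
          using det' tp(1) that by (simp add: determines_def push_structure_eq_def)
        then show ?thesis using push_mate_cong[of \<theta>' t "\<lambda>_. \<theta>' t"] by simp
      qed
      then have "mated t (\<theta>' t) (\<omega> t)"
        using mated_push_mate[OF tp(1) n] by (simp add: mated_def)
      then show ?thesis using pull_mate_eq[OF tp(1) n Cl(2)[OF tp(1)] _ B] mate by simp
    qed
    have "\<theta>' f A = star t (\<theta>' t) p (\<theta>' p) A"
      using \<theta>' arr tp A' pull_structure_Arr_iff[of \<theta>'] by (simp add: localic_structure_def)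
    also have "\<dots> = star t (?cl t) p (?sm p) A"
      by (rule star_cong') (use arr tp A' t_eq det' in \<open>simp_all add: determines_def pull_structure_eq_def\<close>)
    also have "\<dots> = ?\<theta> f A" using ext.ext_eq[of t p] tp A' by simp
    finally show "\<theta>' f A = ?\<theta> f A" .
  qed
  show thesis by (rule that[OF loc det unique])
qed

end

theorem theorem3p10:
  fixes S :: "('s, 'a) basecat"
    and H1 :: "('s, 'a, 'o1, 'm1) fibcat_adj"
    and H2 :: "('s, 'a, 'o2, 'm2) fibcat_adj"
    and R :: "'s \<Rightarrow> ('o1, 'm1, 'o2, 'm2) tfctr"
  assumes "base_category S"
    and "localic_fibered_category S H1"
    and "localic_fibered_category S H2"
    and "\<And>X. X \<in> Ob S \<Longrightarrow> triangulated_functor (fib H1 X) (fib H2 X) (R X)"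
  shows "(\<forall>\<theta> \<theta>sm \<omega>. localic_structure S H1 H2 R \<theta> \<and> determines S H1 H2 R \<theta> \<theta>sm \<omega> \<longrightarrow>
            core S H1 H2 R \<theta>sm \<omega>) \<and>
         (\<forall>\<theta>sm \<omega>. core S H1 H2 R \<theta>sm \<omega> \<longrightarrow>
            (\<exists>\<theta>. localic_structure S H1 H2 R \<theta> \<and> determines S H1 H2 R \<theta> \<theta>sm \<omega> \<and>
              (\<forall>\<theta>'. localic_structure S H1 H2 R \<theta>' \<and> determines S H1 H2 R \<theta>' \<theta>sm \<omega> \<longrightarrow>
                 pull_structure_eq S H1 (Arr S) \<theta>' \<theta>)))"
proof -
  interpret localic_pair S H1 H2 R
    using assms by (intro localic_pair.intro localic.intro localic_pair_axioms.intro)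
  show ?thesis
    using localic_structure_core core_extends_uniquely by metis
qed

end
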